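(* With the notation of the context, for $n\ge1$ let $\hat a_n,\hat b_n,\hat c_n,\hat d_n,\hat e_n$ be the sums of the labels of the vertices of type $A,B,C,D,E$, respectively, on level $n$. Then $\hat a_1=\hat b_1=\hat c_1=\hat d_1=\hat e_1=0$ and for all $n\ge1$: \[ \begin{aligned} \hat{a}_{n+1}&= 2\hat{a}_n+2\hat{b}_n+6,\\ \hat{b}_{n+1}&= \hat{a}_n+2\hat{b}_n,\\ \hat{c}_{n+1}&= \hat{a}_n+3\hat{c}_n+2 \hat d_n,\\ \hat{d}_{n+1}&= \hat{b}_n+3\hat c_n+4\hat{d}_n+5\hat{e}_n,\\ \hat{e}_{n+1}&= 3 \hat{c}_n+4\hat{d}_n+6 \hat{e}_n . \end{aligned} \]
   Context: Consider the regular cubic honeycomb $\{4,3,5\}$ of hyperbolic 3-space (congruent cubes, five around each edge, icosahedral vertex figure). Fix a cube $Q_0$ and a vertex $V_0$ of it; $\mathcal P$ is the union of the cubes of the honeycomb lying in the closed region bounded by the three pairwise perpendicular honeycomb planes through $V_0$ containing the faces of $Q_0$ at $V_0$ (the side containing $Q_0$). $G_{\mathcal P}$ is the graph of vertices and edges of the honeycomb in $\mathcal P$. Each vertex $V$ of $G_{\mathcal P}$ is labelled by the number of distinct shortest paths in $G_{\mathcal P}$ from $V_0$ to $V$ (this labelled graph is the hyperbolic Pascal pyramid). Level $n$ is the set of vertices at graph distance $n$ from $V_0$; ascendants of a vertex on level $n\ge1$ are its neighbours on level $n-1$. On level $n\ge1$: vertices on an intersection line of two bounding planes (exactly 3 per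 level, each with label 1) have type "1"; other vertices on a bounding plane have type $A$ (2 ascendants) or $B$ (1 ascendant); vertices off the bounding planes have type $C$, $D$, $E$ (3, 2, 1 ascendants).
   Formalization: Faces of a cube meet at 72°, so perpendicular planes containing them do not exist; each bounding plane is taken as the {4,5} mosaic of honeycomb squares continuing a face of Q_0 at V_0, and P as the cubes reachable from Q_0 without crossing these mosaics. *)

theory Defs
  imports "HOL-Analysis.Analysis"
begin

section \<open>The honeycomb {4,3,5} in the hyperboloid model of hyperbolic 3-space\<close>

type_synonym mink = "real \<times> (real ^ 3)"

definition lorentz :: "mink \<Rightarrow> mink \<Rightarrow> real" where
  "lorentz x y = snd x \<bullet> snd y - fst x * fst y"

definition hyperbolic_space :: "mink set" where
  "hyperbolic_space = {x. lorentz x x = -1 \<and> fst x > 0}"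

text \<open>For spacelike \<open>n\<close> this is the hyperbolic reflection in the plane
  \<open>{x \<in> hyperbolic_space. lorentz x n = 0}\<close>.\<close>

definition reflection :: "mink \<Rightarrow> mink \<Rightarrow> mink" where
  "reflection n x = x - (2 * lorentz x n / lorentz n n) *\<^sub>R n"

text \<open>The reflection in the plane spanned by \<open>T\<close>; a singleton if \<open>T\<close> consists of the vertices of
  a square.\<close>

definition reflections_in :: "mink set \<Rightarrow> (mink \<Rightarrow> mink) set" where
  "reflections_in T = {reflection n |n. lorentz n n > 0 \<and> (\<forall>x\<in>T. lorentz x n = 0)}"

text \<open>Cubes, squares and edges are represented by their sets of vertices. The cube with vertices
  \<open>(t, \<plusminus>s, \<plusminus>s, \<plusminus>s)\<close> lies in hyperbolic space iff \<open>t\<^sup>2 - 3 * s\<^sup>2 = 1\<close>. Its faces have outer normals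
  \<open>(s, \<plusminus>t * e\<^sub>i)\<close>, so the cosine of its dihedral angle is \<open>s\<^sup>2 / (t\<^sup>2 - s\<^sup>2)\<close>, which for the values
  below is \<open>(sqrt 5 - 1) / 4 = cos (2 * pi / 5)\<close>: five cubes fit around each edge.\<close>

definition cube_t :: real where "cube_t = (3 + sqrt 5) / (2 * sqrt 2)"

definition cube_s :: real where "cube_s = sqrt (1 + sqrt 5) / 2"

definition base_cube :: "mink set" where
  "base_cube = {x. fst x = cube_t \<and> (\<forall>i. \<bar>snd x $ i\<bar> = cube_s)}"

lemma base_cube_subset_hyperbolic_space: "base_cube \<subseteq> hyperbolic_space"
proof
  fix x assume x: "x \<in> base_cube"
  have "(snd x $ i)\<^sup>2 = (1 + sqrt 5) / 4" for i
  proof -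
    have "(snd x $ i)\<^sup>2 = cube_s\<^sup>2"
      using x by (metis (mono_tags, lifting) base_cube_def mem_Collect_eq power2_abs)
    then show ?thesis by (simp add: cube_s_def power_divide)
  qed
  then have "snd x \<bullet> snd x = 3 * ((1 + sqrt 5) / 4)"
    by (simp add: inner_vec_def sum_3 flip: power2_eq_square)
  moreover have "fst x * fst x = (7 + 3 * sqrt 5) / 4"
  proof -
    have "cube_t * cube_t = ((3 + sqrt 5) * (3 + sqrt 5)) / 8"
      by (simp add: cube_t_def)
    also have "\<dots> = (7 + 3 * sqrt 5) / 4"
      by (simp add: algebra_simps)
    finally show ?thesis
      using x by (simp add: base_cube_def)
  qed
  moreover have "fst x > 0"
    using x by (simp add: base_cube_def cube_t_def add_pos_nonneg)
  ultimately show "x \<in> hyperbolic_space"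
    by (simp add: hyperbolic_space_def lorentz_def field_simps)
qed

definition base_squares :: "mink set set" where
  "base_squares = {{x \<in> base_cube. snd x $ i = a} |i a. \<bar>a\<bar> = cube_s}"

definition base_edges :: "mink set set" where
  "base_edges = {{x \<in> base_cube. snd x $ i = a \<and> snd x $ j = b} |i j a b.
     i \<noteq> j \<and> \<bar>a\<bar> = cube_s \<and> \<bar>b\<bar> = cube_s}"

text \<open>Reflecting a cube of the honeycomb in one of its faces gives the neighbouring cube. Hence
  the cubes of the honeycomb are the images of one of them under the group generated by the
  reflections in its six faces.\<close>

inductive_set honeycomb_group :: "(mink \<Rightarrow> mink) set" where
  id: "id \<in> honeycomb_group"
| step: "g \<circ> r \<in> honeycomb_group"
    if "g \<in> honeycomb_group" and "T \<in> base_squares" and "r \<in> reflections_in T"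

definition cubes :: "mink set set" where
  "cubes = {g ` base_cube |g. g \<in> honeycomb_group}"

definition squares :: "mink set set" where
  "squares = {g ` T |g T. g \<in> honeycomb_group \<and> T \<in> base_squares}"

definition edges :: "mink set set" where
  "edges = {g ` e |g e. g \<in> honeycomb_group \<and> e \<in> base_edges}"

definition faces_of :: "mink set \<Rightarrow> mink set set" where
  "faces_of Q = {T \<in> squares. T \<subseteq> Q}"

section \<open>The pyramid\<close>

text \<open>As the dihedral angle is 72 degrees, a geodesic plane containing a square of the honeycomb is
  not a union of squares: behind each edge of the square it enters the interior of a cube. The
  honeycomb plane through the face \<open>F\<close> of the cube \<open>Q\<close> is the mosaic {4,5} of squares of the
  honeycomb that continues \<open>F\<close> across its edges, with two cubes at each edge on the side of \<open>Q\<close>.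
  It is the orbit of \<open>F\<close> under the reflections in the four faces of \<open>Q\<close> that share an edge with
  \<open>F\<close>. All these reflections preserve the geodesic plane halving \<open>Q\<close> parallel to \<open>F\<close>, from which
  the honeycomb plane has constant distance on its vertices; for the three faces of \<open>Q\<close> at a vertex
  these halving planes are pairwise perpendicular.\<close>

inductive_set honeycomb_plane :: "mink set \<Rightarrow> mink set \<Rightarrow> mink set set"
  for Q :: "mink set" and F :: "mink set" where
  base: "F \<in> honeycomb_plane Q F"
| step: "r ` S \<in> honeycomb_plane Q F"
    if "S \<in> honeycomb_plane Q F" and "T \<in> faces_of Q" and "T \<inter> F \<in> edges"
      and "r \<in> reflections_in T"

definition corner_faces :: "mink set \<Rightarrow> mink \<Rightarrow> mink set set" where
  "corner_faces Q0 V0 = {F \<in> faces_of Q0. V0 \<in> F}"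

text \<open>The region bounded by the three honeycomb planes, on the side of \<open>Q0\<close>: the cubes that can be
  reached from \<open>Q0\<close> by passing through squares that belong to none of the three planes.\<close>

inductive_set pyramid_cubes :: "mink set \<Rightarrow> mink \<Rightarrow> mink set set"
  for Q0 :: "mink set" and V0 :: mink where
  base: "Q0 \<in> pyramid_cubes Q0 V0"
| step: "R \<in> pyramid_cubes Q0 V0"
    if "Q \<in> pyramid_cubes Q0 V0" and "R \<in> cubes" and "T \<in> faces_of Q" and "T \<in> faces_of R"
      and "\<forall>F\<in>corner_faces Q0 V0. T \<notin> honeycomb_plane Q0 F"

definition pyramid_vertices :: "mink set \<Rightarrow> mink \<Rightarrow> mink set" where
  "pyramid_vertices Q0 V0 = \<Union> (pyramid_cubes Q0 V0)"

definition pyramid_edges :: "mink set \<Rightarrow> mink \<Rightarrow> mink set set" where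
  "pyramid_edges Q0 V0 = {e \<in> edges. \<exists>Q\<in>pyramid_cubes Q0 V0. e \<subseteq> Q}"

definition paths_to :: "mink set \<Rightarrow> mink \<Rightarrow> mink \<Rightarrow> mink list set" where
  "paths_to Q0 V0 V = {p. p \<noteq> [] \<and> hd p = V0 \<and> last p = V \<and>
     successively (\<lambda>x y. {x, y} \<in> pyramid_edges Q0 V0) p}"

definition shortest_paths_to :: "mink set \<Rightarrow> mink \<Rightarrow> mink \<Rightarrow> mink list set" where
  "shortest_paths_to Q0 V0 V =
     {p \<in> paths_to Q0 V0 V. \<forall>q\<in>paths_to Q0 V0 V. length p \<le> length q}"

definition label :: "mink set \<Rightarrow> mink \<Rightarrow> mink \<Rightarrow> nat" where
  "label Q0 V0 V = card (shortest_paths_to Q0 V0 V)"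

text \<open>A path of length \<open>n\<close> is a list of \<open>n + 1\<close> vertices.\<close>

definition level :: "mink set \<Rightarrow> mink \<Rightarrow> nat \<Rightarrow> mink set" where
  "level Q0 V0 n =
     {V \<in> pyramid_vertices Q0 V0. \<exists>p\<in>shortest_paths_to Q0 V0 V. length p = n + 1}"

text \<open>Only used for vertices \<open>V\<close> on level \<open>n\<close> with \<open>n \<ge> 1\<close>.\<close>

definition ascendants :: "mink set \<Rightarrow> mink \<Rightarrow> nat \<Rightarrow> mink \<Rightarrow> mink set" where
  "ascendants Q0 V0 n V = {U \<in> level Q0 V0 (n - 1). {U, V} \<in> pyramid_edges Q0 V0}"

definition planes_at :: "mink set \<Rightarrow> mink \<Rightarrow> mink \<Rightarrow> mink set set" where
  "planes_at Q0 V0 V = {F \<in> corner_faces Q0 V0. V \<in> \<Union> (honeycomb_plane Q0 F)}"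

text \<open>The vertices on level \<open>n\<close> that lie on exactly \<open>k\<close> of the bounding planes and have exactly
  \<open>m\<close> ascendants. Type A is \<open>k = 1\<close>, \<open>m = 2\<close>; type B is \<open>k = 1\<close>, \<open>m = 1\<close>; types C, D, E are
  \<open>k = 0\<close> and \<open>m = 3, 2, 1\<close>. The vertices of type "1" are those with \<open>k \<ge> 2\<close>.\<close>

definition vertices_of_type :: "mink set \<Rightarrow> mink \<Rightarrow> nat \<Rightarrow> nat \<Rightarrow> nat \<Rightarrow> mink set" where
  "vertices_of_type Q0 V0 k m n =
     {V \<in> level Q0 V0 n. card (planes_at Q0 V0 V) = k \<and> card (ascendants Q0 V0 n V) = m}"

definition a_hat :: "mink set \<Rightarrow> mink \<Rightarrow> nat \<Rightarrow> nat" where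
  "a_hat Q0 V0 n = (\<Sum>V\<in>vertices_of_type Q0 V0 1 2 n. label Q0 V0 V)"

definition b_hat :: "mink set \<Rightarrow> mink \<Rightarrow> nat \<Rightarrow> nat" where
  "b_hat Q0 V0 n = (\<Sum>V\<in>vertices_of_type Q0 V0 1 1 n. label Q0 V0 V)"

definition c_hat :: "mink set \<Rightarrow> mink \<Rightarrow> nat \<Rightarrow> nat" where
  "c_hat Q0 V0 n = (\<Sum>V\<in>vertices_of_type Q0 V0 0 3 n. label Q0 V0 V)"

definition d_hat :: "mink set \<Rightarrow> mink \<Rightarrow> nat \<Rightarrow> nat" where
  "d_hat Q0 V0 n = (\<Sum>V\<in>vertices_of_type Q0 V0 0 2 n. label Q0 V0 V)"

definition e_hat :: "mink set \<Rightarrow> mink \<Rightarrow> nat \<Rightarrow> nat" where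
  "e_hat Q0 V0 n = (\<Sum>V\<in>vertices_of_type Q0 V0 0 1 n. label Q0 V0 V)"

end

theory Submission
  imports Defs
begin

text \<open>Every edge of the honeycomb is bisected by a totally geodesic plane. The twelve such planes around a
  vertex bound a right-angled dodecahedron, so the reflections in them generate a right-angled
  Coxeter group \<open>W\<close> acting simply transitively on the vertices: the honeycomb graph is the Cayley
  graph of \<open>W\<close>, and the cells at a vertex correspond to the cliques of the icosahedron formed by the
  twelve generators. The neighbours of \<open>w\<close> that are closer to the identity are \<open>w s\<close> for \<open>s\<close> in the
  descent set of \<open>w\<close>, which is a clique; if \<open>s\<close> is not a descent, the descents of \<open>w s\<close> are \<open>s\<close> and
  the descents of \<open>w\<close> commuting with \<open>s\<close>. Let \<open>i\<close> range over the three generators given by the edges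
  of the cube at the given vertex. The bounding honeycomb plane through the other two edges is the
  subgroup generated by the five neighbours of \<open>i\<close>, and the pyramid consists of the \<open>w\<close> that, for
  each \<open>i\<close>, lie in this subgroup or beyond the wall of \<open>i\<close>. Whether \<open>w s\<close> is a child in the pyramid, and of which type,
  thus depends only on the planes and descents of \<open>w\<close>; the coefficients of the recurrences count
  vertices of the icosahedron by their adjacency to a clique.\<close>

subsection \<open>Lorentz isometries\<close>

text \<open>The definitions use reflections in faces of cubes, whose mirrors run through the
  interior of other cubes, and honeycomb planes, which are not geodesic. Neither gives a direct test
  by signs. The bisecting walls do: no vertex is closer to a wall than half an edge, so products
  with a unit normal are never strictly between \<open>- cube_s\<close> and \<open>cube_s\<close>,
  and a bounding plane consists exactly of the vertices with product \<open>- cube_s\<close> to one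
  fixed wall. The same gap carries the theory of word length, which is an induction on signs of
  \<open>lorentz\<close> products and needs no general Coxeter theory. To get back to the
  definitions, a group \<open>G\<close> is used that contains both \<open>W\<close> and the group of
  face reflections. The delicate point is the pyramid: its cubes are defined by chains through
  squares off the planes. That such chains stay within the three inequalities is local; that they
  reach every permitted cube needs a walk through the triangles around each vertex towards a
  descent.\<close>

definition lorentz_isometry :: "(mink \<Rightarrow> mink) \<Rightarrow> bool" where
  "lorentz_isometry g \<longleftrightarrow> linear g \<and> (\<forall>x y. lorentz (g x) (g y) = lorentz x y)"

lemma lorentz_add_left: "lorentz (x + y) z = lorentz x z + lorentz y z"
  and lorentz_add_right: "lorentz z (x + y) = lorentz z x + lorentz z y"
  and lorentz_diff_left: "lorentz (x - y) z = lorentz x z - lorentz y z"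
  and lorentz_diff_right: "lorentz z (x - y) = lorentz z x - lorentz z y"
  and lorentz_minus_left: "lorentz (- x) z = - lorentz x z"
  and lorentz_minus_right: "lorentz z (- x) = - lorentz z x"
  and lorentz_scale_left: "lorentz (c *\<^sub>R x) z = c * lorentz x z"
  and lorentz_scale_right: "lorentz z (c *\<^sub>R x) = c * lorentz z x"
  by (simp_all add: lorentz_def inner_add_left inner_add_right inner_diff_left inner_diff_right
      algebra_simps)

lemmas lorentz_bilinear = lorentz_add_left lorentz_add_right lorentz_diff_left lorentz_diff_right
  lorentz_minus_left lorentz_minus_right lorentz_scale_left lorentz_scale_right

lemma lorentz_commute: "lorentz x y = lorentz y x"
  by (simp add: lorentz_def inner_commute mult.commute)

lemma isometry_linear: "lorentz_isometry g \<Longrightarrow> linear g"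
  by (simp add: lorentz_isometry_def)

lemma isometry_lorentz: "lorentz_isometry g \<Longrightarrow> lorentz (g x) (g y) = lorentz x y"
  unfolding lorentz_isometry_def by blast

lemma lorentz_isometryI:
  "linear g \<Longrightarrow> (\<And>x y. lorentz (g x) (g y) = lorentz x y) \<Longrightarrow> lorentz_isometry g"
  by (simp add: lorentz_isometry_def)

lemma lorentz_isometry_id: "lorentz_isometry id"
  by (simp add: lorentz_isometry_def linear_id)

lemma lorentz_isometry_comp:
  "lorentz_isometry g \<Longrightarrow> lorentz_isometry h \<Longrightarrow> lorentz_isometry (g \<circ> h)"
  by (intro lorentz_isometryI) (auto simp: isometry_linear isometry_lorentz linear_compose)

lemma linear_reflection: "linear (reflection n)"
  by (rule linearI)
    (simp_all add: reflection_def lorentz_bilinear algebra_simps add_divide_distrib)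

lemma lorentz_isometry_reflection:
  assumes "lorentz n n \<noteq> 0"
  shows "lorentz_isometry (reflection n)"
proof -
  have "lorentz (reflection n x) (reflection n y) = lorentz x y" for x y
    using assms lorentz_commute[of n y] lorentz_commute[of n x]
    by (simp add: reflection_def lorentz_bilinear field_simps)
  then show ?thesis
    by (simp add: lorentz_isometry_def linear_reflection)
qed

lemma reflection_reflection:
  assumes "lorentz n n \<noteq> 0"
  shows "reflection n (reflection n x) = x"
proof -
  have "lorentz (reflection n x) n = - lorentz x n"
    using assms by (simp add: reflection_def lorentz_bilinear)
  then show ?thesis
    by (simp add: reflection_def[of n "reflection n x"]) (simp add: reflection_def)
qed

lemma reflection_scale:
  assumes "c \<noteq> 0"
  shows "reflection (c *\<^sub>R n) = reflection n"
  using assms by (auto simp: reflection_def lorentz_bilinear fun_eq_iff)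

lemma isometry_reflection:
  assumes "lorentz_isometry g"
  shows "g (reflection n x) = reflection (g n) (g x)"
  using assms
  by (simp add: reflection_def isometry_lorentz isometry_linear linear_diff linear_scale)

section \<open>Future vectors and causal signs\<close>

definition future :: "mink \<Rightarrow> bool" where
  "future x \<longleftrightarrow> lorentz x x < 0 \<and> fst x > 0"

text \<open>The reversed Cauchy-Schwarz inequality as a sign: time coordinates dominate spatial
  norms, so the product of the times outweighs the spatial inner product.\<close>

lemma future_causal:
  assumes x: "future x" and c: "lorentz c c \<le> 0" and pos: "fst c > 0"
  shows "lorentz x c < 0"
proof -
  have "norm (snd x) ^ 2 < fst x ^ 2" "norm (snd c) ^ 2 \<le> fst c ^ 2"
    using x c by (simp_all add: future_def lorentz_def power2_norm_eq_inner) (simp_all add: power2_eq_square)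
  then have "norm (snd x) < fst x" "norm (snd c) \<le> fst c"
    using x pos by (auto simp: future_def intro: power2_less_imp_less power2_le_imp_le)
  then have "norm (snd x) * norm (snd c) < fst x * fst c"
    using pos by (smt (verit) mult_left_mono mult_strict_right_mono norm_ge_zero)
  then show ?thesis
    using norm_cauchy_schwarz[of "snd x" "snd c"] by (simp add: lorentz_def)
qed

text \<open>A nonzero causal vector points to the future or to the past and then has one strict sign
  against all future vectors.\<close>

lemma causal_sign:
  assumes x: "future x" and y: "future y" and c: "lorentz c c \<le> 0"
    and xc: "lorentz x c \<ge> 0" and yc: "lorentz y c \<le> 0"
  shows "c = 0"
proof -
  have "\<not> fst c > 0"
    using future_causal[OF x c] xc by auto
  moreover have "\<not> fst c < 0"
    using future_causal[OF y, of "- c"] c yc by (auto simp: lorentz_bilinear)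
  ultimately have 0: "fst c = 0" by simp
  then have "snd c = 0"
    using c inner_gt_zero_iff[of "snd c"] unfolding lorentz_def by fastforce
  with 0 show ?thesis by (simp add: prod_eq_iff)
qed

text \<open>The image cannot change to the other sheet of the cone, because the product of
  \<open>x\<close> with it is \<open>lorentz x x\<close> minus a nonnegative term.\<close>

lemma future_reflection:
  assumes n: "lorentz n n > 0" and x: "future x"
  shows "future (reflection n x)"
proof -
  let ?y = "reflection n x"
  have yy: "lorentz ?y ?y < 0"
    using n x by (simp add: isometry_lorentz[OF lorentz_isometry_reflection] future_def)
  have "lorentz x ?y = lorentz x x - 2 * (lorentz x n)\<^sup>2 / lorentz n n"
    by (simp add: reflection_def lorentz_bilinear power2_eq_square)
  also have "\<dots> < 0"
    using x n by (smt (verit) future_def zero_le_divide_iff zero_le_power2)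
  finally have xy: "lorentz x ?y < 0" .
  have "fst ?y \<noteq> 0"
    using yy inner_ge_zero[of "snd ?y"] unfolding lorentz_def by fastforce
  moreover have "\<not> fst ?y < 0"
    using future_causal[OF x, of "- ?y"] yy xy by (auto simp: lorentz_bilinear)
  ultimately show ?thesis
    using yy by (simp add: future_def)
qed

subsection \<open>Groups generated by involutions\<close>

text \<open>Closed under products only; the generating sets below consist of involutions, so
  inverses come for free by \<open>generated_inverse\<close>.\<close>

inductive_set generated :: "('a \<Rightarrow> 'a) set \<Rightarrow> ('a \<Rightarrow> 'a) set" for S where
  id: "id \<in> generated S"
| step: "s \<circ> g \<in> generated S" if "s \<in> S" "g \<in> generated S"

lemma generated_comp: "g \<in> generated S \<Longrightarrow> h \<in> generated S \<Longrightarrow> g \<circ> h \<in> generated S"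
proof (induction rule: generated.induct)
  case (step s g)
  then show ?case
    unfolding comp_assoc by (blast intro: generated.step)
qed (simp only: id_comp)

lemma generated_base: "s \<in> S \<Longrightarrow> s \<in> generated S"
  using generated.step[OF _ generated.id, of s S] by simp

lemma generated_right: "g \<in> generated S \<Longrightarrow> s \<in> S \<Longrightarrow> g \<circ> s \<in> generated S"
  by (rule generated_comp[OF _ generated_base])

lemma generated_subset:
  assumes "S \<subseteq> generated T"
  shows "generated S \<subseteq> generated T"
proof
  fix g assume "g \<in> generated S"
  then show "g \<in> generated T"
    by induction (use assms generated.id generated_comp in blast)+
qed

text \<open>The defining rule extends words on the left, whereas a step from a vertex to its
  neighbour extends them on the right.\<close>

lemma generated_induct_right [consumes 1, case_names id step]:
  assumes "g \<in> generated S" and "P id"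
    and st: "\<And>g s. g \<in> generated S \<Longrightarrow> P g \<Longrightarrow> s \<in> S \<Longrightarrow> P (g \<circ> s)"
  shows "P g"
proof -
  have "h \<in> generated S \<Longrightarrow> P h \<Longrightarrow> P (h \<circ> g)" for h
    using assms(1)
  proof (induction arbitrary: h)
    case (step s g)
    then have "P ((h \<circ> s) \<circ> g)"
      by (intro step.IH st generated_right)
    then show ?case unfolding comp_assoc .
  qed (simp only: comp_id)
  from this[OF generated.id assms(2)] show ?thesis by simp
qed

lemma generated_inverse:
  assumes "g \<in> generated S" and inv: "\<And>s. s \<in> S \<Longrightarrow> s \<circ> s = id"
  obtains h where "h \<in> generated S" "h \<circ> g = id" "g \<circ> h = id"
proof -
  have "\<exists>h\<in>generated S. h \<circ> g = id \<and> g \<circ> h = id"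
    using assms(1)
  proof induction
    case id
    show ?case using generated.id comp_id by blast
  next
    case (step s g)
    then obtain h where h: "h \<in> generated S" "h \<circ> g = id" "g \<circ> h = id" by blast
    have "(h \<circ> s) \<circ> (s \<circ> g) = h \<circ> (s \<circ> s) \<circ> g" "(s \<circ> g) \<circ> (h \<circ> s) = s \<circ> (g \<circ> h) \<circ> s"
      by (simp_all add: fun_eq_iff)
    then have "(h \<circ> s) \<circ> (s \<circ> g) = id" "(s \<circ> g) \<circ> (h \<circ> s) = id"
      using h inv[OF step.hyps(1)] by simp_all
    then show ?case
      using generated_right[OF h(1) step.hyps(1)] by blast
  qed
  then show ?thesis using that by blast
qed

lemma generated_isometry:
  assumes "g \<in> generated S" and "\<And>s. s \<in> S \<Longrightarrow> lorentz_isometry s"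
  shows "lorentz_isometry g"
  using assms by induction (auto intro: lorentz_isometry_id lorentz_isometry_comp)

lemma generated_fixes:
  assumes "g \<in> generated S" and "\<And>s. s \<in> S \<Longrightarrow> s x = x"
  shows "g x = x"
  using assms by induction auto

subsection \<open>The icosahedral vertex figure\<close>

text \<open>The vertices of an icosahedron. \<open>X0\<close>, \<open>X1\<close>, \<open>X2\<close>
  belong to the three edges of the base cube at \<open>corner\<close>; \<open>Y0\<close> is the
  other common neighbour of \<open>X1\<close> and \<open>X2\<close>; \<open>U0\<close> is antipodal
  to \<open>X0\<close> and \<open>Z0\<close> to \<open>Y0\<close>. The other indices follow by
  symmetry.\<close>

datatype wall = X0 | X1 | X2 | Y0 | Y1 | Y2 | Z0 | Z1 | Z2 | U0 | U1 | U2

fun nbrs :: "wall \<Rightarrow> wall list" where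
  "nbrs X0 = [X1, X2, Y1, Y2, Z0]"
| "nbrs X1 = [X0, X2, Y0, Y2, Z1]"
| "nbrs X2 = [X0, X1, Y0, Y1, Z2]"
| "nbrs Y0 = [X1, X2, Z1, Z2, U0]"
| "nbrs Y1 = [X0, X2, Z0, Z2, U1]"
| "nbrs Y2 = [X0, X1, Z0, Z1, U2]"
| "nbrs Z0 = [X0, Y1, Y2, U1, U2]"
| "nbrs Z1 = [X1, Y0, Y2, U0, U2]"
| "nbrs Z2 = [X2, Y0, Y1, U0, U1]"
| "nbrs U0 = [Y0, Z1, Z2, U1, U2]"
| "nbrs U1 = [Y1, Z0, Z2, U0, U2]"
| "nbrs U2 = [Y2, Z0, Z1, U0, U1]"

definition adj :: "wall \<Rightarrow> wall \<Rightarrow> bool" where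
  "adj a b \<longleftrightarrow> b \<in> set (nbrs a)"

definition walls :: "wall list" where
  "walls = [X0, X1, X2, Y0, Y1, Y2, Z0, Z1, Z2, U0, U1, U2]"

definition axes :: "wall set" where
  "axes = {X0, X1, X2}"

lemma set_walls: "set walls = UNIV"
proof -
  have "m \<in> set walls" for m
    by (cases m) (simp_all add: walls_def)
  then show ?thesis by blast
qed

lemma distinct_walls: "distinct walls"
  by (simp add: walls_def)

instance wall :: finite
  by standard (metis List.finite_set set_walls)

lemma adj_irrefl [simp]: "\<not> adj a a"
  by (cases a) (simp_all add: adj_def)

lemma adj_sym: "adj a b \<longleftrightarrow> adj b a"
proof -
  have "list_all (\<lambda>a. list_all (\<lambda>b. adj a b = adj b a) walls) walls"
    by code_simp
  then show ?thesis by (simp add: list_all_iff set_walls)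
qed

definition clique :: "wall set \<Rightarrow> bool" where
  "clique S \<longleftrightarrow> (\<forall>a\<in>S. \<forall>b\<in>S. a \<noteq> b \<longrightarrow> adj a b)"

lemma clique_subset: "clique S \<Longrightarrow> T \<subseteq> S \<Longrightarrow> clique T"
  by (auto simp: clique_def)

text \<open>Every ordering of every nonempty clique is listed, so properties of cliques become
  finite checks by evaluation.\<close>

definition cliques :: "wall list list" where
  "cliques = map (\<lambda>a. [a]) walls
    @ concat (map (\<lambda>a. map (\<lambda>b. [a, b]) (nbrs a)) walls)
    @ concat (map (\<lambda>a. concat (map (\<lambda>b. map (\<lambda>c. [a, b, c]) (filter (adj b) (nbrs a))) (nbrs a)))
        walls)"

text \<open>Since descent sets are cliques, this bounds the number of ascendants by three.\<close>

lemma no_4_clique: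
  assumes "adj a b" "adj a c" "adj a d" "adj b c" "adj b d" "adj c d"
  shows False
proof -
  have "list_all (\<lambda>a. list_all (\<lambda>b. list_all (\<lambda>c. list_all (\<lambda>d. \<not> (adj b d \<and> adj c d)) (nbrs a))
      (filter (adj b) (nbrs a))) (nbrs a)) walls"
    by code_simp
  then have "\<forall>a. \<forall>b\<in>set (nbrs a). \<forall>c\<in>set (filter (adj b) (nbrs a)). \<forall>d\<in>set (nbrs a).
      \<not> (adj b d \<and> adj c d)"
    unfolding list_all_iff set_walls by blast
  moreover have "b \<in> set (nbrs a)" "c \<in> set (filter (adj b) (nbrs a))" "d \<in> set (nbrs a)"
    using assms by (simp_all add: adj_def)
  ultimately show False
    using assms by blast
qed

lemma cliques_1: "[a] \<in> set cliques"
  unfolding cliques_def set_append set_map set_walls by simp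

lemma cliques_2: "adj a b \<Longrightarrow> [a, b] \<in> set cliques"
  unfolding cliques_def set_append set_concat set_map set_walls
  by (intro UnI2 UnI1 UN_I[of "map (\<lambda>b. [a, b]) (nbrs a)"] UN_I[of a] rangeI) (simp_all add: adj_def)

lemma cliques_3: "adj a b \<Longrightarrow> adj a c \<Longrightarrow> adj b c \<Longrightarrow> [a, b, c] \<in> set cliques"
  unfolding cliques_def set_append set_concat set_map set_walls
  by (intro UnI2 UN_I[of "concat (map (\<lambda>b. map (\<lambda>c. [a, b, c]) (filter (adj b) (nbrs a))) (nbrs a))"]
      rangeI) (force simp: adj_def)

lemma clique_list:
  assumes "clique S" "S \<noteq> {}"
  obtains xs where "xs \<in> set cliques" "distinct xs" "S = set xs"
proof -
  obtain a where a: "a \<in> S" using assms(2) by blast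
  show ?thesis
  proof (cases "S = {a}")
    case True
    then show ?thesis using that[OF cliques_1[of a]] by simp
  next
    case False
    then obtain b where b: "b \<in> S" "b \<noteq> a" using a by blast
    then have ab: "adj a b" using a assms(1) by (auto simp: clique_def)
    show ?thesis
    proof (cases "S = {a, b}")
      case True
      then show ?thesis
        using that[OF cliques_2[OF ab]] b by simp
    next
      case False
      then obtain c where c: "c \<in> S" "c \<noteq> a" "c \<noteq> b" using a b by blast
      then have ac: "adj a c" "adj b c" using a b assms(1) by (auto simp: clique_def)
      have "S = {a, b, c}"
      proof (rule ccontr)
        assume "S \<noteq> {a, b, c}"
        then obtain d where d: "d \<in> S" "d \<noteq> a" "d \<noteq> b" "d \<noteq> c" using a b c by blast
        then have "adj a d" "adj b d" "adj c d" using a b c assms(1) by (auto simp: clique_def)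
        then show False using no_4_clique ab ac by blast
      qed
      then show ?thesis
        using that[OF cliques_3[OF ab ac]] b c by simp
    qed
  qed
qed

text \<open>The mirror symmetry of the icosahedron that exchanges \<open>Xj\<close> with
  \<open>Yj\<close> and fixes the other two axes; \<open>turn_nrm\<close> identifies it as the
  effect of a face reflection. Arguments \<open>j\<close> outside \<open>axes\<close> get the
  identity as a default.\<close>

definition face_perm :: "wall \<Rightarrow> wall \<Rightarrow> wall" where
  "face_perm j m = (case j of
     X0 \<Rightarrow> (case m of X0 \<Rightarrow> Y0 | Y0 \<Rightarrow> X0 | Y1 \<Rightarrow> Z2 | Y2 \<Rightarrow> Z1
        | Z0 \<Rightarrow> U0 | Z1 \<Rightarrow> Y2 | Z2 \<Rightarrow> Y1 | U0 \<Rightarrow> Z0 | _ \<Rightarrow> m)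
   | X1 \<Rightarrow> (case m of X1 \<Rightarrow> Y1 | Y0 \<Rightarrow> Z2 | Y1 \<Rightarrow> X1 | Y2 \<Rightarrow> Z0
        | Z0 \<Rightarrow> Y2 | Z1 \<Rightarrow> U1 | Z2 \<Rightarrow> Y0 | U1 \<Rightarrow> Z1 | _ \<Rightarrow> m)
   | X2 \<Rightarrow> (case m of X2 \<Rightarrow> Y2 | Y0 \<Rightarrow> Z1 | Y1 \<Rightarrow> Z0 | Y2 \<Rightarrow> X2
        | Z0 \<Rightarrow> Y1 | Z1 \<Rightarrow> Y0 | Z2 \<Rightarrow> U2 | U2 \<Rightarrow> Z2 | _ \<Rightarrow> m)
   | _ \<Rightarrow> m)"

text \<open>Witnesses of transitivity: the twenty words carry the triangle of the three axes to the
  twenty triangles of the icosahedron.\<close>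

definition words :: "wall list list" where
  "words = [[], [X0], [X1], [X2], [X1, X0], [X2, X0], [X0, X1], [X2, X1], [X0, X2], [X1, X2],
    [X2, X1, X0], [X1, X2, X0], [X2, X0, X1], [X0, X2, X1], [X1, X0, X2], [X0, X1, X2],
    [X0, X2, X1, X0], [X0, X1, X2, X0], [X1, X2, X0, X1], [X1, X0, X2, X1, X0]]"

definition triangles :: "wall list list" where
  "triangles = [[X0, X1, X2], [Y0, X1, X2], [X0, Y1, X2], [X0, X1, Y2], [Z2, Y1, X2], [Z1, X1, Y2], [Y0,
    Z2, X2], [X0, Z0, Y2], [Y0, X1, Z1], [X0, Y1, Z0], [U2, Z0, Y2], [U1, Y1, Z0], [Z1,
    U2, Y2], [Y0, U0, Z1], [Z2, Y1, U1], [Y0, Z2, U0], [U2, U0, Z1], [U1, Z2, U0], [U1,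
    U2, Z0], [U2, U0, U1]]"

lemma triangles_words: "triangles = map (\<lambda>js. map (foldr face_perm js) [X0, X1, X2]) words"
  by (simp add: triangles_def words_def face_perm_def)

lemma clique_triangle:
  assumes "clique S" "S \<noteq> {}"
  obtains t where "t \<in> set triangles" "S \<subseteq> set t"
proof -
  obtain xs where xs: "xs \<in> set cliques" "S = set xs"
    using clique_list[OF assms] by metis
  have "list_all (\<lambda>xs. list_ex (\<lambda>t. list_all (\<lambda>x. x \<in> set t) xs) triangles) cliques"
    by code_simp
  then have "\<exists>t\<in>set triangles. set xs \<subseteq> set t"
    using xs(1) unfolding list_all_iff list_ex_iff by blast
  then show ?thesis using that xs(2) by blast
qed

text \<open>Every clique lies in a triangle, and face permutations are transitive on triangles.
  Geometrically, every cell at a vertex is a symmetric image of a face of the base cube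
  there.\<close>

lemma clique_transitive:
  assumes "clique S" "S \<noteq> {}"
  obtains js B where "set js \<subseteq> axes" "B \<subseteq> axes" "S = foldr face_perm js ` B"
proof -
  obtain t where "t \<in> set triangles" "S \<subseteq> set t" using clique_triangle[OF assms] .
  then obtain js where js: "js \<in> set words" "S \<subseteq> foldr face_perm js ` axes"
    unfolding triangles_words axes_def by auto
  moreover have "set js \<subseteq> axes"
    using js(1) unfolding words_def axes_def by auto
  ultimately show ?thesis
    using that[of js "{b \<in> axes. foldr face_perm js b \<in> S}"] by blast
qed

text \<open>The neighbours of \<open>i\<close> form a pentagon, and the two other axes are one of
  its edges. Words in the mirror symmetries of these two axes alone reach all five edges; such words
  correspond to reflections that preserve the honeycomb plane of \<open>i\<close>.\<close>

lemma pentagon_transitive: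
  assumes "i \<in> axes" "adj i a" "adj i b" "adj a b"
  obtains js where "set js \<subseteq> axes - {i}" "{a, b} = foldr face_perm js ` (axes - {i})"
proof -
  have "list_all (\<lambda>(i, j, k). list_all (\<lambda>a. list_all (\<lambda>b. list_ex (\<lambda>js.
      let ys = map (foldr face_perm js) [j, k] in a \<in> set ys \<and> b \<in> set ys)
      [[], [j], [k], [j, k], [k, j]]) (filter (adj a) (nbrs i))) (nbrs i))
      [(X0, X1, X2), (X1, X0, X2), (X2, X0, X1)]"
    by code_simp
  then have *: "\<forall>(i, j, k)\<in>set [(X0, X1, X2), (X1, X0, X2), (X2, X0, X1)].
      \<forall>a\<in>set (nbrs i). \<forall>b\<in>set (filter (adj a) (nbrs i)).
      \<exists>js\<in>set [[], [j], [k], [j, k], [k, j]]. a \<in> set (map (foldr face_perm js) [j, k])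
        \<and> b \<in> set (map (foldr face_perm js) [j, k])"
    unfolding list_all_iff list_ex_iff Let_def .
  obtain j k where jk: "(i, j, k) \<in> set [(X0, X1, X2), (X1, X0, X2), (X2, X0, X1)]"
      "axes - {i} = {j, k}"
    using assms(1) unfolding axes_def by auto
  have ab: "a \<in> set (nbrs i)" "b \<in> set (filter (adj a) (nbrs i))"
    using assms by (simp_all add: adj_def)
  from bspec[OF * jk(1), unfolded prod.case, THEN bspec, OF ab(1), THEN bspec, OF ab(2)]
  obtain js where js: "js \<in> set [[], [j], [k], [j, k], [k, j]]"
      "a \<in> set (map (foldr face_perm js) [j, k])" "b \<in> set (map (foldr face_perm js) [j, k])"
    by blast
  let ?S = "foldr face_perm js ` (axes - {i})"
  have "{a, b} \<subseteq> ?S" unfolding jk(2) using js(2,3) by simp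
  moreover have "card {a, b} = 2" using assms(4) by (cases "a = b") auto
  moreover have "card ?S \<le> 2"
    unfolding jk(2) by (simp add: card_insert_if)
  ultimately have "{a, b} = ?S" by (intro card_seteq) simp_all
  moreover have "set js \<subseteq> axes - {i}"
    unfolding jk(2) using js(1) by fastforce
  ultimately show ?thesis using that by blast
qed

subsection \<open>The right-angled dodecahedron around a vertex\<close>

definition phi :: real where "phi = (1 + sqrt 5) / 2"

lemma phi_phi: "phi * phi = phi + 1"
  by (simp add: phi_def field_simps)

lemma phi_phi_left: "phi * (phi * x) = phi * x + x"
  using phi_phi by (metis distrib_right mult.assoc mult_1)

lemmas phi_simps = algebra_simps phi_phi phi_phi_left

lemma phi_gt_1: "phi > 1"
  by (simp add: phi_def)

lemma cube_s_pos: "cube_s > 0"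
  by (simp add: cube_s_def add_pos_nonneg)

lemma cube_t_pos: "cube_t > 0"
  by (simp add: cube_t_def add_pos_nonneg)

lemma cube_s_sq: "cube_s * cube_s = phi / 2"
  by (simp add: cube_s_def phi_def add_nonneg_nonneg)

definition kappa :: real where "kappa = cube_t / cube_s"

lemma kappa_pos: "kappa > 0"
  by (simp add: kappa_def cube_s_pos cube_t_pos)

lemma kappa_sq: "kappa * kappa = 2 * phi + 1"
proof -
  have "cube_t * cube_t = (7 + 3 * sqrt 5) / 4"
    by (simp add: cube_t_def algebra_simps)
  also have "\<dots> = (2 * phi + 1) * (cube_s * cube_s)"
    by (simp add: cube_s_sq phi_def algebra_simps add_divide_distrib)
  finally show ?thesis
    using cube_s_pos by (simp add: kappa_def field_simps)
qed

text \<open>With the time coordinate scaled by \<^term>\<open>kappa\<close>, all walls and faces around a vertex have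
  coordinates in \<open>\<int>[phi]\<close>.\<close>

definition pt :: "real \<Rightarrow> real \<Rightarrow> real \<Rightarrow> real \<Rightarrow> mink" where
  "pt a b c d = (kappa * a, vector [b, c, d])"

lemma lorentz_pt:
  "lorentz (pt a b c d) (pt a' b' c' d') = b * b' + c * c' + d * d' - (2 * phi + 1) * (a * a')"
proof -
  have "kappa * a * (kappa * a') = (2 * phi + 1) * (a * a')"
    unfolding kappa_sq[symmetric] by (simp only: ac_simps)
  then show ?thesis
    by (simp add: lorentz_def pt_def inner_vec_def sum_3)
qed

lemma vector_3_add: "vector [a, b, c] + vector [a', b', c'] = (vector [a + a', b + b', c + c'] :: real ^ 3)"
  by (simp add: vec_eq_iff forall_3)

lemma vector_3_scale: "r *\<^sub>R vector [a, b, c] = (vector [r * a, r * b, r * c] :: real ^ 3)"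
  by (simp add: vec_eq_iff forall_3)

lemma pt_add: "pt a b c d + pt a' b' c' d' = pt (a + a') (b + b') (c + c') (d + d')"
  by (simp add: pt_def vector_3_add algebra_simps)

lemma pt_scale: "r *\<^sub>R pt a b c d = pt (r * a) (r * b) (r * c) (r * d)"
  by (simp add: pt_def vector_3_scale)

lemma pt_diff: "pt a b c d - pt a' b' c' d' = pt (a - a') (b - b') (c - c') (d - d')"
  using pt_add[of a b c d "- a'" "- b'" "- c'" "- d'"] pt_scale[of "-1" a' b' c' d']
  by (simp add: diff_conv_add_uminus del: add_uminus_conv_diff)

lemma pt_inject: "pt a b c d = pt a' b' c' d' \<longleftrightarrow> a = a' \<and> b = b' \<and> c = c' \<and> d = d'"
  using kappa_pos by (simp add: pt_def vec_eq_iff forall_3)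

definition corner :: mink where
  "corner = cube_s *\<^sub>R pt 1 1 1 1"

text \<open>The outer unit normals of the bisecting planes of the twelve edges at \<^term>\<open>corner\<close>.\<close>

fun nrm :: "wall \<Rightarrow> mink" where
  "nrm X0 = pt 0 (-1) 0 0"
| "nrm X1 = pt 0 0 (-1) 0"
| "nrm X2 = pt 0 0 0 (-1)"
| "nrm Y0 = pt (phi - 1) phi 0 0"
| "nrm Y1 = pt (phi - 1) 0 phi 0"
| "nrm Y2 = pt (phi - 1) 0 0 phi"
| "nrm Z0 = pt 1 0 phi phi"
| "nrm Z1 = pt 1 phi 0 phi"
| "nrm Z2 = pt 1 phi phi 0"
| "nrm U0 = pt phi (phi + 1) phi phi"
| "nrm U1 = pt phi phi (phi + 1) phi"
| "nrm U2 = pt phi phi phi (phi + 1)"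

lemma corner_nrm: "lorentz corner (nrm m) = - cube_s"
proof -
  have "lorentz (pt 1 1 1 1) (nrm m) = -1"
    by (cases m) (simp_all add: lorentz_pt phi_simps)
  then show ?thesis
    by (simp add: corner_def lorentz_bilinear)
qed

lemma nrm_nrm [simp]: "lorentz (nrm m) (nrm m) = 1"
  by (cases m) (simp_all add: lorentz_pt phi_simps)

lemma nrm_adj: "adj a b \<Longrightarrow> lorentz (nrm a) (nrm b) = 0"
  by (cases a) (auto simp: adj_def lorentz_pt phi_simps)

text \<open>Products below -1 mean that the walls are ultraparallel. The nearest such pairs have
  product \<open>- phi\<close>.\<close>

lemma nrm_disjoint:
  assumes "a \<noteq> b" "\<not> adj a b"
  shows "lorentz (nrm a) (nrm b) < -1"
proof -
  have "b = a \<or> b \<in> set (nbrs a) \<or> lorentz (nrm a) (nrm b) \<le> - phi"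
    by (cases a) (cases b; simp add: lorentz_pt phi_simps)+
  then show ?thesis using phi_gt_1 assms by (auto simp: adj_def)
qed

lemma nrm_le_0: "a \<noteq> b \<Longrightarrow> lorentz (nrm a) (nrm b) \<le> 0"
  using nrm_adj[of a b] nrm_disjoint[of a b] by fastforce

lemma nrm_inject: "nrm a = nrm b \<longleftrightarrow> a = b"
  using nrm_le_0[of a b] by fastforce

lemma adj_iff: "adj a b \<longleftrightarrow> lorentz (nrm a) (nrm b) = 0"
  using nrm_adj[of a b] nrm_disjoint[of a b] by (cases "a = b"; cases "adj a b") auto

definition flip :: "wall \<Rightarrow> mink \<Rightarrow> mink" where
  "flip m = reflection (nrm m)"

lemma flip_eq: "flip m x = x - (2 * lorentz x (nrm m)) *\<^sub>R nrm m"
  by (simp add: flip_def reflection_def)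

lemma flip_flip [simp]: "flip m (flip m x) = x"
  by (simp add: flip_def reflection_reflection)

lemma flip_isometry: "lorentz_isometry (flip m)"
  by (simp add: flip_def lorentz_isometry_reflection)

lemma flip_comp_flip: "flip m \<circ> flip m = id"
  by (simp add: fun_eq_iff)

lemma flip_corner: "flip m corner = corner + (2 * cube_s) *\<^sub>R nrm m"
  by (simp add: flip_eq corner_nrm)

lemma flip_nrm_adj: "adj m n \<Longrightarrow> flip m (nrm n) = nrm n"
  by (simp add: flip_eq nrm_adj adj_sym)

lemma flip_nrm_same: "flip m (nrm m) = - nrm m"
  by (simp add: flip_eq scaleR_2)

lemma flip_commute:
  assumes "adj m n"
  shows "flip m \<circ> flip n = flip n \<circ> flip m"
  using assms adj_sym[of m n]
  by (simp add: fun_eq_iff flip_eq lorentz_bilinear nrm_adj)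

text \<open>Normals of the three faces of the base cube at \<^term>\<open>corner\<close>; only meaningful for the
  arguments \<open>X0\<close>, \<open>X1\<close>, \<open>X2\<close>.\<close>

fun face_nrm :: "wall \<Rightarrow> mink" where
  "face_nrm X0 = pt 1 (2 * phi + 1) 0 0"
| "face_nrm X1 = pt 1 0 (2 * phi + 1) 0"
| "face_nrm _ = pt 1 0 0 (2 * phi + 1)"

definition turn :: "wall \<Rightarrow> mink \<Rightarrow> mink" where
  "turn j = reflection (face_nrm j)"

lemma face_nrm_norm: "lorentz (face_nrm j) (face_nrm j) = 6 * phi + 4"
  by (cases j) (simp_all add: lorentz_pt phi_simps)

lemma face_nrm_pos: "lorentz (face_nrm j) (face_nrm j) > 0"
  using phi_gt_1 by (simp add: face_nrm_norm)

lemma turn_isometry: "lorentz_isometry (turn j)"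
  using face_nrm_pos[of j] by (simp add: turn_def lorentz_isometry_reflection)

lemma turn_turn [simp]: "turn j (turn j x) = x"
  using face_nrm_pos[of j] by (simp add: turn_def reflection_reflection)

lemma turn_comp_turn: "turn j \<circ> turn j = id"
  by (simp add: fun_eq_iff)

lemma turn_corner: "turn j corner = corner"
proof -
  have "lorentz (pt 1 1 1 1) (face_nrm j) = 0"
    by (cases j) (simp_all add: lorentz_pt)
  then show ?thesis
    by (simp add: turn_def reflection_def corner_def lorentz_bilinear)
qed

text \<open>The factor \<open>2 / (6 * phi + 4)\<close> equals \<open>(2 - phi) * (2 - phi)\<close>.
  Without a division, images under \<open>turn\<close> can be compared by ring normalisation with
  \<open>phi_phi\<close>.\<close>

lemma turn_eq:
  shows "turn j x = x - ((2 - phi) * (2 - phi) * lorentz x (face_nrm j)) *\<^sub>R face_nrm j"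
proof -
  have "((2 - phi) * (2 - phi)) * (6 * phi + 4) = 2"
    by (simp add: phi_simps)
  then have "2 / (6 * phi + 4) = (2 - phi) * (2 - phi)"
    using phi_gt_1 by (simp add: field_simps)
  then have "2 * lorentz x (face_nrm j) / (6 * phi + 4) = (2 - phi) * (2 - phi) * lorentz x (face_nrm j)"
    by (metis times_divide_eq_left)
  then show ?thesis
    by (simp add: turn_def reflection_def face_nrm_norm)
qed

lemma turn_nrm:
  assumes "j \<in> axes"
  shows "turn j (nrm m) = nrm (face_perm j m)"
  using assms unfolding axes_def
  by (cases m) (auto simp: face_perm_def turn_eq lorentz_pt pt_scale pt_diff pt_add pt_inject phi_simps)

subsection \<open>Word length and descents\<close>

definition W :: "(mink \<Rightarrow> mink) set" where
  "W = generated (range flip)"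

lemma W_id: "id \<in> W"
  by (simp add: W_def generated.id)

lemma W_comp: "w \<in> W \<Longrightarrow> v \<in> W \<Longrightarrow> w \<circ> v \<in> W"
  unfolding W_def by (rule generated_comp)

lemma W_flip: "flip m \<in> W"
  by (simp add: W_def generated_base)

lemma W_right: "w \<in> W \<Longrightarrow> w \<circ> flip m \<in> W"
  by (intro W_comp W_flip)

lemma W_isometry: "w \<in> W \<Longrightarrow> lorentz_isometry w"
  unfolding W_def by (erule generated_isometry) (auto intro: flip_isometry)

lemmas W_linear = isometry_linear[OF W_isometry]
lemmas W_lorentz = isometry_lorentz[OF W_isometry]

lemma W_inverse:
  assumes "w \<in> W"
  obtains v where "v \<in> W" "v \<circ> w = id" "w \<circ> v = id"
  using generated_inverse[of w "range flip"] assms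
  unfolding W_def by (metis flip_comp_flip rangeE)

lemma W_inj: "w \<in> W \<Longrightarrow> w x = w y \<longleftrightarrow> x = y"
  by (metis W_inverse comp_apply id_apply)

lemma comp_flip_nrm:
  assumes "w \<in> W"
  shows "(w \<circ> flip m) (nrm n) = w (nrm n) - (2 * lorentz (nrm n) (nrm m)) *\<^sub>R w (nrm m)"
  using W_linear[OF assms] by (simp add: flip_eq linear_diff linear_scale)

lemma comp_flip_corner:
  assumes "w \<in> W"
  shows "(w \<circ> flip m) corner = w corner + (2 * cube_s) *\<^sub>R w (nrm m)"
  using W_linear[OF assms] by (simp add: flip_corner linear_add linear_scale)

lemma comp_flip_flip [simp]: "w \<circ> flip m \<circ> flip m = w"
  by (simp add: comp_assoc flip_comp_flip)

text \<open>As \<open>w corner\<close> has product \<open>- cube_s\<close> with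
  \<open>w (nrm m)\<close>, a positive height means that this wall separates \<open>corner\<close>
  from \<open>w corner\<close>, so that crossing it leads back towards
  \<open>corner\<close>.\<close>

definition height :: "(mink \<Rightarrow> mink) \<Rightarrow> wall \<Rightarrow> real" where
  "height w m = lorentz corner (w (nrm m))"

definition desc :: "(mink \<Rightarrow> mink) \<Rightarrow> wall set" where
  "desc w = {m. height w m > 0}"

lemma height_id: "height id m = - cube_s"
  by (simp add: height_def corner_nrm)

lemma desc_id: "desc id = {}"
  using cube_s_pos by (auto simp: desc_def height_id)

lemma height_comp_flip:
  "w \<in> W \<Longrightarrow> height (w \<circ> flip m) n = height w n - 2 * lorentz (nrm n) (nrm m) * height w m"
  unfolding height_def by (simp only: comp_flip_nrm) (simp add: lorentz_bilinear)

lemma height_flip_same: "w \<in> W \<Longrightarrow> height (w \<circ> flip m) m = - height w m"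
  by (simp add: height_comp_flip)

lemma height_flip_adj: "w \<in> W \<Longrightarrow> adj n m \<Longrightarrow> height (w \<circ> flip m) n = height w n"
  by (simp add: height_comp_flip nrm_adj)

text \<open>Words are prolonged only by walls that do not yet separate. The definition does not
  minimise over words; \<open>len_unique\<close> and \<open>W_len\<close> show that the sets
  \<open>len k\<close> partition \<open>W\<close>.\<close>

primrec len :: "nat \<Rightarrow> (mink \<Rightarrow> mink) set" where
  "len 0 = {id}"
| "len (Suc k) = {w \<circ> flip m |w m. w \<in> len k \<and> height w m < 0}"

lemma len_W: "w \<in> len k \<Longrightarrow> w \<in> W"
  by (induction k arbitrary: w) (auto intro: W_id W_right)

text \<open>The two bounds need each other. When \<open>p\<close> is crossed, the height of a
  non-adjacent \<open>n\<close> changes by more than twice the negative height of \<open>p\<close>,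
  and by the second bound it was below minus that height; so the new height is below the height of
  \<open>p\<close>, hence at most \<open>- cube_s\<close>.\<close>

lemma len_height:
  assumes "w \<in> len k"
  shows "\<bar>height w n\<bar> \<ge> cube_s"
    and "n \<noteq> m \<Longrightarrow> \<not> adj n m \<Longrightarrow> height w n + height w m < 0"
proof -
  have "(\<forall>n. \<bar>height w n\<bar> \<ge> cube_s) \<and>
      (\<forall>n m. n \<noteq> m \<longrightarrow> \<not> adj n m \<longrightarrow> height w n + height w m < 0)"
    using assms
  proof (induction k arbitrary: w)
    case 0
    then have "w = id" by simp
    show ?case unfolding \<open>w = id\<close> height_id using cube_s_pos by simp
  next
    case (Suc k)
    then obtain v p where w: "w = v \<circ> flip p" and v: "v \<in> len k" "height v p < 0" by auto
    note vW = len_W[OF v(1)]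
    have IH1: "\<bar>height v n\<bar> \<ge> cube_s" for n
      using Suc.IH[OF v(1)] by blast
    have IH2: "height v n + height v m < 0" if "n \<noteq> m" "\<not> adj n m" for n m
      using Suc.IH[OF v(1)] that by blast
    have p: "height v p \<le> - cube_s"
      using IH1[of p] v(2) by linarith
    have "\<bar>height w n\<bar> \<ge> cube_s" for n
    proof (cases "n = p \<or> adj n p")
      case True
      then show ?thesis
        using IH1 vW by (auto simp: w height_flip_same height_flip_adj)
    next
      case False
      then have *: "lorentz (nrm n) (nrm p) < -1" "height v n < - height v p"
        using nrm_disjoint IH2[of n p] by auto
      then have "lorentz (nrm n) (nrm p) * height v p \<ge> - height v p"
        using mult_right_mono_neg[of "lorentz (nrm n) (nrm p)" "-1" "height v p"] v(2) by simp
      then have "height w n \<le> - cube_s"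
        using p *(2) unfolding w height_comp_flip[OF vW] by linarith
      then show ?thesis by linarith
    qed
    moreover have "height w n + height w m < 0" if nm: "n \<noteq> m" "\<not> adj n m" for n m
    proof -
      \<comment> \<open>If one of the two walls is \<open>p\<close> itself, its product 1 is
        outweighed by the other product, which is below -1.\<close>
      have "lorentz (nrm n) (nrm p) + lorentz (nrm m) (nrm p) \<le> 0"
      proof -
        consider "n = p" | "m = p" | "n \<noteq> p" "m \<noteq> p" by blast
        then show ?thesis
        proof cases
          case 1
          then show ?thesis using nrm_disjoint[of m n] nm adj_sym by force
        next
          case 2
          then show ?thesis using nrm_disjoint[of n m] nm by force
        next
          case 3
          then show ?thesis using nrm_le_0[of n p] nrm_le_0[of m p] by linarith
        qed
      qed
      then have "(lorentz (nrm n) (nrm p) + lorentz (nrm m) (nrm p)) * height v p \<ge> 0"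
        using v(2) by (simp add: mult_nonpos_nonpos)
      then show ?thesis
        using IH2[OF nm] unfolding w height_comp_flip[OF vW] by (simp add: algebra_simps)
    qed
    ultimately show ?case by blast
  qed
  then show "\<bar>height w n\<bar> \<ge> cube_s"
    "n \<noteq> m \<Longrightarrow> \<not> adj n m \<Longrightarrow> height w n + height w m < 0" by blast+
qed

lemma len_height_cases:
  assumes "w \<in> len k"
  shows "height w n < 0 \<longleftrightarrow> n \<notin> desc w"
  using len_height(1)[OF assms, of n] cube_s_pos by (auto simp: desc_def)

lemma desc_clique: "w \<in> len k \<Longrightarrow> clique (desc w)"
  unfolding clique_def desc_def using len_height(2) by fastforce

text \<open>Walls adjacent to \<open>m\<close> are orthogonal to it and keep their heights; the
  others cannot be descents together with \<open>m\<close>, because descents form a clique.\<close>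

lemma desc_flip:
  assumes w: "w \<in> len k" and m: "m \<notin> desc w"
  shows "desc (w \<circ> flip m) = insert m {n \<in> desc w. adj n m}"
proof -
  note wW = len_W[OF w]
  have m0: "height w m < 0" using len_height_cases[OF w] m by blast
  then have wm: "w \<circ> flip m \<in> len (Suc k)" using w by auto
  have "m \<in> desc (w \<circ> flip m)"
    using m0 wW by (simp add: desc_def height_flip_same)
  moreover have "n \<in> desc (w \<circ> flip m) \<longleftrightarrow> n \<in> desc w" if "adj n m" for n
    using that wW by (simp add: desc_def height_flip_adj)
  moreover have "n \<notin> desc (w \<circ> flip m)" if "n \<noteq> m" "\<not> adj n m" for n
    using desc_clique[OF wm] calculation(1) that by (auto simp: clique_def)
  ultimately show ?thesis by blast
qed

lemma len_up: "w \<in> len k \<Longrightarrow> m \<notin> desc w \<Longrightarrow> w \<circ> flip m \<in> len (Suc k)"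
  unfolding len.simps using len_height_cases by blast

lemma len_SucE:
  assumes "w \<in> len (Suc k)"
  obtains v m where "w = v \<circ> flip m" "v \<in> len k" "m \<notin> desc v"
  using assms unfolding len.simps using len_height_cases by blast

lemma desc_nonempty: "w \<in> len (Suc k) \<Longrightarrow> desc w \<noteq> {}"
  by (erule len_SucE) (simp add: desc_flip del: o_apply)

text \<open>The exchange property: any descent can be made the last letter. A descent other than the
  last letter \<open>n\<close> commutes with it and is already a descent of the prefix, so it can be
  removed there first.\<close>

lemma len_down: "w \<in> len (Suc k) \<Longrightarrow> m \<in> desc w \<Longrightarrow> w \<circ> flip m \<in> len k"
proof (induction k arbitrary: w m)
  case 0
  then obtain n where w: "w = flip n" by auto
  moreover have "desc w = {n}"
    using desc_flip[of id 0 n] by (simp add: desc_id w)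
  ultimately have "w \<circ> flip m = id"
    using 0(2) by (simp add: flip_comp_flip)
  then show ?case unfolding len.simps by blast
next
  case (Suc k)
  obtain v n where v: "w = v \<circ> flip n" "v \<in> len (Suc k)" and n: "n \<notin> desc v"
    using len_SucE[OF Suc.prems(1)] .
  have "m = n \<or> m \<in> desc v \<and> adj m n"
    using Suc.prems(2) unfolding v(1) desc_flip[OF v(2) n] by blast
  then show ?case
  proof (elim disjE conjE)
    assume "m = n"
    then show ?thesis using v(2) unfolding v(1) by (simp only: comp_flip_flip)
  next
    assume m: "m \<in> desc v" "adj m n"
    have vm: "v \<circ> flip m \<in> len k" by (rule Suc.IH[OF v(2) m(1)])
    moreover have "n \<notin> desc (v \<circ> flip m)"
      using n height_flip_adj[OF len_W[OF v(2)], of n m] m adj_sym by (simp add: desc_def)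
    ultimately have "v \<circ> flip m \<circ> flip n \<in> len (Suc k)" by (rule len_up)
    then show ?thesis
      unfolding v(1) comp_assoc by (simp only: flip_commute[OF m(2)])
  qed
qed

lemma len_0_desc: "w \<in> len 0 \<Longrightarrow> m \<notin> desc w"
  by (simp add: desc_id)

text \<open>The descents depend on \<open>w\<close> alone, so the same descent can be stripped from
  both representations.\<close>

lemma len_unique: "w \<in> len j \<Longrightarrow> w \<in> len k \<Longrightarrow> j = k"
proof (induction j arbitrary: w k)
  case 0
  then have "desc w = {}" by (simp add: desc_id)
  then show ?case
    using desc_nonempty 0(2) by (cases k) blast+
next
  case (Suc j)
  then obtain m where m: "m \<in> desc w" using desc_nonempty by blast
  then obtain i where i: "k = Suc i"
    using Suc.prems(2) len_0_desc by (cases k) blast+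
  show ?case
    using Suc.IH[OF len_down[OF Suc.prems(1) m] len_down[OF Suc.prems(2)[unfolded i] m]] i by simp
qed

lemma W_len: "w \<in> W \<Longrightarrow> \<exists>k. w \<in> len k"
  unfolding W_def
proof (induction rule: generated_induct_right)
  case id
  have "id \<in> len 0" by simp
  then show ?case by blast
next
  case (step g s)
  then obtain k m where k: "g \<in> len k" and s: "s = flip m" by blast
  show ?case
  proof (cases "m \<in> desc g")
    case True
    with k obtain j where "k = Suc j" using len_0_desc by (cases k) blast+
    then show ?thesis using True k len_down s by blast
  next
    case False
    then show ?thesis using k len_up s by blast
  qed
qed

text \<open>If \<open>w\<close> fixes \<open>corner\<close>, all heights of its inverse are
  \<open>- cube_s\<close>; an element without descents has length zero.\<close>

lemma W_trivial:
  assumes "w \<in> W" "w corner = corner"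
  shows "w = id"
proof -
  obtain v where v: "v \<in> W" "v \<circ> w = id" "w \<circ> v = id" using W_inverse[OF assms(1)] .
  obtain k where k: "v \<in> len k" using W_len[OF v(1)] by blast
  have "height v m = - cube_s" for m
  proof -
    have "height v m = lorentz (w corner) (w (v (nrm m)))"
      using W_lorentz[OF assms(1)] by (simp add: height_def)
    then show ?thesis
      using v(3) assms(2) by (simp add: corner_nrm pointfree_idE)
  qed
  then have "desc v = {}" using cube_s_pos by (auto simp: desc_def)
  then have "v = id" using k desc_nonempty by (cases k) (simp, blast)
  then show ?thesis using v(2) by simp
qed

lemma W_free:
  assumes "w \<in> W" "v \<in> W" "w corner = v corner"
  shows "w = v"
proof -
  obtain u where u: "u \<in> W" "u \<circ> v = id" "v \<circ> u = id" using W_inverse[OF assms(2)] .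
  have "(u \<circ> w) corner = corner"
    using assms(3) u(2) by (simp add: pointfree_idE)
  then have "u \<circ> w = id" by (intro W_trivial W_comp u assms)
  then show ?thesis using u(3) by (metis comp_assoc comp_id id_comp)
qed

subsection \<open>The three bounding walls\<close>

definition side :: "wall \<Rightarrow> (mink \<Rightarrow> mink) \<Rightarrow> real" where
  "side i w = lorentz (w corner) (nrm i)"

text \<open>Moving by the inverse exchanges the roles of vertex and wall, which transfers all bounds
  on heights to sides.\<close>

lemma side_inverse:
  assumes "w \<in> W" "w \<circ> v = id"
  shows "side i w = height v i"
proof -
  have "height v i = lorentz (w corner) (w (v (nrm i)))"
    using W_lorentz[OF assms(1)] by (simp add: height_def)
  then show ?thesis
    using assms(2) by (simp add: side_def pointfree_idE)
qed

lemma side_abs: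
  assumes "w \<in> W"
  shows "\<bar>side i w\<bar> \<ge> cube_s"
proof -
  obtain v where v: "v \<in> W" "w \<circ> v = id" using W_inverse[OF assms] .
  then show ?thesis
    using side_inverse[OF assms] W_len len_height(1) by metis
qed

lemma side_flip:
  assumes "w \<in> W"
  shows "side i (w \<circ> flip m) = side i w + 2 * cube_s * lorentz (w (nrm m)) (nrm i)"
  unfolding side_def comp_flip_corner[OF assms] by (simp add: lorentz_bilinear)

definition plane_group :: "wall \<Rightarrow> (mink \<Rightarrow> mink) set" where
  "plane_group i = generated (flip ` {m. adj i m})"

lemma plane_group_nrm:
  assumes "w \<in> plane_group i"
  shows "w (nrm i) = nrm i"
  using assms unfolding plane_group_def
  by (rule generated_fixes) (auto simp: flip_nrm_adj adj_sym)

text \<open>At the extreme height \<open>- cube_s\<close> of \<open>i\<close>, a descent that is not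
  adjacent to \<open>i\<close> would make the sum of the two heights nonnegative. So every descent
  is one of the five neighbours of \<open>i\<close>, and removing it keeps the height of
  \<open>i\<close>.\<close>

lemma height_plane_group:
  assumes "v \<in> len k" "height v i = - cube_s"
  shows "v \<in> plane_group i"
  using assms
proof (induction k arbitrary: v)
  case 0
  then show ?case unfolding plane_group_def len.simps using generated.id by blast
next
  case (Suc k)
  obtain m where m: "m \<in> desc v" using desc_nonempty[OF Suc.prems(1)] by blast
  have "m \<noteq> i" using m Suc.prems(2) cube_s_pos by (auto simp: desc_def)
  moreover have "height v m \<ge> cube_s"
    using len_height(1)[OF Suc.prems(1), of m] m by (auto simp: desc_def)
  ultimately have a: "adj i m"
    using len_height(2)[OF Suc.prems(1), of i m] Suc.prems(2) by fastforce
  then have "height (v \<circ> flip m) i = - cube_s"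
    using height_flip_adj[OF len_W[OF Suc.prems(1)]] Suc.prems(2) by simp
  then have "v \<circ> flip m \<in> plane_group i"
    by (intro Suc.IH len_down[OF Suc.prems(1) m])
  then have "(v \<circ> flip m) \<circ> flip m \<in> plane_group i"
    unfolding plane_group_def by (rule generated_right) (simp add: a)
  then show ?case unfolding comp_flip_flip .
qed

text \<open>This turns membership in a honeycomb plane, an orbit, into an equation for a linear
  form.\<close>

lemma side_plane_group:
  assumes "w \<in> W"
  shows "side i w = - cube_s \<longleftrightarrow> w \<in> plane_group i"
proof
  assume *: "side i w = - cube_s"
  obtain v where v: "v \<in> W" "v \<circ> w = id" "w \<circ> v = id" using W_inverse[OF assms] .
  then have "height v i = - cube_s"
    using * side_inverse[OF assms v(3)] by simp
  then have "v \<in> plane_group i"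
    using W_len[OF v(1)] height_plane_group by blast
  then obtain u where u: "u \<in> plane_group i" "u \<circ> v = id"
    unfolding plane_group_def by (rule generated_inverse) (blast intro: flip_comp_flip)
  then have "u = w" using v(2,3) by (metis comp_assoc comp_id id_comp)
  with u show "w \<in> plane_group i" by simp
next
  assume "w \<in> plane_group i"
  then have "side i w = lorentz (w corner) (w (nrm i))"
    by (simp add: side_def plane_group_nrm)
  then show "side i w = - cube_s"
    using W_lorentz[OF assms] by (simp add: corner_nrm)
qed

lemma plane_nrm: "w \<in> W \<Longrightarrow> side i w = - cube_s \<Longrightarrow> w (nrm i) = nrm i"
  using side_plane_group plane_group_nrm by blast

lemma future_corner: "future corner"
proof -
  have "lorentz (pt 1 1 1 1) (pt 1 1 1 1) < 0"
    using phi_gt_1 by (simp add: lorentz_pt)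
  then show ?thesis
    using cube_s_pos kappa_pos mult_pos_neg[of "cube_s * cube_s"]
    by (simp add: future_def corner_def lorentz_bilinear) (simp add: pt_def mult_pos_neg)
qed

lemma W_future: "w \<in> W \<Longrightarrow> future x \<Longrightarrow> future (w x)"
  unfolding W_def
proof (induction rule: generated.induct)
  case (step s g)
  then show ?case by (auto simp: flip_def intro: future_reflection)
qed simp

text \<open>If the walls \<open>w (nrm m)\<close> and \<open>nrm i\<close> differ, they cannot both separate the ends of an edge:
  the sum of the two normals would be a causal vector changing its sign between two future vectors.\<close>

lemma side_crossing:
  assumes w: "w \<in> W" and pos: "side i w > 0" and neg: "side i (w \<circ> flip m) < 0"
  shows "side i (w \<circ> flip m) = - cube_s" and "m \<in> desc w" and "w (nrm m) = - nrm i"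
proof -
  let ?x = "w corner" and ?y = "(w \<circ> flip m) corner" and ?r = "w (nrm m)"
  let ?q = "lorentz ?r (nrm i)"
  note wm = W_right[OF w, of m]
  have x: "lorentz ?x (nrm i) \<ge> cube_s"
    using side_abs[OF w, of i] pos by (simp add: side_def)
  have y: "lorentz ?y (nrm i) \<le> - cube_s"
    using side_abs[OF wm, of i] neg by (simp add: side_def)
  have xr: "lorentz ?x ?r = - cube_s"
    using W_lorentz[OF w] by (simp add: corner_nrm)
  have rr: "lorentz ?r ?r = 1"
    using W_lorentz[OF w] by simp
  have yr: "lorentz ?y ?r = cube_s"
    unfolding comp_flip_corner[OF w] by (simp add: lorentz_bilinear xr rr)
  have "2 * cube_s * ?q \<le> - 2 * cube_s"
    using x y unfolding comp_flip_corner[OF w] by (simp add: lorentz_bilinear)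
  then have q: "?q \<le> -1"
    using cube_s_pos mult_le_cancel_left_pos[of "2 * cube_s" ?q "-1"] by simp
  have "nrm i + ?r = 0"
  proof (rule causal_sign[of ?x ?y])
    show "future ?x" "future ?y"
      by (rule W_future[OF w future_corner] W_future[OF wm future_corner])+
    show "lorentz (nrm i + ?r) (nrm i + ?r) \<le> 0"
      using q rr lorentz_commute[of ?r "nrm i"] by (simp add: lorentz_bilinear)
    show "0 \<le> lorentz ?x (nrm i + ?r)" "lorentz ?y (nrm i + ?r) \<le> 0"
      using x y xr yr by (simp_all add: lorentz_bilinear del: comp_apply)
  qed
  then show r: "w (nrm m) = - nrm i"
    by (simp add: eq_neg_iff_add_eq_0 add.commute)
  then show "m \<in> desc w"
    using cube_s_pos by (simp add: desc_def height_def lorentz_bilinear corner_nrm)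
  show "side i (w \<circ> flip m) = - cube_s"
    using yr r by (simp add: side_def lorentz_bilinear)
qed

subsection \<open>Cells of the honeycomb\<close>

text \<open>For a clique \<open>B\<close> the normals are orthogonal and this is the image of
  \<open>corner\<close> under the product of the flips in \<open>B\<close>; the sum avoids a choice
  of their order.\<close>

definition vtx :: "wall set \<Rightarrow> mink" where
  "vtx B = corner + (2 * cube_s) *\<^sub>R (\<Sum>c\<in>B. nrm c)"

text \<open>The cell at the vertex \<open>w corner\<close> spanned by the edges crossing the walls in \<open>S\<close>.\<close>

definition block :: "(mink \<Rightarrow> mink) \<Rightarrow> wall set \<Rightarrow> mink set" where
  "block w S = (\<lambda>B. w (vtx B)) ` Pow S"

lemma vtx_empty [simp]: "vtx {} = corner"
  by (simp add: vtx_def)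

lemma vtx_single: "vtx {a} = flip a corner"
  by (simp add: vtx_def flip_corner)

lemma vtx_insert: "a \<notin> B \<Longrightarrow> vtx (insert a B) = vtx B + (2 * cube_s) *\<^sub>R nrm a"
  by (simp add: vtx_def algebra_simps)

lemma lorentz_sum_left: "lorentz (\<Sum>c\<in>B. f c) z = (\<Sum>c\<in>B. lorentz (f c) z)"
  by (induction B rule: infinite_finite_induct) (simp_all add: lorentz_bilinear lorentz_def[of 0])

lemma vtx_nrm:
  assumes "clique (insert a B)"
  shows "lorentz (vtx B) (nrm a) = (if a \<in> B then cube_s else - cube_s)"
proof -
  have "(\<Sum>c\<in>B. lorentz (nrm c) (nrm a)) = (\<Sum>c\<in>B. if c = a then 1 else 0)"
    using assms by (intro sum.cong) (auto simp: clique_def nrm_adj)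
  then show ?thesis
    by (simp add: vtx_def lorentz_bilinear lorentz_sum_left corner_nrm)
qed

lemma flip_vtx:
  assumes "clique (insert a B)"
  shows "flip a (vtx B) = vtx (if a \<in> B then B - {a} else insert a B)"
proof (cases "a \<in> B")
  case True
  then have "vtx B = vtx (B - {a}) + (2 * cube_s) *\<^sub>R nrm a"
    using vtx_insert[of a "B - {a}"] by (simp add: insert_absorb)
  then show ?thesis
    using True vtx_nrm[OF assms] by (simp add: flip_eq)
next
  case False
  then show ?thesis
    using vtx_nrm[OF assms] by (simp add: flip_eq vtx_insert)
qed

lemma block_image: "g ` block w S = block (g \<circ> w) S"
  by (auto simp: block_def image_image)

text \<open>The flips in \<open>S\<close> permute the vertices of the cell, so the cell does not
  depend on which of its vertices is taken as origin.\<close>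

lemma block_flip:
  assumes "clique S" "a \<in> S"
  shows "block (w \<circ> flip a) S = block w S"
proof -
  have sub: "block (w \<circ> flip a) S \<subseteq> block w S" for w
  proof
    fix x assume "x \<in> block (w \<circ> flip a) S"
    then obtain B where B: "B \<subseteq> S" "x = w (flip a (vtx B))" by (auto simp: block_def)
    have "clique (insert a B)"
      using assms B(1) clique_subset[of S "insert a B"] by blast
    then have "x = w (vtx (if a \<in> B then B - {a} else insert a B))"
      using B(2) flip_vtx by simp
    moreover have "(if a \<in> B then B - {a} else insert a B) \<subseteq> S"
      using B(1) assms(2) by auto
    ultimately show "x \<in> block w S" unfolding block_def by blast
  qed
  show ?thesis
    using sub[of w] sub[of "w \<circ> flip a"] unfolding comp_flip_flip by blast
qed

lemma block_vertex:
  assumes w: "w \<in> W" and S: "clique S" and x: "x \<in> block w S"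
  obtains v where "v \<in> W" "x = v corner" "block v S = block w S"
proof -
  obtain B where B: "B \<subseteq> S" "x = w (vtx B)" using x by (auto simp: block_def)
  have "finite B" by simp
  then have "B \<subseteq> S \<Longrightarrow> \<exists>u\<in>W. u corner = vtx B \<and> block u S = block id S"
  proof (induction B rule: finite_induct)
    case empty
    show ?case by (rule bexI[of _ id]) (simp_all add: W_id)
  next
    case (insert a B)
    then obtain u where u: "u \<in> W" "u corner = vtx B" "block u S = block id S" by blast
    have "clique (insert a B)" using S insert.prems clique_subset by blast
    then have "(flip a \<circ> u) corner = vtx (insert a B)"
      using u(2) insert.hyps(2) by (simp add: flip_vtx)
    moreover have "block (flip a \<circ> u) S = block id S"
    proof -
      have "block (flip a \<circ> u) S = flip a ` block id S"
        by (simp add: block_image[symmetric] u(3))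
      also have "\<dots> = block (id \<circ> flip a) S"
        by (simp add: block_image)
      also have "\<dots> = block id S"
        using S insert.prems by (intro block_flip) auto
      finally show ?thesis .
    qed
    ultimately show ?case using W_comp[OF W_flip u(1)] by blast
  qed
  then obtain u where u: "u \<in> W" "u corner = vtx B" "block u S = block id S" using B(1) by blast
  have "block (w \<circ> u) S = w ` block id S"
    by (simp add: block_image[symmetric] u(3))
  also have "\<dots> = block w S" by (simp add: block_image)
  finally show ?thesis
    using that[of "w \<circ> u"] W_comp[OF w u(1)] B(2) u(2) by simp
qed

lemma block_corner: "w corner \<in> block w S"
  unfolding block_def by (rule image_eqI[of _ _ "{}"]) auto

lemma block_neighbour: "a \<in> S \<Longrightarrow> (w \<circ> flip a) corner \<in> block w S"
  unfolding block_def by (rule image_eqI[of _ _ "{a}"]) (auto simp: vtx_single)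

text \<open>An edge in direction \<open>a\<close> that ends in the other cell makes
  \<open>nrm a\<close> a sum of normals from \<open>T\<close>. Pairing with \<open>nrm a\<close>
  gives 1, which a sum of other normals, with nonpositive products, cannot reach.\<close>

lemma block_subset:
  assumes "w \<in> W" "block w S \<subseteq> block w T"
  shows "S \<subseteq> T"
proof
  fix a assume "a \<in> S"
  then have "(w \<circ> flip a) corner \<in> block w T"
    using assms(2) block_neighbour by blast
  then obtain B where B: "B \<subseteq> T" "w (flip a corner) = w (vtx B)" by (auto simp: block_def)
  then have "flip a corner = vtx B" using W_inj[OF assms(1)] by blast
  then have "nrm a = (\<Sum>c\<in>B. nrm c)"
    using cube_s_pos by (simp add: flip_corner vtx_def)
  then have "lorentz (nrm a) (nrm a) = (\<Sum>c\<in>B. lorentz (nrm c) (nrm a))"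
    using lorentz_sum_left by metis
  moreover have "(\<Sum>c\<in>B. lorentz (nrm c) (nrm a)) \<le> 0" if "a \<notin> B"
    using that by (intro sum_nonpos nrm_le_0) blast
  ultimately show "a \<in> T" using B(1) by auto
qed

definition cells :: "nat \<Rightarrow> mink set set" where
  "cells d = {block w S |w S. w \<in> W \<and> clique S \<and> card S = d}"

text \<open>An isometry in the stabiliser of \<open>corner\<close> together with the permutation of
  the twelve walls that it induces.\<close>

definition wall_symmetry :: "(mink \<Rightarrow> mink) \<Rightarrow> (wall \<Rightarrow> wall) \<Rightarrow> bool" where
  "wall_symmetry k p \<longleftrightarrow> lorentz_isometry k \<and> k corner = corner \<and> (\<forall>m. k (nrm m) = nrm (p m))"

lemma wall_symmetry_id: "wall_symmetry id id"
  by (simp add: wall_symmetry_def lorentz_isometry_id)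

lemma wall_symmetry_comp:
  "wall_symmetry k p \<Longrightarrow> wall_symmetry k' p' \<Longrightarrow> wall_symmetry (k \<circ> k') (p \<circ> p')"
  by (simp add: wall_symmetry_def lorentz_isometry_comp)

lemma wall_symmetry_turn: "j \<in> axes \<Longrightarrow> wall_symmetry (turn j) (face_perm j)"
  by (simp add: wall_symmetry_def turn_isometry turn_corner turn_nrm)

lemma wall_symmetry_lorentz:
  assumes "wall_symmetry k p"
  shows "lorentz (nrm (p a)) (nrm (p b)) = lorentz (nrm a) (nrm b)"
proof -
  have "k (nrm a) = nrm (p a)" "k (nrm b) = nrm (p b)" "lorentz_isometry k"
    using assms by (simp_all add: wall_symmetry_def)
  then show ?thesis using isometry_lorentz[of k "nrm a" "nrm b"] by simp
qed

lemma wall_symmetry_inj: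
  assumes "wall_symmetry k p"
  shows "inj p"
proof (rule injI)
  fix a b assume "p a = p b"
  then have "lorentz (nrm a) (nrm b) = 1"
    using wall_symmetry_lorentz[OF assms, of a b] by simp
  then show "a = b" using nrm_le_0[of a b] by fastforce
qed

lemma wall_symmetry_adj: "wall_symmetry k p \<Longrightarrow> adj (p a) (p b) \<longleftrightarrow> adj a b"
  by (simp add: adj_iff wall_symmetry_lorentz)

lemma wall_symmetry_clique: "wall_symmetry k p \<Longrightarrow> clique S \<Longrightarrow> clique (p ` S)"
  unfolding clique_def by (auto simp: wall_symmetry_adj)

lemma wall_symmetry_flip:
  assumes "wall_symmetry k p"
  shows "k \<circ> flip m = flip (p m) \<circ> k"
  using assms isometry_reflection[of k "nrm m"]
  by (auto simp: wall_symmetry_def flip_def fun_eq_iff)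

lemma wall_symmetry_vtx:
  assumes "wall_symmetry k p"
  shows "k (vtx B) = vtx (p ` B)"
proof -
  have lin: "linear k" and k: "k corner = corner" "\<And>m. k (nrm m) = nrm (p m)"
    using assms by (auto simp: wall_symmetry_def isometry_linear)
  have "inj_on p B" using wall_symmetry_inj[OF assms] by (rule inj_on_subset) simp
  then have "(\<Sum>c\<in>p ` B. nrm c) = k (\<Sum>c\<in>B. nrm c)"
    using lin by (simp add: sum.reindex linear_sum k)
  then show ?thesis
    using lin by (simp add: vtx_def linear_add linear_scale k)
qed

lemma wall_symmetry_block:
  assumes "wall_symmetry k p"
  shows "block (w \<circ> k) S = block w (p ` S)"
proof -
  have "Pow (p ` S) = (`) p ` Pow S" by (rule image_Pow_surj[symmetric]) simp
  then show ?thesis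
    by (simp add: block_def image_image wall_symmetry_vtx[OF assms])
qed

text \<open>A common overgroup of \<open>W\<close> and of the group of face reflections that defines
  the honeycomb, generated by six reflections at one corner of one cube.\<close>

definition G :: "(mink \<Rightarrow> mink) set" where
  "G = generated (flip ` axes \<union> turn ` axes)"

lemma G_id: "id \<in> G"
  by (simp add: G_def generated.id)

lemma G_comp: "g \<in> G \<Longrightarrow> h \<in> G \<Longrightarrow> g \<circ> h \<in> G"
  unfolding G_def by (rule generated_comp)

lemma G_turn: "j \<in> axes \<Longrightarrow> turn j \<in> G"
  by (simp add: G_def generated_base)

lemma G_isometry: "g \<in> G \<Longrightarrow> lorentz_isometry g"
  unfolding G_def by (erule generated_isometry) (auto intro: flip_isometry turn_isometry)

lemma G_inverse:
  assumes "g \<in> G"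
  obtains h where "h \<in> G" "h \<circ> g = id" "g \<circ> h = id"
  using assms unfolding G_def by (rule generated_inverse) (use flip_comp_flip turn_comp_turn in blast)

lemma turn_conj:
  assumes "w \<in> W" "j \<in> axes"
  shows "\<exists>v\<in>W. turn j \<circ> w = v \<circ> turn j"
  using assms(1) unfolding W_def
proof induction
  case id
  show ?case by (rule bexI[of _ id]) (simp_all add: generated.id)
next
  case (step s g)
  then obtain v m where v: "v \<in> generated (range flip)" "turn j \<circ> g = v \<circ> turn j" "s = flip m" by blast
  have "turn j \<circ> (s \<circ> g) = (turn j \<circ> flip m) \<circ> g"
    by (simp add: v(3) comp_assoc)
  also have "\<dots> = (flip (face_perm j m) \<circ> v) \<circ> turn j"
    unfolding wall_symmetry_flip[OF wall_symmetry_turn[OF assms(2)]] comp_assoc v(2) ..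
  finally show ?case
    using generated.step[OF _ v(1), of "flip (face_perm j m)"] by blast
qed

text \<open>Face reflections at \<open>corner\<close> permute the walls and therefore normalise
  \<open>W\<close>, so they can be collected on the right, where they fix
  \<open>corner\<close>.\<close>

lemma G_decompose:
  assumes "g \<in> G"
  obtains w k p where "w \<in> W" "wall_symmetry k p" "g = w \<circ> k"
proof -
  have "\<exists>w k p. w \<in> W \<and> wall_symmetry k p \<and> g = w \<circ> k"
    using assms unfolding G_def
  proof induction
    case id
    have "id = id \<circ> (id :: mink \<Rightarrow> mink)" by simp
    then show ?case using W_id wall_symmetry_id by blast
  next
    case (step s g)
    then obtain w k p where w: "w \<in> W" "wall_symmetry k p" "g = w \<circ> k" by blast
    from step.hyps(1) show ?case
    proof
      assume "s \<in> flip ` axes"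
      then obtain m where "s = flip m" by blast
      then have "s \<circ> g = (flip m \<circ> w) \<circ> k" by (simp add: w(3) comp_assoc)
      then show ?thesis using W_comp[OF W_flip w(1)] w(2) by blast
    next
      assume "s \<in> turn ` axes"
      then obtain j where j: "s = turn j" "j \<in> axes" by blast
      obtain v where v: "v \<in> W" "turn j \<circ> w = v \<circ> turn j" using turn_conj[OF w(1) j(2)] by blast
      have "s \<circ> g = (turn j \<circ> w) \<circ> k" by (simp add: j(1) w(3) comp_assoc)
      then have "s \<circ> g = v \<circ> (turn j \<circ> k)" by (simp add: v(2) comp_assoc)
      then show ?thesis
        using v(1) wall_symmetry_comp[OF wall_symmetry_turn[OF j(2)] w(2)] by blast
    qed
  qed
  then show ?thesis using that by blast
qed

lemma flip_face_perm:
  assumes "j \<in> axes"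
  shows "flip (face_perm j m) = turn j \<circ> flip m \<circ> turn j"
  unfolding wall_symmetry_flip[OF wall_symmetry_turn[OF assms]] comp_assoc turn_comp_turn by simp

lemma flip_foldr:
  assumes "set js \<subseteq> axes" "turn ` set js \<subseteq> generated S" "flip a \<in> generated S"
  shows "flip (foldr face_perm js a) \<in> generated S"
  using assms
proof (induction js)
  case (Cons j js)
  then have "turn j \<circ> flip (foldr face_perm js a) \<circ> turn j \<in> generated S"
    by (intro generated_comp) auto
  moreover have "j \<in> axes" using Cons.prems by simp
  ultimately show ?case unfolding foldr_Cons comp_apply[of "face_perm j"] by (simp only: flip_face_perm)
qed simp

lemma foldr_turn:
  assumes "set js \<subseteq> axes" "turn ` set js \<subseteq> S"
  obtains k where "k \<in> generated S" "wall_symmetry k (foldr face_perm js)"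
proof -
  have "\<exists>k\<in>generated S. wall_symmetry k (foldr face_perm js)"
    using assms
  proof (induction js)
    case Nil
    then show ?case using generated.id wall_symmetry_id by (metis foldr_Nil)
  next
    case (Cons j js)
    then obtain k where k: "k \<in> generated S" "wall_symmetry k (foldr face_perm js)" by auto
    have "turn j \<circ> k \<in> generated S" using Cons.prems k(1) by (intro generated.step) auto
    moreover have "wall_symmetry (turn j \<circ> k) (foldr face_perm (j # js))"
      unfolding foldr_Cons using Cons.prems k(2)
      by (intro wall_symmetry_comp wall_symmetry_turn) auto
    ultimately show ?case by blast
  qed
  then show ?thesis using that by blast
qed

text \<open>Only three of the twelve flips are generators of \<open>G\<close>; transitivity on the
  walls makes the others conjugates of these by face reflections.\<close>

lemma W_G: "w \<in> W \<Longrightarrow> w \<in> G"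
proof -
  have "flip m \<in> G" for m
  proof -
    obtain js B where jB: "set js \<subseteq> axes" "B \<subseteq> axes" "{m} = foldr face_perm js ` B"
      by (rule clique_transitive[of "{m}"]) (auto simp: clique_def)
    then obtain a where a: "a \<in> axes" "m = foldr face_perm js a" by blast
    have "turn ` set js \<subseteq> G" "flip a \<in> G"
      using jB(1) a(1) unfolding G_def by (auto intro: generated_base)
    then show ?thesis
      unfolding a(2) G_def using jB(1) by (intro flip_foldr)
  qed
  then show "w \<in> W \<Longrightarrow> w \<in> G"
    unfolding W_def G_def using generated_subset[of "range flip"] by blast
qed

lemma clique_axes: "clique axes"
  by (auto simp: clique_def axes_def adj_def)

text \<open>The bridge between faces of one cube moved by \<open>G\<close> and cliques moved by
  \<open>W\<close>. Splitting off a vertex symmetry gives one inclusion, transitivity on nonempty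
  cliques the other; hence \<open>d > 0\<close>.\<close>

lemma G_cells:
  assumes "d > 0"
  shows "{block g B |g B. g \<in> G \<and> B \<subseteq> axes \<and> card B = d} = cells d"
proof (intro equalityI subsetI)
  fix x assume "x \<in> {block g B |g B. g \<in> G \<and> B \<subseteq> axes \<and> card B = d}"
  then obtain g B where x: "x = block g B" "g \<in> G" "B \<subseteq> axes" "card B = d" by blast
  obtain w k p where w: "w \<in> W" "wall_symmetry k p" "g = w \<circ> k" using G_decompose[OF x(2)] .
  have "x = block w (p ` B)"
    by (simp add: x(1) w(3) wall_symmetry_block[OF w(2)])
  moreover have "clique (p ` B)"
    using wall_symmetry_clique[OF w(2)] clique_subset[OF clique_axes x(3)] by blast
  moreover have "card (p ` B) = d"
    using wall_symmetry_inj[OF w(2)] x(4) card_image inj_on_subset by blast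
  ultimately show "x \<in> cells d" using w(1) unfolding cells_def by blast
next
  fix x assume "x \<in> cells d"
  then obtain w S where x: "x = block w S" "w \<in> W" "clique S" "card S = d"
    unfolding cells_def by blast
  have "S \<noteq> {}" using x(4) assms by auto
  then obtain js B where jB: "set js \<subseteq> axes" "B \<subseteq> axes" "S = foldr face_perm js ` B"
    using clique_transitive[OF x(3)] by metis
  obtain k where k: "k \<in> G" "wall_symmetry k (foldr face_perm js)"
    unfolding G_def by (rule foldr_turn[OF jB(1), of "flip ` axes \<union> turn ` axes"]) (use jB(1) in auto)
  have "x = block (w \<circ> k) B"
    by (simp add: x(1) jB(3) wall_symmetry_block[OF k(2)])
  moreover have "card B = d"
    using wall_symmetry_inj[OF k(2)] x(4) jB(3) by (metis card_image inj_on_subset subset_UNIV)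
  ultimately show "x \<in> {block g B |g B. g \<in> G \<and> B \<subseteq> axes \<and> card B = d}"
    using G_comp[OF W_G[OF x(2)] k(1)] jB(2) by blast
qed

subsection \<open>The base cube\<close>

definition ix :: "wall \<Rightarrow> 3" where
  "ix c = (case c of X0 \<Rightarrow> 1 | X1 \<Rightarrow> 2 | _ \<Rightarrow> 3)"

lemma ix_surj: "\<exists>c\<in>axes. i = ix c"
  using exhaust_3[of i] by (auto simp: ix_def axes_def)

lemma ix_inj: "c \<in> axes \<Longrightarrow> d \<in> axes \<Longrightarrow> ix c = ix d \<longleftrightarrow> c = d"
  by (auto simp: ix_def axes_def)

lemma coordinate_axis: "c \<in> axes \<Longrightarrow> snd x $ ix c = - lorentz x (nrm c)"
  by (auto simp: axes_def ix_def lorentz_def pt_def inner_vec_def sum_3)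

lemma coordinate_vtx:
  assumes "B \<subseteq> axes" "c \<in> axes"
  shows "snd (vtx B) $ ix c = (if c \<in> B then - cube_s else cube_s)"
  using coordinate_axis[OF assms(2)] vtx_nrm[of c B] assms clique_subset[OF clique_axes] by simp

lemma fst_vtx:
  assumes "B \<subseteq> axes"
  shows "fst (vtx B) = cube_t"
proof -
  have "(\<Sum>c\<in>B. fst (nrm c)) = 0"
    using assms by (intro sum.neutral) (auto simp: axes_def pt_def)
  then have "fst (\<Sum>c\<in>B. nrm c) = 0"
    by (simp add: fst_sum)
  then show ?thesis
    using cube_s_pos by (simp add: vtx_def corner_def pt_def kappa_def)
qed

lemma base_cube_eqI:
  assumes "fst x = cube_t" "fst y = cube_t" "\<And>c. c \<in> axes \<Longrightarrow> snd x $ ix c = snd y $ ix c"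
  shows "x = y"
proof -
  have "snd x $ i = snd y $ i" for i
    using ix_surj[of i] assms(3) by auto
  then show ?thesis
    using assms(1,2) by (simp add: prod_eq_iff vec_eq_iff)
qed

lemma base_cube_iff: "x \<in> base_cube \<longleftrightarrow> (\<exists>B\<subseteq>axes. x = vtx B)"
proof
  assume x: "x \<in> base_cube"
  \<comment> \<open>All coordinates of \<open>corner\<close> are positive, so the negative
    coordinates record the walls that have been crossed.\<close>
  let ?B = "{c \<in> axes. snd x $ ix c = - cube_s}"
  have "x = vtx ?B"
  proof (rule base_cube_eqI)
    show "fst x = cube_t" using x by (simp add: base_cube_def)
    show "fst (vtx ?B) = cube_t" by (rule fst_vtx) blast
    fix c assume c: "c \<in> axes"
    have "snd x $ ix c = cube_s \<or> snd x $ ix c = - cube_s"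
      using x unfolding base_cube_def by (smt (verit) mem_Collect_eq)
    moreover have "snd (vtx ?B) $ ix c = (if c \<in> ?B then - cube_s else cube_s)"
      by (rule coordinate_vtx) (use c in blast)+
    ultimately show "snd x $ ix c = snd (vtx ?B) $ ix c"
      using c by (cases "c \<in> ?B") simp_all
  qed
  moreover have "?B \<subseteq> axes" by blast
  ultimately show "\<exists>B\<subseteq>axes. x = vtx B" by (intro exI[of _ ?B] conjI)
next
  assume "\<exists>B\<subseteq>axes. x = vtx B"
  then obtain B where B: "B \<subseteq> axes" "x = vtx B" by blast
  have "\<bar>snd x $ i\<bar> = cube_s" for i
    using ix_surj[of i] coordinate_vtx[OF B(1)] cube_s_pos B(2) by auto
  then show "x \<in> base_cube"
    using fst_vtx[OF B(1)] B(2) by (simp add: base_cube_def)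
qed

lemma base_cube_block: "base_cube = block id axes"
  unfolding block_def set_eq_iff base_cube_iff by (simp only: id_apply image_iff Pow_iff Bex_def) blast

section \<open>Sign changes of the base cube\<close>

definition sign_group :: "(mink \<Rightarrow> mink) set" where
  "sign_group = generated (flip ` axes)"

text \<open>With vertices of the cube as subsets of \<open>axes\<close>, a sign change is the
  translation by \<open>C\<close> modulo 2.\<close>

definition acts_by :: "wall set \<Rightarrow> (mink \<Rightarrow> mink) \<Rightarrow> bool" where
  "acts_by C b \<longleftrightarrow> C \<subseteq> axes \<and> (\<forall>B\<subseteq>axes. b (vtx B) = vtx (sym_diff B C))"

lemma acts_by_id: "acts_by {} id"
  by (simp add: acts_by_def)

lemma acts_by_flip:
  assumes "acts_by C b" "a \<in> axes"
  shows "acts_by (sym_diff C {a}) (flip a \<circ> b)"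
proof -
  have "flip a (vtx (sym_diff B C)) = vtx (sym_diff B (sym_diff C {a}))" if "B \<subseteq> axes" for B
  proof -
    have "clique (insert a (sym_diff B C))"
      by (rule clique_subset[OF clique_axes]) (use assms that in \<open>auto simp: acts_by_def\<close>)
    moreover have "(if a \<in> sym_diff B C then sym_diff B C - {a} else insert a (sym_diff B C))
        = sym_diff B (sym_diff C {a})"
      by auto
    ultimately show ?thesis by (simp only: flip_vtx)
  qed
  then show ?thesis
    using assms by (auto simp: acts_by_def)
qed

lemma sign_group_acts:
  assumes "b \<in> sign_group"
  obtains C where "acts_by C b"
proof -
  have "\<exists>C. acts_by C b"
    using assms unfolding sign_group_def
  proof induction
    case id
    then show ?case using acts_by_id by blast
  next
    case (step s g)
    then show ?case using acts_by_flip by blast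
  qed
  then show ?thesis using that by blast
qed

lemma acts_by_exists:
  assumes "C \<subseteq> axes"
  obtains b where "b \<in> sign_group" "acts_by C b"
proof -
  have "finite C" by simp
  then have "C \<subseteq> axes \<Longrightarrow> \<exists>b\<in>sign_group. acts_by C b"
  proof (induction C rule: finite_induct)
    case empty
    then show ?case using acts_by_id generated.id unfolding sign_group_def by blast
  next
    case (insert a C)
    then obtain b where b: "b \<in> sign_group" "acts_by C b" by blast
    have "sym_diff C {a} = insert a C" using insert.hyps(2) by blast
    then have "acts_by (insert a C) (flip a \<circ> b)"
      using acts_by_flip[OF b(2), of a] insert.prems by auto
    moreover have "flip a \<circ> b \<in> sign_group"
      using b(1) insert.prems unfolding sign_group_def by (intro generated.step) auto
    ultimately show ?case by blast
  qed
  then show ?thesis using assms that by blast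
qed

text \<open>\<open>E\<close> is the set of fixed coordinates and \<open>C\<close> gives their signs;
  no, one or two fixed coordinates yield the cube, its squares and its edges.\<close>

lemma block_acts:
  assumes "acts_by C b" "E \<subseteq> axes"
  shows "block b (axes - E) =
    {x \<in> base_cube. \<forall>c\<in>E. snd x $ ix c = (if c \<in> C then - cube_s else cube_s)}"
proof (intro equalityI subsetI)
  fix x assume "x \<in> block b (axes - E)"
  then obtain B where B: "B \<subseteq> axes - E" "x = b (vtx B)" by (auto simp: block_def)
  then have x: "x = vtx (sym_diff B C)" "sym_diff B C \<subseteq> axes"
    using assms by (auto simp: acts_by_def)
  have "snd x $ ix c = (if c \<in> C then - cube_s else cube_s)" if "c \<in> E" for c
  proof -
    have "c \<in> axes" "c \<notin> B" using that assms(2) B(1) by blast+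
    then show ?thesis using coordinate_vtx[OF x(2), of c] unfolding x(1) by auto
  qed
  then show "x \<in> {x \<in> base_cube. \<forall>c\<in>E. snd x $ ix c = (if c \<in> C then - cube_s else cube_s)}"
    using x base_cube_iff by blast
next
  fix x assume x: "x \<in> {x \<in> base_cube. \<forall>c\<in>E. snd x $ ix c = (if c \<in> C then - cube_s else cube_s)}"
  then obtain B where B: "B \<subseteq> axes" "x = vtx B" using base_cube_iff by blast
  have "c \<in> B \<longleftrightarrow> c \<in> C" if "c \<in> E" for c
  proof -
    have "c \<in> axes" "snd (vtx B) $ ix c = (if c \<in> C then - cube_s else cube_s)"
      using that assms(2) x unfolding B(2) by blast+
    then show ?thesis using coordinate_vtx[OF B(1), of c] cube_s_pos by (auto split: if_splits)
  qed
  then have 1: "sym_diff B C \<subseteq> axes - E"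
    using assms B(1) by (auto simp: acts_by_def)
  have "x = vtx (sym_diff (sym_diff B C) C)"
    unfolding B(2) by (rule arg_cong[of _ _ vtx]) blast
  also have "\<dots> = b (vtx (sym_diff B C))"
    using assms(1) 1 unfolding acts_by_def by (metis Diff_subset order_trans)
  finally show "x \<in> block b (axes - E)"
    using 1 unfolding block_def by blast
qed

lemma base_squares_eq: "base_squares = {block b (axes - {j}) |b j. b \<in> sign_group \<and> j \<in> axes}"
proof (intro equalityI subsetI)
  fix T assume "T \<in> base_squares"
  then obtain i a where T: "T = {x \<in> base_cube. snd x $ i = a}" "\<bar>a\<bar> = cube_s"
    by (auto simp: base_squares_def)
  obtain j where j: "j \<in> axes" "i = ix j" using ix_surj by blast
  define C where "C = (if a = cube_s then {} else {j})"
  have "C \<subseteq> axes" using j(1) by (simp add: C_def)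
  then obtain b where b: "b \<in> sign_group" "acts_by C b"
    using acts_by_exists by blast
  have "a = (if j \<in> C then - cube_s else cube_s)" using T(2) by (auto simp: C_def)
  then have "T = block b (axes - {j})"
    using block_acts[OF b(2), of "{j}"] j unfolding T(1) by auto
  then show "T \<in> {block b (axes - {j}) |b j. b \<in> sign_group \<and> j \<in> axes}"
    using b j by blast
next
  fix T assume "T \<in> {block b (axes - {j}) |b j. b \<in> sign_group \<and> j \<in> axes}"
  then obtain b j where T: "T = block b (axes - {j})" "b \<in> sign_group" "j \<in> axes" by blast
  obtain C where C: "acts_by C b" using sign_group_acts[OF T(2)] .
  have "T = {x \<in> base_cube. snd x $ ix j = (if j \<in> C then - cube_s else cube_s)}"
    using block_acts[OF C, of "{j}"] T by simp
  moreover have "\<bar>if j \<in> C then - cube_s else cube_s\<bar> = cube_s" using cube_s_pos by auto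
  ultimately show "T \<in> base_squares" unfolding base_squares_def by blast
qed

lemma base_edges_eq:
  "base_edges = {block b (axes - {i, j}) |b i j. b \<in> sign_group \<and> i \<in> axes \<and> j \<in> axes \<and> i \<noteq> j}"
proof (intro equalityI subsetI)
  fix T assume "T \<in> base_edges"
  then obtain k l p q where T: "T = {x \<in> base_cube. snd x $ k = p \<and> snd x $ l = q}"
      "k \<noteq> l" "\<bar>p\<bar> = cube_s" "\<bar>q\<bar> = cube_s"
    unfolding base_edges_def by blast
  obtain i where i: "i \<in> axes" "k = ix i" using ix_surj by blast
  obtain j where j: "j \<in> axes" "l = ix j" using ix_surj by blast
  have ij: "i \<noteq> j" using T(2) i j by blast
  define C where "C = (if p = cube_s then {} else {i}) \<union> (if q = cube_s then {} else {j})"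
  have "C \<subseteq> axes" using i j by (auto simp: C_def)
  then obtain b where b: "b \<in> sign_group" "acts_by C b"
    using acts_by_exists by blast
  have "p = (if i \<in> C then - cube_s else cube_s)" "q = (if j \<in> C then - cube_s else cube_s)"
    using T(3,4) ij by (auto simp: C_def)
  then have "T = block b (axes - {i, j})"
    using block_acts[OF b(2), of "{i, j}"] i j unfolding T(1) by auto
  then show "T \<in> {block b (axes - {i, j}) |b i j. b \<in> sign_group \<and> i \<in> axes \<and> j \<in> axes \<and> i \<noteq> j}"
    using b i j ij by blast
next
  fix T assume "T \<in> {block b (axes - {i, j}) |b i j. b \<in> sign_group \<and> i \<in> axes \<and> j \<in> axes \<and> i \<noteq> j}"
  then obtain b i j where T: "T = block b (axes - {i, j})" "b \<in> sign_group" "i \<in> axes" "j \<in> axes" "i \<noteq> j"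
    by blast
  obtain C where C: "acts_by C b" using sign_group_acts[OF T(2)] .
  have "T = {x \<in> base_cube. snd x $ ix i = (if i \<in> C then - cube_s else cube_s)
      \<and> snd x $ ix j = (if j \<in> C then - cube_s else cube_s)}"
    using block_acts[OF C, of "{i, j}"] T by simp
  moreover have "\<bar>if c \<in> C then - cube_s else cube_s\<bar> = cube_s" for c using cube_s_pos by auto
  moreover have "ix i \<noteq> ix j" using T ix_inj by blast
  ultimately show "T \<in> base_edges" unfolding base_edges_def by blast
qed

lemma sign_group_id: "id \<in> sign_group"
  by (simp add: sign_group_def generated.id)

lemma sign_group_G: "b \<in> sign_group \<Longrightarrow> b \<in> G"
  unfolding sign_group_def G_def using generated_subset[of "flip ` axes" "flip ` axes \<union> turn ` axes"]
  by (auto intro: generated_base)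

section \<open>Reflections in squares and the group of the honeycomb\<close>

lemma pt_surj: "\<exists>a b c d. n = pt a b c d"
proof -
  have "n = pt (fst n / kappa) (snd n $ 1) (snd n $ 2) (snd n $ 3)"
    using kappa_pos by (simp add: pt_def prod_eq_iff vec_eq_iff forall_3)
  then show ?thesis by blast
qed

lemma face_nrm_axis: "j \<in> axes \<Longrightarrow> c \<in> axes \<Longrightarrow> c \<noteq> j \<Longrightarrow> lorentz (nrm c) (face_nrm j) = 0"
  by (auto simp: axes_def lorentz_pt)

lemma corner_face_nrm: "lorentz corner (face_nrm j) = 0"
  by (cases j) (simp_all add: corner_def lorentz_bilinear lorentz_pt)

lemma face_nrm_perp:
  assumes "j \<in> axes" "x \<in> block id (axes - {j})"
  shows "lorentz x (face_nrm j) = 0"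
proof -
  obtain B where B: "B \<subseteq> axes - {j}" "x = vtx B" using assms(2) by (auto simp: block_def)
  then have "(\<Sum>c\<in>B. lorentz (nrm c) (face_nrm j)) = 0"
    using assms(1) by (intro sum.neutral) (auto intro: face_nrm_axis)
  then show ?thesis
    by (simp add: B(2) vtx_def lorentz_bilinear lorentz_sum_left corner_face_nrm)
qed

text \<open>Three linear conditions on four coordinates leave a line: the two axes in the face kill
  two coordinates, and \<open>corner\<close> ties the third one to the time. This is why a square
  determines its reflection.\<close>

lemma face_nrm_unique:
  assumes j: "j \<in> axes" and n: "\<forall>x\<in>block id (axes - {j}). lorentz x n = 0"
  shows "\<exists>r. n = r *\<^sub>R face_nrm j"
proof -
  have 0: "lorentz corner n = 0" using n block_corner[of id] by auto
  have c: "lorentz (nrm c) n = 0" if "c \<in> axes - {j}" for c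
  proof -
    have "lorentz (flip c corner) n = 0" using n block_neighbour[OF that, of id] by auto
    then show ?thesis using 0 cube_s_pos by (simp add: flip_corner lorentz_bilinear)
  qed
  obtain p q r s where pt: "n = pt p q r s" using pt_surj by blast
  have "lorentz (pt 1 1 1 1) n = 0"
    using 0 cube_s_pos by (simp add: corner_def lorentz_bilinear)
  then have "n = p *\<^sub>R face_nrm j"
    using j c[of X0] c[of X1] c[of X2] unfolding pt axes_def
    by (auto simp: lorentz_pt pt_scale pt_inject algebra_simps)
  then show ?thesis by blast
qed

lemma reflections_in_block:
  assumes g: "g \<in> G" and j: "j \<in> axes"
  shows "reflections_in (block g (axes - {j})) = {reflection (g (face_nrm j))}"
proof -
  obtain h where h: "h \<in> G" "h \<circ> g = id" "g \<circ> h = id" using G_inverse[OF g] .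
  note iso = G_isometry[OF g] G_isometry[OF h(1)]
  have T: "block g (axes - {j}) = g ` block id (axes - {j})" by (simp add: block_image)
  have "lorentz (g (face_nrm j)) (g (face_nrm j)) > 0"
    using face_nrm_pos by (simp add: isometry_lorentz[OF iso(1)])
  moreover have "\<forall>x\<in>block g (axes - {j}). lorentz x (g (face_nrm j)) = 0"
    unfolding T using face_nrm_perp[OF j] by (auto simp: isometry_lorentz[OF iso(1)])
  ultimately have "reflection (g (face_nrm j)) \<in> reflections_in (block g (axes - {j}))"
    unfolding reflections_in_def by blast
  moreover have "reflection n = reflection (g (face_nrm j))"
    if n: "lorentz n n > 0" "\<forall>x\<in>block g (axes - {j}). lorentz x n = 0" for n
  proof -
    have gh: "g (h n) = n" using h(3) by (rule pointfree_idE)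
    have "lorentz x (h n) = 0" if "x \<in> block id (axes - {j})" for x
    proof -
      have "lorentz (g x) n = 0" using n(2) that unfolding T by blast
      then show ?thesis using isometry_lorentz[OF iso(1), of x "h n"] gh by simp
    qed
    then obtain r where r: "h n = r *\<^sub>R face_nrm j" using face_nrm_unique[OF j] by blast
    then have "n = r *\<^sub>R g (face_nrm j)"
      using gh isometry_linear[OF iso(1)] by (metis linear_scale)
    moreover have "r \<noteq> 0" using n(1) calculation by (auto simp: lorentz_bilinear)
    ultimately show ?thesis by (simp add: reflection_scale)
  qed
  ultimately show ?thesis unfolding reflections_in_def by blast
qed

lemma reflection_face:
  assumes "g \<in> G"
  shows "reflection (g (face_nrm j)) \<circ> g = g \<circ> turn j"
  using isometry_reflection[OF G_isometry[OF assms]] by (auto simp: fun_eq_iff turn_def)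

lemma face_reflection_G:
  assumes "g \<in> G" "j \<in> axes"
  shows "reflection (g (face_nrm j)) \<in> G"
proof -
  obtain h where h: "h \<in> G" "h \<circ> g = id" "g \<circ> h = id" using G_inverse[OF assms(1)] .
  have "reflection (g (face_nrm j)) = (g \<circ> turn j) \<circ> h"
    unfolding reflection_face[OF assms(1), symmetric] comp_assoc h(3) by simp
  then show ?thesis using G_comp[OF G_comp[OF assms(1) G_turn[OF assms(2)]] h(1)] by simp
qed

lemma honeycomb_group_G: "g \<in> honeycomb_group \<Longrightarrow> g \<in> G"
proof (induction rule: honeycomb_group.induct)
  case id
  then show ?case by (rule G_id)
next
  case (step g T r)
  then obtain b j where b: "b \<in> sign_group" "j \<in> axes" "T = block b (axes - {j})"
    unfolding base_squares_eq by blast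
  then have "r = reflection (b (face_nrm j))"
    using step.hyps(3) reflections_in_block[OF sign_group_G[OF b(1)] b(2)] by simp
  then have "r \<in> G" using face_reflection_G[OF sign_group_G[OF b(1)] b(2)] by simp
  then show ?case by (rule G_comp[OF step.IH])
qed

text \<open>Up to sign changes, which preserve the base cube, both groups agree. A
  \<open>turn\<close> multiplied to the right of \<open>b\<close> becomes, on the left of
  \<open>b\<close>, the reflection in another face of the base cube.\<close>

lemma G_honeycomb_group:
  assumes "g \<in> G"
  obtains h b where "h \<in> honeycomb_group" "b \<in> sign_group" "g = h \<circ> b"
proof -
  have "\<exists>h\<in>honeycomb_group. \<exists>b\<in>sign_group. g = h \<circ> b"
    using assms unfolding G_def
  proof (induction rule: generated_induct_right)
    case id
    have "id = id \<circ> (id :: mink \<Rightarrow> mink)" by simp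
    then show ?case using honeycomb_group.id sign_group_id by blast
  next
    case (step g s)
    then obtain h b where h: "h \<in> honeycomb_group" "b \<in> sign_group" "g = h \<circ> b" by blast
    from step.hyps(2) show ?case
    proof
      assume "s \<in> flip ` axes"
      then have "b \<circ> s \<in> sign_group"
        using h(2) unfolding sign_group_def by (intro generated_right)
      then show ?thesis using h(1) unfolding h(3) comp_assoc by blast
    next
      assume "s \<in> turn ` axes"
      then obtain j where j: "s = turn j" "j \<in> axes" by blast
      let ?r = "reflection (b (face_nrm j))"
      have "?r \<in> reflections_in (block b (axes - {j}))"
        using reflections_in_block[OF sign_group_G[OF h(2)] j(2)] by simp
      moreover have "block b (axes - {j}) \<in> base_squares"
        using h(2) j(2) unfolding base_squares_eq by blast
      ultimately have "h \<circ> ?r \<in> honeycomb_group"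
        using honeycomb_group.step[OF h(1)] by blast
      moreover have "g \<circ> s = (h \<circ> ?r) \<circ> b"
        unfolding h(3) j(1) comp_assoc reflection_face[OF sign_group_G[OF h(2)]] ..
      ultimately show ?thesis using h(2) by blast
    qed
  qed
  then show ?thesis using that by blast
qed

lemma sign_group_block:
  assumes "b \<in> sign_group"
  shows "block b axes = base_cube"
proof -
  obtain C where "acts_by C b" using sign_group_acts[OF assms] .
  then show ?thesis using block_acts[of C b "{}"] by simp
qed

lemma card_axes: "card axes = 3"
  by (simp add: axes_def)

lemma cubes_cells: "cubes = cells 3"
proof -
  have "cubes = {block g B |g B. g \<in> G \<and> B \<subseteq> axes \<and> card B = 3}"
  proof (intro equalityI subsetI)
    fix Q assume "Q \<in> cubes"
    then obtain g where g: "Q = g ` base_cube" "g \<in> honeycomb_group" unfolding cubes_def by blast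
    then have "Q = block g axes" by (simp add: base_cube_block block_image)
    then show "Q \<in> {block g B |g B. g \<in> G \<and> B \<subseteq> axes \<and> card B = 3}"
      using honeycomb_group_G[OF g(2)] card_axes by blast
  next
    fix Q assume "Q \<in> {block g B |g B. g \<in> G \<and> B \<subseteq> axes \<and> card B = 3}"
    then obtain g B where Q: "Q = block g B" "g \<in> G" "B \<subseteq> axes" "card B = 3" by blast
    then have B: "B = axes" using card_axes by (intro card_seteq) auto
    obtain h b where h: "h \<in> honeycomb_group" "b \<in> sign_group" "g = h \<circ> b"
      using G_honeycomb_group[OF Q(2)] .
    have "Q = h ` base_cube"
      by (simp add: Q(1) B h(3) block_image[symmetric] sign_group_block[OF h(2)])
    then show "Q \<in> cubes" using h(1) unfolding cubes_def by blast
  qed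
  then show ?thesis by (simp add: G_cells)
qed

lemma axes_subset_2: "B \<subseteq> axes \<and> card B = 2 \<longleftrightarrow> (\<exists>j\<in>axes. B = axes - {j})"
proof
  assume B: "B \<subseteq> axes \<and> card B = 2"
  then have "card (axes - B) = 1" using card_axes by (simp add: card_Diff_subset)
  then obtain j where "axes - B = {j}" by (auto simp: card_1_singleton_iff)
  then show "\<exists>j\<in>axes. B = axes - {j}" using B by blast
qed (auto simp: card_axes)

lemma axes_subset_1: "B \<subseteq> axes \<and> card B = 1 \<longleftrightarrow> (\<exists>i\<in>axes. \<exists>j\<in>axes. i \<noteq> j \<and> B = axes - {i, j})"
proof
  assume B: "B \<subseteq> axes \<and> card B = 1"
  then have "card (axes - B) = 2" using card_axes by (simp add: card_Diff_subset)
  then obtain i j where "axes - B = {i, j}" "i \<noteq> j" by (auto simp: card_2_iff)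
  then show "\<exists>i\<in>axes. \<exists>j\<in>axes. i \<noteq> j \<and> B = axes - {i, j}" using B by blast
qed (auto simp: card_axes card_Diff_subset)

lemma squares_cells: "squares = cells 2"
proof -
  have "squares = {block g B |g B. g \<in> G \<and> B \<subseteq> axes \<and> card B = 2}"
  proof (intro equalityI subsetI)
    fix T assume "T \<in> squares"
    then obtain h b j where T: "T = h ` block b (axes - {j})" "h \<in> honeycomb_group" "b \<in> sign_group" "j \<in> axes"
      unfolding squares_def base_squares_eq by blast
    have "T = block (h \<circ> b) (axes - {j})" "h \<circ> b \<in> G"
      using T by (auto simp: block_image intro: G_comp honeycomb_group_G sign_group_G)
    then show "T \<in> {block g B |g B. g \<in> G \<and> B \<subseteq> axes \<and> card B = 2}"
      using axes_subset_2[of "axes - {j}"] T(4) by blast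
  next
    fix T assume "T \<in> {block g B |g B. g \<in> G \<and> B \<subseteq> axes \<and> card B = 2}"
    then obtain g B where B: "T = block g B" "g \<in> G" "B \<subseteq> axes" "card B = 2" by blast
    then obtain j where j: "j \<in> axes" "B = axes - {j}"
      using axes_subset_2[of B] by blast
    note T = B(1)[unfolded j(2)] B(2) j(1)
    obtain h b where h: "h \<in> honeycomb_group" "b \<in> sign_group" "g = h \<circ> b"
      using G_honeycomb_group[OF T(2)] .
    have "T = h ` block b (axes - {j})"
      by (simp add: T(1) h(3) block_image)
    then show "T \<in> squares"
      using h T(3) unfolding squares_def base_squares_eq by blast
  qed
  then show ?thesis by (simp add: G_cells)
qed

lemma edges_cells: "edges = cells 1"
proof -
  have "edges = {block g B |g B. g \<in> G \<and> B \<subseteq> axes \<and> card B = 1}"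
  proof (intro equalityI subsetI)
    fix T assume "T \<in> edges"
    then obtain h b i j where T: "T = h ` block b (axes - {i, j})" "h \<in> honeycomb_group" "b \<in> sign_group"
        "i \<in> axes" "j \<in> axes" "i \<noteq> j"
      unfolding edges_def base_edges_eq by blast
    have "T = block (h \<circ> b) (axes - {i, j})" "h \<circ> b \<in> G"
      using T by (auto simp: block_image intro: G_comp honeycomb_group_G sign_group_G)
    then show "T \<in> {block g B |g B. g \<in> G \<and> B \<subseteq> axes \<and> card B = 1}"
      using axes_subset_1[of "axes - {i, j}"] T(4-6) by blast
  next
    fix T assume "T \<in> {block g B |g B. g \<in> G \<and> B \<subseteq> axes \<and> card B = 1}"
    then obtain g B where B: "T = block g B" "g \<in> G" "B \<subseteq> axes" "card B = 1" by blast
    then obtain i j where j: "i \<in> axes" "j \<in> axes" "i \<noteq> j" "B = axes - {i, j}"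
      using axes_subset_1[of B] by blast
    note T = B(1)[unfolded j(4)] B(2) j(1-3)
    obtain h b where h: "h \<in> honeycomb_group" "b \<in> sign_group" "g = h \<circ> b"
      using G_honeycomb_group[OF T(2)] .
    have "T = h ` block b (axes - {i, j})"
      by (simp add: T(1) h(3) block_image)
    then show "T \<in> edges"
      using h T(3-5) unfolding edges_def base_edges_eq by blast
  qed
  then show ?thesis by (simp add: G_cells)
qed

subsection \<open>The vertex figures of the pyramid\<close>

text \<open>The directions that stay in the pyramid at a vertex on the planes in \<open>I\<close>:
  for each of them, along the plane or inwards across its wall. See \<open>pyr_flip\<close>.\<close>

definition star :: "wall set \<Rightarrow> wall set" where
  "star I = {m. \<forall>i\<in>I. m = i \<or> adj i m}"

definition axis_lists :: "wall list list" where
  "axis_lists = [[], [X0], [X1], [X2], [X0, X1], [X0, X2], [X1, X2]]"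

lemma axis_list:
  assumes "I \<subset> axes"
  obtains xs where "xs \<in> set axis_lists" "distinct xs" "I = set xs"
proof -
  have "I \<in> {{}, {X0}, {X1}, {X2}, {X0, X1}, {X0, X2}, {X1, X2}}"
    using assms unfolding axes_def by blast
  then have "\<exists>xs\<in>set axis_lists. distinct xs \<and> I = set xs"
    unfolding axis_lists_def by (elim insertE emptyE) simp_all
  then show ?thesis using that by blast
qed

text \<open>Graph distance in the icosahedron, which has diameter three; it is the measure for walks
  around a vertex.\<close>

fun dist_wall :: "wall \<Rightarrow> wall \<Rightarrow> nat" where
  "dist_wall a b = (if a = b then 0 else if adj a b then 1
     else if list_ex (adj b) (nbrs a) then 2 else 3)"

lemma clique_3_triangle:
  assumes "clique S" "card S = 3"
  obtains t where "t \<in> set triangles" "S = set t"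
proof -
  have "S \<noteq> {}" using assms(2) by auto
  then obtain t where t: "t \<in> set triangles" "S \<subseteq> set t"
    using clique_triangle[OF assms(1)] by blast
  have "\<forall>t\<in>set triangles. length t = 3" by (simp add: triangles_def)
  then have "card (set t) \<le> 3" using t(1) card_length[of t] by simp
  then have "S = set t" using t(2) assms(2) by (intro card_seteq) simp_all
  then show ?thesis using that t(1) by blast
qed

text \<open>Around a vertex, cubes are triangles and squares are edges of the icosahedron. A
  triangle in the star that misses \<open>d\<close> can be exchanged for one nearer to
  \<open>d\<close> across an edge whose square lies on none of the planes in \<open>I\<close>. The
  cases are evaluated.\<close>

lemma star_connected:
  assumes I: "I \<subset> axes" and S: "clique S" "card S = 3" "S \<subseteq> star I"
    and d: "d \<in> star I" "d \<notin> S"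
  obtains a b c c' where "S = {a, b, c}" "a \<noteq> b" "c \<noteq> a" "c \<noteq> b" "adj a b" "adj a c'" "adj b c'"
    "c' \<in> star I" "dist_wall d c' < dist_wall d c" "\<forall>i\<in>I. \<not> (adj i a \<and> adj i b)"
proof -
  obtain xs where xs: "xs \<in> set axis_lists" "I = set xs" using axis_list[OF I] by metis
  obtain t where t: "t \<in> set triangles" "S = set t" using clique_3_triangle[OF S(1,2)] .
  let ?st = "\<lambda>xs m. list_all (\<lambda>i. m = i \<or> adj i m) xs"
  have "list_all (\<lambda>xs. list_all (\<lambda>t. list_all (?st xs) t \<longrightarrow> list_all (\<lambda>d. \<not> ?st xs d \<or> d \<in> set t \<or>
      list_ex (\<lambda>c. case filter (\<lambda>x. x \<noteq> c) t of
        [a, b] \<Rightarrow> list_all (\<lambda>i. \<not> (adj i a \<and> adj i b)) xs \<and> adj a b \<and> a \<noteq> b \<and>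
          list_ex (\<lambda>c'. adj b c' \<and> ?st xs c' \<and> dist_wall d c' < dist_wall d c) (nbrs a)
        | _ \<Rightarrow> False) t) walls) triangles) axis_lists"
    by code_simp
  then have "\<exists>c\<in>set t. case filter (\<lambda>x. x \<noteq> c) t of
        [a, b] \<Rightarrow> (\<forall>i\<in>set xs. \<not> (adj i a \<and> adj i b)) \<and> adj a b \<and> a \<noteq> b \<and>
          (\<exists>c'\<in>set (nbrs a). adj b c' \<and> c' \<in> star I \<and> dist_wall d c' < dist_wall d c)
        | _ \<Rightarrow> False"
    using xs t S(3) d unfolding list_all_iff list_ex_iff set_walls star_def subset_iff mem_Collect_eq
    by blast
  then obtain c where c: "c \<in> set t" "case filter (\<lambda>x. x \<noteq> c) t of
        [a, b] \<Rightarrow> (\<forall>i\<in>set xs. \<not> (adj i a \<and> adj i b)) \<and> adj a b \<and> a \<noteq> b \<and>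
          (\<exists>c'\<in>set (nbrs a). adj b c' \<and> c' \<in> star I \<and> dist_wall d c' < dist_wall d c)
        | _ \<Rightarrow> False" by blast
  then obtain a b where ab: "filter (\<lambda>x. x \<noteq> c) t = [a, b]"
    by (auto split: list.splits)
  have "set t - {c} = {a, b}"
    using arg_cong[OF ab, of set] by auto
  then have "S = {a, b, c}" "c \<noteq> a" "c \<noteq> b" using c(1) t(2) by auto
  then show ?thesis
    using c(2) that[of a b c] xs(2) unfolding ab by (auto simp: adj_def)
qed

text \<open>Ensures that each edge allowed by the inequalities lies in a cube allowed by
  them.\<close>

lemma star_triangle:
  assumes I: "I \<subseteq> axes" and m: "m \<in> star I"
  obtains S where "clique S" "card S = 3" "S \<subseteq> star I" "m \<in> S"
proof (cases "I = axes")
  case True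
  have "list_all (\<lambda>m. list_all (\<lambda>i. m = i \<or> adj i m) [X0, X1, X2] \<longrightarrow> m \<in> set [X0, X1, X2]) walls"
    by code_simp
  then have "m \<in> axes"
    using m True unfolding list_all_iff set_walls by (auto simp: star_def axes_def)
  moreover have "axes \<subseteq> star axes"
    using clique_axes by (auto simp: star_def clique_def)
  ultimately show ?thesis using that[of axes] True clique_axes card_axes by blast
next
  case False
  then obtain xs where xs: "xs \<in> set axis_lists" "I = set xs" using axis_list[of I] I by blast
  let ?st = "\<lambda>xs m. list_all (\<lambda>i. m = i \<or> adj i m) xs"
  have "list_all (\<lambda>xs. list_all (\<lambda>m. ?st xs m \<longrightarrow>
      list_ex (\<lambda>a. ?st xs a \<and> list_ex (\<lambda>b. adj m b \<and> ?st xs b) (nbrs a)) (nbrs m)) walls) axis_lists"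
    by code_simp
  then have "\<exists>a\<in>set (nbrs m). a \<in> star I \<and> (\<exists>b\<in>set (nbrs a). adj m b \<and> b \<in> star I)"
    using xs m unfolding list_all_iff list_ex_iff set_walls star_def mem_Collect_eq by blast
  then obtain a b where ab: "adj m a" "a \<in> star I" "adj a b" "adj m b" "b \<in> star I"
    by (auto simp: adj_def)
  moreover have "card {m, a, b} = 3"
    using ab(1,3,4) by (auto simp: card_insert_if)
  moreover have "clique {m, a, b}"
    using ab(1,3,4) adj_sym by (auto simp: clique_def)
  ultimately show ?thesis using that[of "{m, a, b}"] m by blast
qed

text \<open>Descents are adjacent to all planes of a vertex, so away from the apex at most two
  planes can meet.\<close>

lemma no_common_neighbour: "\<not> (\<forall>i\<in>axes. adj i m)"
  using no_4_clique[of X0 X1 X2 m] by (auto simp: axes_def adj_def)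

lemma pentagon_edge:
  assumes "i \<in> axes" "adj i m"
  obtains b where "adj i b" "adj m b"
proof -
  have "list_all (\<lambda>i. list_all (\<lambda>m. list_ex (adj m) (nbrs i)) (nbrs i)) [X0, X1, X2]"
    by code_simp
  then have "\<exists>b\<in>set (nbrs i). adj m b"
    using assms unfolding list_all_iff list_ex_iff adj_def axes_def by auto
  then show ?thesis using that by (auto simp: adj_def)
qed

text \<open>By \<open>side_abs\<close> there are no values strictly between \<open>- cube_s\<close>
  and \<open>cube_s\<close>: each inequality says that the vertex is on the bounding plane or beyond
  its wall.\<close>

definition pyr :: "(mink \<Rightarrow> mink) set" where
  "pyr = {w \<in> W. \<forall>i\<in>axes. side i w \<ge> - cube_s}"

definition planes :: "(mink \<Rightarrow> mink) \<Rightarrow> wall set" where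
  "planes w = {i \<in> axes. side i w = - cube_s}"

lemma planes_axes: "planes w \<subseteq> axes"
  by (auto simp: planes_def)

lemma pyr_W: "w \<in> pyr \<Longrightarrow> w \<in> W"
  by (simp add: pyr_def)

lemma side_not_plane:
  assumes "w \<in> pyr" "i \<in> axes" "i \<notin> planes w"
  shows "side i w > 0"
  using assms side_abs[of w i] cube_s_pos unfolding pyr_def planes_def
  by (smt (verit) mem_Collect_eq)

lemma side_flip_plane:
  assumes "w \<in> W" "i \<in> planes w"
  shows "side i (w \<circ> flip m) = - cube_s + 2 * cube_s * lorentz (nrm m) (nrm i)"
proof -
  have s: "side i w = - cube_s" using assms(2) by (simp add: planes_def)
  have "lorentz (w (nrm m)) (nrm i) = lorentz (w (nrm m)) (w (nrm i))"
    by (simp add: plane_nrm[OF assms(1) s])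
  then show ?thesis
    using W_lorentz[OF assms(1)] by (simp only: side_flip[OF assms(1)] s)
qed

text \<open>On plane \<open>i\<close> the element \<open>w\<close> fixes \<open>nrm i\<close>, so
  the sign of the product of \<open>nrm m\<close> and \<open>nrm i\<close> decides. Off the plane, a
  single step can at worst land on it, by \<open>side_crossing\<close>.\<close>

lemma pyr_flip:
  assumes w: "w \<in> pyr"
  shows "w \<circ> flip m \<in> pyr \<longleftrightarrow> m \<in> star (planes w)"
proof
  note wW = pyr_W[OF w]
  assume *: "w \<circ> flip m \<in> pyr"
  show "m \<in> star (planes w)"
    unfolding star_def
  proof (intro CollectI ballI)
    fix i assume i: "i \<in> planes w"
    have "side i (w \<circ> flip m) \<ge> - cube_s"
      using * i planes_axes unfolding pyr_def by blast
    then have "cube_s * lorentz (nrm m) (nrm i) \<ge> 0"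
      using side_flip_plane[OF wW i, of m] by simp
    then have "lorentz (nrm m) (nrm i) \<ge> 0"
      using cube_s_pos by (simp add: zero_le_mult_iff)
    then show "m = i \<or> adj i m"
      using nrm_disjoint[of m i] adj_sym[of i m] by fastforce
  qed
next
  note wW = pyr_W[OF w]
  assume m: "m \<in> star (planes w)"
  have "side i (w \<circ> flip m) \<ge> - cube_s" if i: "i \<in> axes" for i
  proof (cases "i \<in> planes w")
    case True
    then have "m = i \<or> adj m i" using m adj_sym[of i m] by (auto simp: star_def)
    then have "lorentz (nrm m) (nrm i) \<ge> 0" using nrm_adj by auto
    then show ?thesis
      using side_flip_plane[OF wW True, of m] cube_s_pos by simp
  next
    case False
    then have "side i w > 0" using side_not_plane[OF w i] by blast
    then show ?thesis
      using side_crossing(1)[OF wW, of i m] cube_s_pos by fastforce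
  qed
  then show "w \<circ> flip m \<in> pyr" using W_right[OF wW] by (auto simp: pyr_def)
qed

text \<open>A step can reach a new plane only by crossing the wall of that plane backwards, which is
  a descent. Ascents therefore only leave planes, and only the one whose wall is crossed.\<close>

lemma planes_flip:
  assumes w: "w \<in> pyr" and m: "m \<in> star (planes w)" "m \<notin> desc w"
  shows "planes (w \<circ> flip m) = planes w - {m}"
proof -
  note wW = pyr_W[OF w]
  have "i \<in> planes (w \<circ> flip m) \<longleftrightarrow> i \<in> planes w - {m}" if i: "i \<in> axes" for i
  proof (cases "i \<in> planes w")
    case True
    then have *: "i = m \<or> adj m i" using m(1) adj_sym[of i m] by (auto simp: star_def)
    then show ?thesis
    proof
      assume "i = m"
      then show ?thesis
        using side_flip_plane[OF wW True, of m] cube_s_pos by (simp add: planes_def)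
    next
      assume a: "adj m i"
      then have "i \<noteq> m" by auto
      then show ?thesis
        using side_flip_plane[OF wW True, of m] nrm_adj[OF a] i True by (simp add: planes_def)
    qed
  next
    case False
    then have "side i w > 0" using side_not_plane[OF w i] by blast
    then have "\<not> side i (w \<circ> flip m) < 0"
      using side_crossing(2)[OF wW, of i m] m(2) by blast
    then have "i \<notin> planes (w \<circ> flip m)" using cube_s_pos by (auto simp: planes_def)
    with False show ?thesis by blast
  qed
  then show ?thesis using planes_axes by blast
qed

lemma desc_planes:
  assumes "w \<in> pyr" "w \<in> len k" "m \<in> desc w" "i \<in> planes w"
  shows "adj i m"
proof -
  have "w (nrm i) = nrm i"
    using plane_nrm[OF pyr_W[OF assms(1)]] assms(4) by (simp add: planes_def)
  then have h: "height w i = - cube_s" by (simp add: height_def corner_nrm)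
  moreover have "height w m \<ge> cube_s"
    using len_height(1)[OF assms(2), of m] assms(3) by (auto simp: desc_def)
  ultimately show ?thesis
    using len_height(2)[OF assms(2), of i m] cube_s_pos by fastforce
qed

lemma desc_star: "w \<in> pyr \<Longrightarrow> w \<in> len k \<Longrightarrow> m \<in> desc w \<Longrightarrow> m \<in> star (planes w)"
  using desc_planes by (auto simp: star_def)

lemma planes_id: "planes id = axes"
  by (auto simp: planes_def side_def corner_nrm)

lemma pyr_id: "id \<in> pyr"
  by (simp add: pyr_def W_id side_def corner_nrm)

subsection \<open>The bounding honeycomb planes\<close>

definition corner_face :: "wall \<Rightarrow> mink set" where
  "corner_face j = block id (axes - {j})"

text \<open>An element of \<open>W\<close> is determined by its vertex, so a cell through
  \<open>w corner\<close> can be described from \<open>w\<close>; inclusion of cells then becomes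
  inclusion of cliques.\<close>

lemma cell_rebase:
  assumes "w \<in> W" "clique S" "v \<in> W" "clique T" "block w S \<subseteq> block v T"
  shows "block w T = block v T" and "S \<subseteq> T"
proof -
  have "w corner \<in> block v T" using assms(5) block_corner by blast
  then obtain u where u: "u \<in> W" "w corner = u corner" "block u T = block v T"
    using block_vertex[OF assms(3,4)] by blast
  then have "u = w" using W_free[OF assms(1) u(1,2)] by simp
  then show T: "block w T = block v T" using u(3) by simp
  show "S \<subseteq> T" using block_subset[OF assms(1)] assms(5) T by blast
qed

lemma sign_group_W: "b \<in> sign_group \<Longrightarrow> b \<in> W"
  unfolding sign_group_def W_def using generated_subset[of "flip ` axes" "range flip"]
  by (auto intro: generated_base)

lemma faces_of_base_cube:
  "faces_of base_cube = {block b (axes - {j}) |b j. b \<in> sign_group \<and> j \<in> axes}"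
proof (intro equalityI subsetI)
  fix T assume "T \<in> faces_of base_cube"
  then have T: "T \<in> cells 2" "T \<subseteq> base_cube" by (auto simp: faces_of_def squares_cells)
  then obtain w S where w: "T = block w S" "w \<in> W" "clique S" "card S = 2"
    unfolding cells_def by blast
  have "S \<subseteq> axes"
    using cell_rebase(2)[OF w(2,3) W_id clique_axes] T(2) w(1) base_cube_block by simp
  then obtain j where j: "j \<in> axes" "S = axes - {j}" using axes_subset_2[of S] w(4) by blast
  have "w corner \<in> base_cube" using T(2) w(1) block_corner by blast
  then obtain B where B: "B \<subseteq> axes" "w corner = vtx B" using base_cube_iff by blast
  obtain b where b: "b \<in> sign_group" "acts_by B b" using acts_by_exists[OF B(1)] .
  have "b (vtx {}) = vtx (sym_diff {} B)" using b(2) unfolding acts_by_def by blast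
  then have "b corner = w corner" using B(2) by simp
  then have "b = w" using W_free[OF sign_group_W[OF b(1)] w(2)] by blast
  then show "T \<in> {block b (axes - {j}) |b j. b \<in> sign_group \<and> j \<in> axes}"
    using b(1) j w(1) by blast
next
  fix T assume *: "T \<in> {block b (axes - {j}) |b j. b \<in> sign_group \<and> j \<in> axes}"
  then have "T \<in> base_squares" by (simp add: base_squares_eq)
  moreover have "T \<subseteq> base_cube" using calculation by (auto simp: base_squares_def)
  ultimately have "T \<subseteq> base_cube" "id ` T \<in> squares"
    unfolding squares_def using honeycomb_group.id by blast+
  then show "T \<in> faces_of base_cube" by (simp add: faces_of_def)
qed

lemma corner_faces_base: "corner_faces base_cube corner = corner_face ` axes"
proof (intro equalityI subsetI)
  fix T assume "T \<in> corner_faces base_cube corner"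
  then obtain b j where T: "T = block b (axes - {j})" "b \<in> sign_group" "j \<in> axes" "corner \<in> T"
    by (auto simp: corner_faces_def faces_of_base_cube)
  have "clique (axes - {j})" using clique_subset[OF clique_axes] by blast
  then obtain v where v: "v \<in> W" "corner = v corner" "block v (axes - {j}) = T"
    using block_vertex[OF sign_group_W[OF T(2)]] T(1,4) by blast
  then have "v = id" using W_trivial by metis
  then show "T \<in> corner_face ` axes" using v(3) T(3) by (auto simp: corner_face_def)
next
  fix T assume "T \<in> corner_face ` axes"
  then obtain j where j: "j \<in> axes" "T = corner_face j" by blast
  then have "corner \<in> T" using block_corner[of id] by (simp add: corner_face_def)
  then show "T \<in> corner_faces base_cube corner"
    using j sign_group_id by (auto simp: corner_faces_def faces_of_base_cube corner_face_def)
qed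

lemma corner_face_inj: "inj_on corner_face axes"
proof (rule inj_onI)
  fix i j assume ij: "i \<in> axes" "j \<in> axes" "corner_face i = corner_face j"
  then have "axes - {i} \<subseteq> axes - {j}"
    using block_subset[OF W_id, of "axes - {i}" "axes - {j}"] by (simp add: corner_face_def)
  then show "i = j" using ij by blast
qed

lemma sign_group_nrm:
  assumes "b \<in> sign_group" "i \<in> axes"
  shows "b (nrm i) = nrm i \<or> b (nrm i) = - nrm i"
  using assms(1) unfolding sign_group_def
proof induction
  case (step s g)
  then obtain a where a: "s = flip a" "a \<in> axes" by blast
  have "s (nrm i) = nrm i \<or> s (nrm i) = - nrm i"
  proof (cases "a = i")
    case True
    then show ?thesis by (simp add: a(1) flip_nrm_same)
  next
    case False
    then have "adj a i" using clique_axes a(2) assms(2) by (auto simp: clique_def)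
    then show ?thesis by (simp add: a(1) flip_nrm_adj)
  qed
  moreover have "s (- nrm i) = - s (nrm i)"
    using isometry_linear[OF flip_isometry] by (simp add: a(1) linear_neg)
  ultimately show ?case using step.IH by auto
qed simp

text \<open>For \<open>j = i\<close>, a common edge would by \<open>cell_rebase\<close> identify the
  two faces, and the edge would be a whole square.\<close>

lemma edge_through_face:
  assumes "b \<in> sign_group" "j \<in> axes" "i \<in> axes"
  shows "block b (axes - {j}) \<inter> corner_face i \<in> edges \<longleftrightarrow> j \<noteq> i"
proof
  assume *: "block b (axes - {j}) \<inter> corner_face i \<in> edges"
  show "j \<noteq> i"
  proof
    assume ji: "j = i"
    obtain w S where w: "block b (axes - {i}) \<inter> corner_face i = block w S" "w \<in> W" "clique S" "card S = 1"
      using * unfolding edges_cells cells_def ji by blast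
    have cl: "clique (axes - {i})" using clique_subset[OF clique_axes] by blast
    have "block w (axes - {i}) = block b (axes - {i})"
      by (rule cell_rebase[OF w(2,3) sign_group_W[OF assms(1)] cl]) (use w(1) in blast)
    moreover have "block w (axes - {i}) = corner_face i"
      unfolding corner_face_def
      by (rule cell_rebase[OF w(2,3) W_id cl]) (use w(1) in \<open>auto simp: corner_face_def\<close>)
    ultimately have "block w (axes - {i}) = block w S" using w(1) by blast
    then have "axes - {i} \<subseteq> S" using block_subset[OF w(2)] by blast
    then have "card (axes - {i}) \<le> 1" using w(4) card_mono[of S] by simp
    then show False using assms(3) card_axes by simp
  qed
next
  assume ji: "j \<noteq> i"
  obtain C where C: "acts_by C b" using sign_group_acts[OF assms(1)] .
  have 1: "block b (axes - {j}) = {x \<in> base_cube. snd x $ ix j = (if j \<in> C then - cube_s else cube_s)}"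
    using block_acts[OF C, of "{j}"] assms(2) by simp
  have 2: "corner_face i = {x \<in> base_cube. snd x $ ix i = cube_s}"
    using block_acts[OF acts_by_id, of "{i}"] assms(3) by (simp add: corner_face_def)
  have "block b (axes - {j}) \<inter> corner_face i = {x \<in> base_cube.
      snd x $ ix j = (if j \<in> C then - cube_s else cube_s) \<and> snd x $ ix i = cube_s}"
    unfolding 1 2 by blast
  moreover have "\<bar>if j \<in> C then - cube_s else cube_s\<bar> = cube_s" "\<bar>cube_s\<bar> = cube_s" "ix j \<noteq> ix i"
    using cube_s_pos ix_inj assms ji by auto
  ultimately have "block b (axes - {j}) \<inter> corner_face i \<in> base_edges"
    unfolding base_edges_def by blast
  then have "id ` (block b (axes - {j}) \<inter> corner_face i) \<in> edges"
    unfolding edges_def using honeycomb_group.id by blast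
  then show "block b (axes - {j}) \<inter> corner_face i \<in> edges" by simp
qed

text \<open>The normals of the reflecting faces are orthogonal to \<open>nrm i\<close>, because sign
  changes send \<open>nrm i\<close> to itself or its negative; so the reflections preserve the
  product with \<open>nrm i\<close>.\<close>

lemma plane_side:
  assumes i: "i \<in> axes" and T: "T \<in> honeycomb_plane base_cube (corner_face i)" and x: "x \<in> T"
  shows "lorentz x (nrm i) = - cube_s"
  using T x
proof (induction arbitrary: x)
  case base
  then obtain B where B: "B \<subseteq> axes - {i}" "x = vtx B" by (auto simp: corner_face_def block_def)
  have "clique (insert i B)"
    by (rule clique_subset[OF clique_axes]) (use B(1) i in blast)
  then show ?case using vtx_nrm[of i B] B by auto
next
  case (step S T r)
  obtain b j where b: "b \<in> sign_group" "j \<in> axes" "T = block b (axes - {j})"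
    using step.hyps(2) unfolding faces_of_base_cube by blast
  have ji: "j \<noteq> i" using step.hyps(3) edge_through_face[OF b(1,2) i] b(3) by simp
  have r: "r = reflection (b (face_nrm j))"
    using step.hyps(4) reflections_in_block[OF sign_group_G[OF b(1)] b(2)] b(3) by simp
  obtain y where y: "y \<in> S" "x = r y" using step.prems by blast
  have "lorentz (b (nrm i)) (b (face_nrm j)) = 0"
    using isometry_lorentz[OF G_isometry[OF sign_group_G[OF b(1)]]] face_nrm_axis[OF b(2) i] ji by simp
  then have "lorentz (nrm i) (b (face_nrm j)) = 0"
    using sign_group_nrm[OF b(1) i] by (auto simp: lorentz_bilinear)
  then have "lorentz x (nrm i) = lorentz y (nrm i)"
    using lorentz_commute[of "b (face_nrm j)" "nrm i"] by (simp add: y(2) r reflection_def lorentz_bilinear)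
  then show ?case using step.IH[OF y(1)] by simp
qed

text \<open>\<open>honeycomb_plane\<close> applies reflections in faces of the fixed cube on the
  left, while generators here act on the right. The two are matched by writing \<open>g\<close> as a
  product \<open>h\<close> of such reflections after a sign change \<open>b\<close> that preserves
  the face.\<close>

lemma plane_generators:
  assumes i: "i \<in> axes" and g: "g \<in> generated (turn ` (axes - {i}) \<union> flip ` (axes - {i}))"
  shows "block g (axes - {i}) \<in> honeycomb_plane base_cube (corner_face i)"
proof -
  let ?R = "{reflection (b (face_nrm j)) |b j. b \<in> sign_group \<and> j \<in> axes - {i}}"
  let ?B = "{b \<in> sign_group. block b (axes - {i}) = corner_face i}"
  have "\<exists>h\<in>generated ?R. \<exists>b\<in>?B. g = h \<circ> b"
    using g
  proof (induction rule: generated_induct_right)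
    case id
    have "id = id \<circ> (id :: mink \<Rightarrow> mink)" by simp
    moreover have "id \<in> ?B" using sign_group_id by (simp add: corner_face_def)
    ultimately show ?case using generated.id by blast
  next
    case (step g s)
    then obtain h b where h: "h \<in> generated ?R" "b \<in> ?B" "g = h \<circ> b" by blast
    from step.hyps(2) show ?case
    proof
      assume "s \<in> flip ` (axes - {i})"
      then obtain a where a: "s = flip a" "a \<in> axes - {i}" by blast
      have "b \<circ> s \<in> sign_group"
        using h(2) a unfolding sign_group_def by (intro generated_right) auto
      moreover have "block (b \<circ> s) (axes - {i}) = corner_face i"
        using h(2) block_flip[of "axes - {i}" a b] a clique_subset[OF clique_axes, of "axes - {i}"] by auto
      ultimately show ?thesis using h(1) unfolding h(3) comp_assoc by blast
    next
      assume "s \<in> turn ` (axes - {i})"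
      then obtain j where j: "s = turn j" "j \<in> axes - {i}" by blast
      have bs: "b \<in> sign_group" using h(2) by blast
      have "reflection (b (face_nrm j)) \<in> ?R" using bs j(2) by blast
      then have "h \<circ> reflection (b (face_nrm j)) \<in> generated ?R"
        by (rule generated_right[OF h(1)])
      moreover have "g \<circ> s = (h \<circ> reflection (b (face_nrm j))) \<circ> b"
        unfolding h(3) j(1) comp_assoc reflection_face[OF sign_group_G[OF bs]] ..
      ultimately show ?thesis using h(2) by blast
    qed
  qed
  then obtain h b where h: "h \<in> generated ?R" "b \<in> ?B" "g = h \<circ> b" by blast
  have "h ` corner_face i \<in> honeycomb_plane base_cube (corner_face i)"
    using h(1)
  proof induction
    case id
    then show ?case using honeycomb_plane.base by simp
  next
    case (step s g)
    then obtain b j where b: "s = reflection (b (face_nrm j))" "b \<in> sign_group" "j \<in> axes" "j \<noteq> i" by blast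
    let ?T = "block b (axes - {j})"
    have "?T \<in> faces_of base_cube" using b unfolding faces_of_base_cube by blast
    moreover have "?T \<inter> corner_face i \<in> edges" using edge_through_face[OF b(2,3) i] b(4) by blast
    moreover have "s \<in> reflections_in ?T"
      using reflections_in_block[OF sign_group_G[OF b(2)] b(3)] b(1) by simp
    ultimately have "s ` (g ` corner_face i) \<in> honeycomb_plane base_cube (corner_face i)"
      using honeycomb_plane.step[OF step.IH] by blast
    then show ?case by (simp only: image_comp)
  qed
  moreover have "block g (axes - {i}) = h ` corner_face i"
    using h(2) unfolding h(3) by (simp add: block_image[symmetric])
  ultimately show ?thesis by simp
qed

text \<open>Turns about the two other axes conjugate their flips to the flips of all five neighbours
  of \<open>i\<close>, and carry their square to all five squares of the plane at a vertex.\<close>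

lemma plane_complete:
  assumes i: "i \<in> axes" and w: "w \<in> plane_group i" and ab: "adj i a" "adj i b" "adj a b"
  shows "block w {a, b} \<in> honeycomb_plane base_cube (corner_face i)"
proof -
  let ?S = "turn ` (axes - {i}) \<union> flip ` (axes - {i})"
  have "flip m \<in> generated ?S" if m: "adj i m" for m
  proof -
    obtain c where c: "adj i c" "adj m c" using pentagon_edge[OF i m] .
    obtain js where js: "set js \<subseteq> axes - {i}" "{m, c} = foldr face_perm js ` (axes - {i})"
      using pentagon_transitive[OF i m c] .
    obtain x where x: "x \<in> axes - {i}" "m = foldr face_perm js x" using js(2) by blast
    have "set js \<subseteq> axes" using js(1) by blast
    moreover have "turn ` set js \<subseteq> generated ?S" using js(1) by (auto intro: generated_base)
    moreover have "flip x \<in> generated ?S" using x(1) by (auto intro: generated_base)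
    ultimately show ?thesis unfolding x(2) by (rule flip_foldr)
  qed
  then have "flip ` {m. adj i m} \<subseteq> generated ?S" by blast
  then have wS: "w \<in> generated ?S"
    using w generated_subset unfolding plane_group_def by blast
  obtain js where js: "set js \<subseteq> axes - {i}" "{a, b} = foldr face_perm js ` (axes - {i})"
    using pentagon_transitive[OF i ab] .
  obtain k where k: "k \<in> generated ?S" "wall_symmetry k (foldr face_perm js)"
    by (rule foldr_turn[of js ?S]) (use js(1) in auto)
  have "block w {a, b} = block (w \<circ> k) (axes - {i})"
    unfolding js(2) wall_symmetry_block[OF k(2)] ..
  then show ?thesis
    using plane_generators[OF i generated_comp[OF wS k(1)]] by simp
qed

subsection \<open>The pyramid of a base cube\<close>

lemma block_faces_of:
  assumes "w \<in> W" "clique S" "card S = 2" "S \<subseteq> T"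
  shows "block w S \<in> faces_of (block w T)"
proof -
  have "block w S \<in> squares"
    using assms unfolding squares_cells cells_def by blast
  moreover have "block w S \<subseteq> block w T" using assms(4) by (auto simp: block_def)
  ultimately show ?thesis by (simp add: faces_of_def)
qed

lemma side_block:
  assumes "i \<in> axes" "block w S \<in> honeycomb_plane base_cube (corner_face i)"
  shows "side i w = - cube_s" and "a \<in> S \<Longrightarrow> side i (w \<circ> flip a) = - cube_s"
  using plane_side[OF assms] block_corner block_neighbour unfolding side_def by blast+

lemma square_not_plane:
  assumes w: "w \<in> pyr" and S: "S \<subseteq> star (planes w)"
    and n: "\<forall>i\<in>planes w. \<not> S \<subseteq> {m. adj i m}"
  shows "\<forall>F\<in>corner_faces base_cube corner. block w S \<notin> honeycomb_plane base_cube F"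
proof
  fix F assume "F \<in> corner_faces base_cube corner"
  then obtain i where i: "i \<in> axes" "F = corner_face i" using corner_faces_base by blast
  show "block w S \<notin> honeycomb_plane base_cube F"
  proof
    assume "block w S \<in> honeycomb_plane base_cube F"
    then have h: "block w S \<in> honeycomb_plane base_cube (corner_face i)" using i(2) by simp
    have ip: "i \<in> planes w" using side_block(1)[OF i(1) h] i(1) by (simp add: planes_def)
    then obtain a where a: "a \<in> S" "\<not> adj i a" using n by blast
    then have "a = i" using S ip by (auto simp: star_def)
    then have "side i (w \<circ> flip a) = cube_s"
      using side_flip_plane[OF pyr_W[OF w] ip, of a] by simp
    then show False
      using side_block(2)[OF i(1) h a(1)] cube_s_pos by simp
  qed
qed

text \<open>Descending can reach a new plane \<open>i\<close> only across its own wall, that is with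
  \<open>d = i\<close>; the directions in \<open>S\<close> are then allowed since they form a clique
  with \<open>d\<close>.\<close>

lemma star_planes_flip_desc:
  assumes w: "w \<in> pyr" "w \<in> len k" and d: "d \<in> desc w" and S: "clique S" "d \<in> S" "S \<subseteq> star (planes w)"
  shows "S \<subseteq> star (planes (w \<circ> flip d))"
proof
  note wW = pyr_W[OF w(1)]
  fix a assume a: "a \<in> S"
  show "a \<in> star (planes (w \<circ> flip d))"
    unfolding star_def
  proof (intro CollectI ballI)
    fix i assume i: "i \<in> planes (w \<circ> flip d)"
    show "a = i \<or> adj i a"
    proof (cases "i \<in> planes w")
      case True
      then show ?thesis using S(3) a by (auto simp: star_def)
    next
      case False
      have iax: "i \<in> axes" and si: "side i (w \<circ> flip d) = - cube_s"
        using i by (simp_all add: planes_def)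
      have "side i w > 0" using side_not_plane[OF w(1) iax False] .
      then have "w (nrm d) = - nrm i"
        using side_crossing(3)[OF wW, of i d] si cube_s_pos by simp
      moreover have "(w \<circ> flip d) (nrm d) = - w (nrm d)"
        using W_linear[OF wW] by (simp add: flip_nrm_same linear_neg)
      ultimately have "(w \<circ> flip d) (nrm d) = nrm i" by simp
      also have "\<dots> = (w \<circ> flip d) (nrm i)"
        using plane_nrm[OF W_right[OF wW] si] by simp
      finally have "d = i" using W_inj[OF W_right[OF wW]] nrm_inject by blast
      then show ?thesis using S(1,2) a by (auto simp: clique_def)
    qed
  qed
qed

text \<open>Induction on the length. A cube at \<open>w\<close> whose triangle contains a descent is
  also a cube at a vertex nearer to \<open>corner\<close>, where the induction hypothesis applies;
  the other cubes at \<open>w\<close> are joined to such a cube by walking around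
  \<open>w\<close>.\<close>

lemma pyramid_complete:
  assumes "w \<in> len k" "w \<in> pyr" "clique S" "card S = 3" "S \<subseteq> star (planes w)"
  shows "block w S \<in> pyramid_cubes base_cube corner"
  using assms
proof (induction k arbitrary: w S)
  case 0
  then have w: "w = id" by simp
  have "S \<subseteq> axes"
  proof
    fix m assume m: "m \<in> S"
    have "m \<in> star axes" using 0(5) m unfolding w planes_id by blast
    then obtain i where "i \<in> axes" "\<not> adj i m" using no_common_neighbour by blast
    then show "m \<in> axes" using \<open>m \<in> star axes\<close> by (auto simp: star_def)
  qed
  then have "S = axes" using 0(4) card_axes by (intro card_seteq) auto
  then have "block w S = base_cube" unfolding w base_cube_block by simp
  then show ?case using pyramid_cubes.base by simp
next
  case (Suc k)
  note wW = pyr_W[OF Suc.prems(2)]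
  obtain d where d: "d \<in> desc w" using desc_nonempty[OF Suc.prems(1)] by blast
  have ds: "d \<in> star (planes w)" using desc_star[OF Suc.prems(2,1) d] .
  have I: "planes w \<subset> axes"
    using planes_axes desc_planes[OF Suc.prems(2,1) d] no_common_neighbour by blast
  \<comment> \<open>The walk is an inner induction on the total distance of the triangle from
    \<open>d\<close>, which \<open>star_connected\<close> lowers.\<close>
  have "clique S \<Longrightarrow> card S = 3 \<Longrightarrow> S \<subseteq> star (planes w) \<Longrightarrow>
      block w S \<in> pyramid_cubes base_cube corner" for S
  proof (induction "\<Sum>x\<in>S. dist_wall d x" arbitrary: S rule: less_induct)
    case less
    show ?case
    proof (cases "d \<in> S")
      case True
      have "w \<circ> flip d \<in> pyr" using pyr_flip[OF Suc.prems(2)] ds by blast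
      moreover have "w \<circ> flip d \<in> len k" by (rule len_down[OF Suc.prems(1) d])
      ultimately have "block (w \<circ> flip d) S \<in> pyramid_cubes base_cube corner"
        using Suc.IH less.prems star_planes_flip_desc[OF Suc.prems(2,1) d less.prems(1) True less.prems(3)]
        by blast
      then show ?thesis using block_flip[OF less.prems(1) True] by simp
    next
      case False
      obtain a b c c' where abc: "S = {a, b, c}" "a \<noteq> b" "c \<noteq> a" "c \<noteq> b" "adj a b" "adj a c'" "adj b c'"
        "c' \<in> star (planes w)" "dist_wall d c' < dist_wall d c" "\<forall>i\<in>planes w. \<not> (adj i a \<and> adj i b)"
        by (rule star_connected[OF I less.prems ds False])
      let ?S = "{a, b, c'}"
      have c': "c' \<noteq> a" "c' \<noteq> b" using abc(6,7) by auto
      have "(\<Sum>x\<in>?S. dist_wall d x) < (\<Sum>x\<in>S. dist_wall d x)"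
        using abc(2-4,9) c' unfolding abc(1) by (simp del: dist_wall.simps)
      moreover have cl: "clique ?S"
        using abc(5-7) adj_sym by (auto simp: clique_def)
      moreover have cd: "card ?S = 3" using abc(2) c' by simp
      moreover have "?S \<subseteq> star (planes w)" using less.prems(3) abc(1,8) by blast
      ultimately have 1: "block w ?S \<in> pyramid_cubes base_cube corner" by (rule less.hyps)
      have "block w S \<in> cubes"
        using wW less.prems(1,2) unfolding cubes_cells cells_def by blast
      moreover have ab: "clique {a, b}" "card {a, b} = 2"
        using cl clique_subset[of ?S "{a, b}"] abc(2) by auto
      have "block w {a, b} \<in> faces_of (block w ?S)" "block w {a, b} \<in> faces_of (block w S)"
        by (rule block_faces_of[OF wW ab]; use abc(1) in blast)+
      moreover have "\<forall>F\<in>corner_faces base_cube corner. block w {a, b} \<notin> honeycomb_plane base_cube F"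
        by (rule square_not_plane[OF Suc.prems(2)]) (use abc(1,10) less.prems(3) in auto)
      ultimately show ?thesis using pyramid_cubes.step[OF 1] by blast
    qed
  qed
  then show ?case using Suc.prems by blast
qed

lemma vtx_translation:
  assumes "clique S" "B \<subseteq> S"
  obtains y where "y \<in> W" "\<forall>E\<subseteq>S. y (vtx E) = vtx (sym_diff E B)"
proof -
  have "finite B" by simp
  then have "B \<subseteq> S \<Longrightarrow> \<exists>y\<in>W. \<forall>E\<subseteq>S. y (vtx E) = vtx (sym_diff E B)"
  proof (induction B rule: finite_induct)
    case empty
    show ?case by (rule bexI[OF _ W_id]) simp
  next
    case (insert a B)
    then obtain y where y: "y \<in> W" "\<forall>E\<subseteq>S. y (vtx E) = vtx (sym_diff E B)" by blast
    have "(flip a \<circ> y) (vtx E) = vtx (sym_diff E (insert a B))" if E: "E \<subseteq> S" for E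
    proof -
      have "clique (insert a (sym_diff E B))"
        by (rule clique_subset[OF assms(1)]) (use E insert.prems in blast)
      moreover have "(if a \<in> sym_diff E B then sym_diff E B - {a} else insert a (sym_diff E B))
          = sym_diff E (insert a B)"
        using insert.hyps(2) by auto
      moreover have "(flip a \<circ> y) (vtx E) = flip a (vtx (sym_diff E B))" using y(2) E by simp
      ultimately show ?thesis by (simp only: flip_vtx)
    qed
    then show ?case using W_comp[OF W_flip y(1)] by blast
  qed
  then show ?thesis using assms(2) that by blast
qed

text \<open>The inequalities of \<open>pyr\<close> at all vertices of a cube are an invariant of the
  chains: a step that violated one would have to pass through a square of that bounding
  plane.\<close>

lemma pyramid_sound:
  assumes "Q \<in> pyramid_cubes base_cube corner"
  shows "Q \<in> cells 3 \<and> (\<forall>v\<in>W. v corner \<in> Q \<longrightarrow> v \<in> pyr)"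
  using assms
proof induction
  case base
  have "base_cube \<in> cells 3"
    using W_id clique_axes card_axes unfolding base_cube_block cells_def by blast
  moreover have "v \<in> pyr" if v: "v \<in> W" "v corner \<in> base_cube" for v
  proof -
    obtain B where B: "B \<subseteq> axes" "v corner = vtx B" using v(2) base_cube_iff by blast
    have "side i v \<ge> - cube_s" if "i \<in> axes" for i
    proof -
      have "clique (insert i B)" by (rule clique_subset[OF clique_axes]) (use B(1) that in blast)
      then show ?thesis using vtx_nrm[of i B] cube_s_pos by (simp add: side_def B(2))
    qed
    then show ?thesis using v(1) by (simp add: pyr_def)
  qed
  ultimately show ?case by blast
next
  case (step Q R T)
  have R: "R \<in> cells 3" using step.hyps(2) cubes_cells by simp
  obtain q A where Q: "Q = block q A" "q \<in> W" "clique A" "card A = 3"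
    using step.IH unfolding cells_def by blast
  obtain r D where D: "R = block r D" "r \<in> W" "clique D" "card D = 3"
    using R unfolding cells_def by blast
  obtain t S where T: "T = block t S" "t \<in> W" "clique S" "card S = 2"
    using step.hyps(3) unfolding faces_of_def squares_cells cells_def by blast
  have TQ: "T \<subseteq> Q" and TR: "T \<subseteq> R" using step.hyps(3,4) by (auto simp: faces_of_def)
  have SA: "S \<subseteq> A" "block t A = Q"
    using cell_rebase[OF T(2,3) Q(2,3)] TQ T(1) Q(1) by auto
  have SD: "S \<subseteq> D" "block t D = R"
    using cell_rebase[OF T(2,3) D(2,3)] TR T(1) D(1) by auto
  have "card (D - S) = 1" using D(4) T(4) SD(1) by (simp add: card_Diff_subset)
  then obtain c where c: "D - S = {c}" by (auto simp: card_1_singleton_iff)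
  \<comment> \<open>Besides \<open>T\<close>, the cube \<open>R\<close> has the neighbours of
    vertices of \<open>T\<close> in direction \<open>c\<close>. If \<open>c\<close> were forbidden
    at \<open>u\<close> by the plane \<open>i\<close>, both directions of \<open>T\<close> would be
    adjacent to \<open>i\<close>, and \<open>plane_complete\<close> would put \<open>T\<close> on
    that plane.\<close>
  have top: "u \<circ> flip c \<in> pyr" if u: "u \<in> W" "block u S = T" for u
  proof -
    have uT: "u corner \<in> T" using u(2) block_corner by blast
    have up: "u \<in> pyr" using step.IH u(1) uT TQ by blast
    have uA: "block u A = Q"
      using cell_rebase(1)[OF u(1) T(3) Q(2,3)] TQ u(2) Q(1) by auto
    have Ss: "S \<subseteq> star (planes u)"
    proof
      fix a assume "a \<in> S"
      then have "(u \<circ> flip a) corner \<in> Q" using block_neighbour[of a A u] SA(1) uA by blast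
      then have "u \<circ> flip a \<in> pyr" using step.IH W_right[OF u(1)] by blast
      then show "a \<in> star (planes u)" using pyr_flip[OF up] by blast
    qed
    have "c \<in> star (planes u)"
      unfolding star_def
    proof (intro CollectI ballI)
      fix i assume i: "i \<in> planes u"
      show "c = i \<or> adj i c"
      proof (rule ccontr)
        assume n: "\<not> (c = i \<or> adj i c)"
        have adj: "adj i a" if a: "a \<in> S" for a
        proof -
          have "a = i \<or> adj i a" using Ss a i by (auto simp: star_def)
          moreover have "a \<noteq> i"
            using n c a SD(1) D(3) unfolding clique_def by blast
          ultimately show ?thesis by blast
        qed
        obtain a b where ab: "S = {a, b}" "a \<noteq> b" using T(4) by (auto simp: card_2_iff)
        have "adj a b" using T(3) ab by (auto simp: clique_def)
        moreover have iax: "i \<in> axes" and "side i u = - cube_s"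
          using i by (simp_all add: planes_def)
        moreover have "u \<in> plane_group i" using calculation side_plane_group[OF u(1)] by blast
        ultimately have "block u {a, b} \<in> honeycomb_plane base_cube (corner_face i)"
          using adj ab(1) by (intro plane_complete) auto
        then have "T \<in> honeycomb_plane base_cube (corner_face i)" using ab(1) u(2) by simp
        then show False using step.hyps(5) corner_faces_base iax by blast
      qed
    qed
    then show ?thesis using pyr_flip[OF up] by blast
  qed
  have "v \<in> pyr" if v: "v \<in> W" "v corner \<in> R" for v
  proof -
    obtain B where B: "B \<subseteq> D" "v corner = t (vtx B)" using v(2) SD(2) by (auto simp: block_def)
    have "t (vtx (B - {c})) \<in> T" using B(1) c T(1) by (auto simp: block_def)
    then obtain u where u: "u \<in> W" "t (vtx (B - {c})) = u corner" "block u S = T"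
      using block_vertex[OF T(2,3)] T(1) by metis
    show ?thesis
    proof (cases "c \<in> B")
      case False
      then have "v = u" using W_free[OF v(1) u(1)] u(2) B(2) by simp
      then have "v corner \<in> T" using u(3) block_corner by blast
      then show ?thesis using step.IH v(1) TQ by blast
    next
      case True
      \<comment> \<open>Translation by \<open>B\<close> modulo 2 sends \<open>corner\<close> to the
        vertex \<open>B\<close> and its neighbour in direction \<open>c\<close> to the vertex
        \<open>B - {c}\<close>, so \<open>t o y\<close> is \<open>v\<close>, and crossing
        \<open>c\<close> from \<open>v\<close> ends in \<open>T\<close>.\<close>
      obtain y where y: "y \<in> W" "\<forall>E\<subseteq>D. y (vtx E) = vtx (sym_diff E B)"
        using vtx_translation[OF D(3) B(1)] .
      have "(t \<circ> y) corner = v corner"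
        using spec[OF y(2), of "{}"] B(2) by simp
      then have v': "v = t \<circ> y" using W_free[OF W_comp[OF T(2) y(1)] v(1)] by simp
      have "sym_diff {c} B = B - {c}" using True by blast
      then have "y (flip c corner) = vtx (B - {c})"
        using spec[OF y(2), of "{c}"] c by (auto simp: vtx_single)
      then have "(v \<circ> flip c) corner = u corner" unfolding v' u(2)[symmetric] by simp
      then have "v \<circ> flip c = u" by (rule W_free[OF W_right[OF v(1)] u(1)])
      then have "v = u \<circ> flip c" by (metis comp_flip_flip)
      then show ?thesis using top[OF u(1,3)] by simp
    qed
  qed
  then show ?case using R by blast
qed

lemma pyramid_vertices_base: "pyramid_vertices base_cube corner = (\<lambda>w. w corner) ` pyr"
proof (intro equalityI subsetI)
  fix x assume "x \<in> pyramid_vertices base_cube corner"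
  then obtain Q where Q: "Q \<in> pyramid_cubes base_cube corner" "x \<in> Q"
    by (auto simp: pyramid_vertices_def)
  then obtain w S where w: "Q = block w S" "w \<in> W" "clique S"
    using pyramid_sound[OF Q(1)] unfolding cells_def by blast
  obtain v where v: "v \<in> W" "x = v corner" using block_vertex[OF w(2,3)] Q(2) w(1) by blast
  then have "v \<in> pyr" using pyramid_sound[OF Q(1)] Q(2) by blast
  then show "x \<in> (\<lambda>w. w corner) ` pyr" using v(2) by blast
next
  fix x assume "x \<in> (\<lambda>w. w corner) ` pyr"
  then obtain w where w: "w \<in> pyr" "x = w corner" by blast
  obtain k where k: "w \<in> len k" using W_len[OF pyr_W[OF w(1)]] by blast
  have "star (planes w) \<noteq> {}"
  proof (cases k)
    case 0
    then have "w = id" using k by simp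
    then have "axes \<subseteq> star (planes w)"
      using clique_axes unfolding \<open>w = id\<close> planes_id by (auto simp: star_def clique_def)
    then show ?thesis by (auto simp: axes_def)
  next
    case (Suc j)
    then show ?thesis using desc_nonempty desc_star[OF w(1) k] k by blast
  qed
  then obtain S where S: "clique S" "card S = 3" "S \<subseteq> star (planes w)"
    using star_triangle[OF planes_axes] by blast
  have "block w S \<in> pyramid_cubes base_cube corner" by (rule pyramid_complete[OF k w(1) S])
  then show "x \<in> pyramid_vertices base_cube corner"
    using block_corner w(2) unfolding pyramid_vertices_def by blast
qed

lemma block_edge: "block w {m} = {w corner, (w \<circ> flip m) corner}"
  by (auto simp: block_def Pow_insert vtx_single)

lemma pyramid_edges_base: "pyramid_edges base_cube corner =
  {{w corner, (w \<circ> flip m) corner} |w m. w \<in> pyr \<and> w \<circ> flip m \<in> pyr}"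
proof (intro equalityI subsetI)
  fix e assume "e \<in> pyramid_edges base_cube corner"
  then obtain Q where Q: "e \<in> cells 1" "Q \<in> pyramid_cubes base_cube corner" "e \<subseteq> Q"
    by (auto simp: pyramid_edges_def edges_cells)
  then obtain w S where w: "e = block w S" "w \<in> W" "card S = 1" unfolding cells_def by blast
  then obtain m where "S = {m}" by (auto simp: card_1_singleton_iff)
  then have e: "e = {w corner, (w \<circ> flip m) corner}" using w(1) block_edge by simp
  have "w \<in> pyr" "w \<circ> flip m \<in> pyr"
    using pyramid_sound[OF Q(2)] w(2) W_right[OF w(2)] Q(3) unfolding e by blast+
  then show "e \<in> {{w corner, (w \<circ> flip m) corner} |w m. w \<in> pyr \<and> w \<circ> flip m \<in> pyr}"
    using e by blast
next
  fix e assume "e \<in> {{w corner, (w \<circ> flip m) corner} |w m. w \<in> pyr \<and> w \<circ> flip m \<in> pyr}"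
  then obtain w m where w: "e = {w corner, (w \<circ> flip m) corner}" "w \<in> pyr" "w \<circ> flip m \<in> pyr" by blast
  have "m \<in> star (planes w)" using pyr_flip[OF w(2)] w(3) by blast
  then obtain S where S: "clique S" "card S = 3" "S \<subseteq> star (planes w)" "m \<in> S"
    using star_triangle[OF planes_axes] by blast
  obtain k where k: "w \<in> len k" using W_len[OF pyr_W[OF w(2)]] by blast
  have "block w S \<in> pyramid_cubes base_cube corner" by (rule pyramid_complete[OF k w(2) S(1-3)])
  moreover have "e \<subseteq> block w S"
    using block_corner block_neighbour[OF S(4)] unfolding w(1) by blast
  moreover have "clique {m}" "card {m} = 1" by (simp_all add: clique_def)
  then have "block w {m} \<in> edges"
    using pyr_W[OF w(2)] unfolding edges_cells cells_def by blast
  then have "e \<in> edges" using w(1) block_edge by simp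
  ultimately show "e \<in> pyramid_edges base_cube corner" by (auto simp: pyramid_edges_def)
qed

lemma planes_at_base:
  assumes w: "w \<in> W"
  shows "planes_at base_cube corner (w corner) = corner_face ` planes w"
proof -
  have "w corner \<in> \<Union> (honeycomb_plane base_cube (corner_face i)) \<longleftrightarrow> side i w = - cube_s"
    if i: "i \<in> axes" for i
  proof
    assume "w corner \<in> \<Union> (honeycomb_plane base_cube (corner_face i))"
    then show "side i w = - cube_s" unfolding side_def using plane_side[OF i] by blast
  next
    assume "side i w = - cube_s"
    then have wp: "w \<in> plane_group i" using side_plane_group[OF w] by blast
    have "card (axes - {i}) = 2" using axes_subset_2[of "axes - {i}"] i by blast
    then obtain a b where "axes - {i} = {a, b}" "a \<noteq> b" unfolding card_2_iff by blast
    then have "adj i a" "adj i b" "adj a b"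
      using clique_axes i unfolding clique_def by blast+
    then have "block w {a, b} \<in> honeycomb_plane base_cube (corner_face i)"
      by (rule plane_complete[OF i wp])
    then show "w corner \<in> \<Union> (honeycomb_plane base_cube (corner_face i))"
      using block_corner by blast
  qed
  then show ?thesis
    unfolding planes_at_def corner_faces_base planes_def by blast
qed

lemma card_planes_at_base:
  "w \<in> W \<Longrightarrow> card (planes_at base_cube corner (w corner)) = card (planes w)"
  unfolding planes_at_base using corner_face_inj planes_axes
  by (meson card_image inj_on_subset)

subsection \<open>Transport to an arbitrary cube and vertex\<close>

lemma G_inj: "g \<in> G \<Longrightarrow> inj g"
  by (metis G_inverse inj_on_id inj_on_imageI2)

lemma cells_image:
  assumes "g \<in> G" "d > 0" "x \<in> cells d"
  shows "g ` x \<in> cells d"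
proof -
  obtain h B where x: "x = block h B" "h \<in> G" "B \<subseteq> axes" "card B = d"
    using assms(3) unfolding G_cells[OF assms(2), symmetric] by blast
  then have "g ` x = block (g \<circ> h) B" by (simp add: block_image)
  then show ?thesis
    using G_comp[OF assms(1) x(2)] x(3,4) unfolding G_cells[OF assms(2), symmetric] by blast
qed

lemma image_inverse: "h \<circ> g = id \<Longrightarrow> h ` (g ` A) = A"
  by (simp add: image_comp)

lemma faces_of_image:
  assumes "g \<in> G" "T \<in> faces_of Q"
  shows "g ` T \<in> faces_of (g ` Q)"
  using assms(2) cells_image[OF assms(1), of 2 T] by (auto simp: faces_of_def squares_cells)

lemma corner_faces_image:
  assumes g: "g \<in> G"
  shows "corner_faces (g ` Q) (g V) = (`) g ` corner_faces Q V"
proof (intro equalityI subsetI)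
  obtain h where h: "h \<in> G" "h \<circ> g = id" "g \<circ> h = id" using G_inverse[OF g] .
  fix F assume "F \<in> corner_faces (g ` Q) (g V)"
  then have F: "F \<in> faces_of (g ` Q)" "g V \<in> F" by (auto simp: corner_faces_def)
  have "h ` F \<in> faces_of Q"
    using faces_of_image[OF h(1) F(1)] by (simp only: image_inverse[OF h(2)])
  moreover have "V \<in> h ` F"
    using F(2) h(2) by (metis comp_apply id_apply image_eqI)
  ultimately have "h ` F \<in> corner_faces Q V" by (simp add: corner_faces_def)
  then have "g ` (h ` F) \<in> (`) g ` corner_faces Q V" by blast
  then show "F \<in> (`) g ` corner_faces Q V" by (simp only: image_inverse[OF h(3)])
next
  fix F assume "F \<in> (`) g ` corner_faces Q V"
  then show "F \<in> corner_faces (g ` Q) (g V)"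
    using faces_of_image[OF g] by (auto simp: corner_faces_def)
qed

lemma honeycomb_plane_image:
  assumes g: "g \<in> G" and S: "S \<in> honeycomb_plane Q F"
  shows "g ` S \<in> honeycomb_plane (g ` Q) (g ` F)"
  using S
proof induction
  case base
  show ?case by (rule honeycomb_plane.base)
next
  case (step S T r)
  obtain n where n: "r = reflection n" "lorentz n n > 0" "\<forall>x\<in>T. lorentz x n = 0"
    using step.hyps(4) unfolding reflections_in_def by blast
  note iso = G_isometry[OF g]
  have "lorentz (g n) (g n) > 0" "\<forall>x\<in>g ` T. lorentz x (g n) = 0"
    using n(2,3) by (simp_all add: isometry_lorentz[OF iso])
  then have "reflection (g n) \<in> reflections_in (g ` T)"
    unfolding reflections_in_def by blast
  moreover have "g ` T \<in> faces_of (g ` Q)" by (rule faces_of_image[OF g step.hyps(2)])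
  moreover have "g ` T \<inter> g ` F \<in> edges"
    using cells_image[OF g, of 1 "T \<inter> F"] step.hyps(3)
    unfolding image_Int[OF G_inj[OF g]] edges_cells by simp
  ultimately have "reflection (g n) ` (g ` S) \<in> honeycomb_plane (g ` Q) (g ` F)"
    using honeycomb_plane.step[OF step.IH] by blast
  moreover have "reflection (g n) ` (g ` S) = g ` (r ` S)"
    unfolding image_image n(1) isometry_reflection[OF iso] ..
  ultimately show ?case by simp
qed

text \<open>The rule for pyramid cubes demands that squares are not on the planes, so its transport
  needs the converse direction too.\<close>

lemma honeycomb_plane_image_iff:
  assumes g: "g \<in> G"
  shows "g ` S \<in> honeycomb_plane (g ` Q) (g ` F) \<longleftrightarrow> S \<in> honeycomb_plane Q F"
proof
  obtain h where h: "h \<in> G" "h \<circ> g = id" "g \<circ> h = id" using G_inverse[OF g] .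
  assume "g ` S \<in> honeycomb_plane (g ` Q) (g ` F)"
  from honeycomb_plane_image[OF h(1) this] show "S \<in> honeycomb_plane Q F"
    unfolding image_inverse[OF h(2)] .
qed (rule honeycomb_plane_image[OF g])

lemma pyramid_cubes_image:
  assumes g: "g \<in> G" and R: "R \<in> pyramid_cubes Q V"
  shows "g ` R \<in> pyramid_cubes (g ` Q) (g V)"
  using R
proof induction
  case base
  show ?case by (rule pyramid_cubes.base)
next
  case (step P R T)
  have "g ` R \<in> cubes" using cells_image[OF g, of 3] step.hyps(2) by (simp add: cubes_cells)
  moreover have "\<forall>F\<in>corner_faces (g ` Q) (g V). g ` T \<notin> honeycomb_plane (g ` Q) F"
    unfolding corner_faces_image[OF g] using step.hyps(5) honeycomb_plane_image_iff[OF g] by blast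
  ultimately show ?case
    using pyramid_cubes.step[OF step.IH] faces_of_image[OF g] step.hyps(3,4) by blast
qed

lemma pyramid_cubes_image_eq:
  assumes g: "g \<in> G"
  shows "pyramid_cubes (g ` Q) (g V) = (`) g ` pyramid_cubes Q V"
proof (intro equalityI subsetI)
  obtain h where h: "h \<in> G" "h \<circ> g = id" "g \<circ> h = id" using G_inverse[OF g] .
  fix R assume "R \<in> pyramid_cubes (g ` Q) (g V)"
  from pyramid_cubes_image[OF h(1) this] have "h ` R \<in> pyramid_cubes Q V"
    unfolding image_inverse[OF h(2)] pointfree_idE[OF h(2)] .
  then have "g ` (h ` R) \<in> (`) g ` pyramid_cubes Q V" by blast
  then show "R \<in> (`) g ` pyramid_cubes Q V" unfolding image_inverse[OF h(3)] .
next
  fix R assume "R \<in> (`) g ` pyramid_cubes Q V"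
  then show "R \<in> pyramid_cubes (g ` Q) (g V)" using pyramid_cubes_image[OF g] by blast
qed

lemma pyramid_vertices_image:
  "g \<in> G \<Longrightarrow> pyramid_vertices (g ` Q) (g V) = g ` pyramid_vertices Q V"
  by (auto simp: pyramid_vertices_def pyramid_cubes_image_eq)

lemma pyramid_edges_image:
  assumes g: "g \<in> G"
  shows "pyramid_edges (g ` Q) (g V) = (`) g ` pyramid_edges Q V"
proof (intro equalityI subsetI)
  obtain h where h: "h \<in> G" "h \<circ> g = id" "g \<circ> h = id" using G_inverse[OF g] .
  fix e assume "e \<in> pyramid_edges (g ` Q) (g V)"
  then obtain R where R: "e \<in> edges" "R \<in> pyramid_cubes Q V" "e \<subseteq> g ` R"
    by (auto simp: pyramid_edges_def pyramid_cubes_image_eq[OF g])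
  have "h ` e \<in> edges" using cells_image[OF h(1), of 1] R(1) by (simp add: edges_cells)
  moreover have "h ` e \<subseteq> R" using image_mono[OF R(3), of h] unfolding image_inverse[OF h(2)] .
  ultimately have "h ` e \<in> pyramid_edges Q V" using R(2) by (auto simp: pyramid_edges_def)
  then have "g ` (h ` e) \<in> (`) g ` pyramid_edges Q V" by blast
  then show "e \<in> (`) g ` pyramid_edges Q V" unfolding image_inverse[OF h(3)] .
next
  fix e assume "e \<in> (`) g ` pyramid_edges Q V"
  then obtain e' R where e: "e = g ` e'" "e' \<in> edges" "R \<in> pyramid_cubes Q V" "e' \<subseteq> R"
    by (auto simp: pyramid_edges_def)
  have "e \<in> edges" using cells_image[OF g, of 1] e(1,2) by (simp add: edges_cells)
  moreover have "e \<subseteq> g ` R" using e(1,4) by blast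
  ultimately show "e \<in> pyramid_edges (g ` Q) (g V)"
    using pyramid_cubes_image[OF g e(3)] by (auto simp: pyramid_edges_def)
qed

lemma planes_at_image:
  assumes g: "g \<in> G"
  shows "planes_at (g ` Q) (g V) (g X) = (`) g ` planes_at Q V X"
proof -
  have "g X \<in> \<Union> (honeycomb_plane (g ` Q) (g ` F)) \<longleftrightarrow> X \<in> \<Union> (honeycomb_plane Q F)" for F
  proof
    obtain h where h: "h \<in> G" "h \<circ> g = id" "g \<circ> h = id" using G_inverse[OF g] .
    assume "g X \<in> \<Union> (honeycomb_plane (g ` Q) (g ` F))"
    then obtain S where S: "S \<in> honeycomb_plane (g ` Q) (g ` F)" "g X \<in> S" by blast
    from honeycomb_plane_image[OF h(1) S(1)] have "h ` S \<in> honeycomb_plane Q F"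
      unfolding image_inverse[OF h(2)] .
    moreover have "X \<in> h ` S" using S(2) h(2) by (metis comp_apply id_apply image_eqI)
    ultimately show "X \<in> \<Union> (honeycomb_plane Q F)" by blast
  next
    assume "X \<in> \<Union> (honeycomb_plane Q F)"
    then show "g X \<in> \<Union> (honeycomb_plane (g ` Q) (g ` F))" using honeycomb_plane_image[OF g] by blast
  qed
  then show ?thesis
    unfolding planes_at_def corner_faces_image[OF g] by blast
qed

text \<open>Sign changes carry \<open>corner\<close> to every vertex of the base cube, so a single
  corner represents all choices.\<close>

lemma cube_vertex_base:
  assumes "Q \<in> cubes" "V \<in> Q"
  obtains g where "g \<in> G" "Q = g ` base_cube" "V = g corner"
proof -
  obtain h where h: "h \<in> honeycomb_group" "Q = h ` base_cube" using assms(1) unfolding cubes_def by blast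
  obtain y where y: "y \<in> base_cube" "V = h y" using assms(2) h(2) by blast
  obtain B where "B \<subseteq> axes" "y = vtx B" using y(1) base_cube_iff[of y] by blast
  then have B: "B \<subseteq> axes" "V = h (vtx B)" using y(2) by simp_all
  obtain b where b: "b \<in> sign_group" "acts_by B b" using acts_by_exists[OF B(1)] .
  have "b (vtx {}) = vtx (sym_diff {} B)" using b(2) unfolding acts_by_def by blast
  then have "V = (h \<circ> b) corner" using B(2) by simp
  moreover have "Q = (h \<circ> b) ` base_cube"
    unfolding h(2) image_comp[symmetric]
    by (simp add: base_cube_block block_image sign_group_block[OF b(1)])
  ultimately show ?thesis
    using that G_comp[OF honeycomb_group_G[OF h(1)] sign_group_G[OF b(1)]] by blast
qed

subsection \<open>Levels and labels of a graded pyramid\<close>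

text \<open>A function that vanishes only at the apex, changes by one along each edge and can always
  be lowered is the distance from the apex. Path counting uses nothing else about the
  geometry.\<close>

locale graded_pyramid =
  fixes Q V :: _ and lev :: "mink \<Rightarrow> nat"
  assumes edge: "{x, y} \<in> pyramid_edges Q V \<Longrightarrow>
      x \<in> pyramid_vertices Q V \<and> y \<in> pyramid_vertices Q V \<and> (lev y = Suc (lev x) \<or> lev x = Suc (lev y))"
    and lev_base: "lev V = 0"
    and lev_0: "x \<in> pyramid_vertices Q V \<Longrightarrow> lev x = 0 \<Longrightarrow> x = V"
    and descend: "x \<in> pyramid_vertices Q V \<Longrightarrow> lev x = Suc n \<Longrightarrow> \<exists>y. {y, x} \<in> pyramid_edges Q V \<and> lev y = n"
    and finite_nbrs: "finite {y. {y, x} \<in> pyramid_edges Q V}"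
begin

lemma path_length:
  assumes "p \<in> paths_to Q V x"
  shows "lev x + 1 \<le> length p"
proof -
  have "p \<noteq> [] \<Longrightarrow> hd p = V \<Longrightarrow> successively (\<lambda>x y. {x, y} \<in> pyramid_edges Q V) p \<Longrightarrow>
      lev (last p) + 1 \<le> length p"
  proof (induction p rule: rev_induct)
    case (snoc x p)
    show ?case
    proof (cases "p = []")
      case True
      then show ?thesis using snoc.prems lev_base by simp
    next
      case False
      then have "lev (last p) + 1 \<le> length p" "{last p, x} \<in> pyramid_edges Q V"
        using snoc by (auto simp: successively_append_iff)
      then show ?thesis using edge[of "last p" x] by auto
    qed
  qed simp
  then show ?thesis using assms by (auto simp: paths_to_def)
qed

lemma path_exists: "x \<in> pyramid_vertices Q V \<Longrightarrow> \<exists>p\<in>paths_to Q V x. length p = lev x + 1"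
proof (induction "lev x" arbitrary: x)
  case 0
  then have "x = V" using lev_0 by simp
  then have "[x] \<in> paths_to Q V x" by (simp add: paths_to_def)
  then show ?case using 0(1) by (intro bexI[of _ "[x]"]) simp_all
next
  case (Suc n)
  then obtain y where y: "{y, x} \<in> pyramid_edges Q V" "lev y = n" using descend[OF Suc.prems] by metis
  then obtain p where p: "p \<in> paths_to Q V y" "length p = n + 1"
    using Suc.hyps(1)[of y] edge[OF y(1)] by auto
  have "p @ [x] \<in> paths_to Q V x"
    using p(1) y(1) by (auto simp: paths_to_def successively_append_iff)
  then show ?case using p(2) Suc.hyps(2) by (intro bexI[of _ "p @ [x]"]) simp_all
qed

lemma shortest_paths_eq:
  assumes "x \<in> pyramid_vertices Q V"
  shows "shortest_paths_to Q V x = {p \<in> paths_to Q V x. length p = lev x + 1}"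
proof -
  obtain q where q: "q \<in> paths_to Q V x" "length q = lev x + 1" using path_exists[OF assms] by blast
  show ?thesis
  proof (intro equalityI subsetI)
    fix p assume "p \<in> shortest_paths_to Q V x"
    then have p: "p \<in> paths_to Q V x" "length p \<le> length q"
      using q(1) by (auto simp: shortest_paths_to_def)
    then show "p \<in> {p \<in> paths_to Q V x. length p = lev x + 1}"
      using path_length[OF p(1)] q(2) by simp
  next
    fix p assume "p \<in> {p \<in> paths_to Q V x. length p = lev x + 1}"
    then show "p \<in> shortest_paths_to Q V x"
      using path_length by (auto simp: shortest_paths_to_def)
  qed
qed

lemma level_eq: "level Q V n = {x \<in> pyramid_vertices Q V. lev x = n}"
proof -
  have "(\<exists>p\<in>shortest_paths_to Q V x. length p = n + 1) \<longleftrightarrow> lev x = n"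
    if x: "x \<in> pyramid_vertices Q V" for x
    using path_exists[OF x] unfolding shortest_paths_eq[OF x] by auto
  then show ?thesis unfolding level_def by blast
qed

lemma ascendants_eq:
  "ascendants Q V (Suc n) x = {y. {y, x} \<in> pyramid_edges Q V \<and> lev y = n}"
  unfolding ascendants_def level_eq diff_Suc_1 using edge by blast

lemma shortest_paths_base: "V \<in> pyramid_vertices Q V \<Longrightarrow> shortest_paths_to Q V V = {[V]}"
  by (auto simp: shortest_paths_eq lev_base paths_to_def length_Suc_conv)

text \<open>Cutting off the last vertex sorts the shortest paths by ascendants, which gives Pascal's
  rule for labels.\<close>

lemma shortest_paths_Suc:
  assumes x: "x \<in> pyramid_vertices Q V" "lev x = Suc n"
  shows "shortest_paths_to Q V x =
    (\<Union>y\<in>ascendants Q V (Suc n) x. (\<lambda>p. p @ [x]) ` shortest_paths_to Q V y)"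
proof (intro equalityI subsetI)
  fix q assume "q \<in> shortest_paths_to Q V x"
  then have q: "q \<in> paths_to Q V x" "length q = n + 2" by (auto simp: shortest_paths_eq[OF x(1)] x(2))
  then obtain p where p: "q = p @ [x]" "length p = n + 1"
    by (cases q rule: rev_cases) (auto simp: paths_to_def)
  have pne: "p \<noteq> []" using p(2) by auto
  let ?y = "last p"
  have e: "{?y, x} \<in> pyramid_edges Q V" and pp: "p \<in> paths_to Q V ?y"
    using q(1) pne unfolding p(1) by (auto simp: paths_to_def successively_append_iff)
  have ly: "lev ?y = n" using path_length[OF pp] p(2) edge[OF e] x(2) by auto
  then have "p \<in> shortest_paths_to Q V ?y"
    using edge[OF e] pp p(2) by (simp add: shortest_paths_eq)
  moreover have "?y \<in> ascendants Q V (Suc n) x" using e ly by (simp add: ascendants_eq)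
  ultimately show "q \<in> (\<Union>y\<in>ascendants Q V (Suc n) x. (\<lambda>p. p @ [x]) ` shortest_paths_to Q V y)"
    unfolding p(1) by blast
next
  fix q assume "q \<in> (\<Union>y\<in>ascendants Q V (Suc n) x. (\<lambda>p. p @ [x]) ` shortest_paths_to Q V y)"
  then obtain y p where y: "y \<in> ascendants Q V (Suc n) x" "p \<in> shortest_paths_to Q V y" "q = p @ [x]" by blast
  then have e: "{y, x} \<in> pyramid_edges Q V" "lev y = n" by (simp_all add: ascendants_eq)
  then have p: "p \<in> paths_to Q V y" "length p = n + 1"
    using y(2) edge[OF e(1)] by (auto simp: shortest_paths_eq)
  then have "q \<in> paths_to Q V x"
    using e(1) unfolding y(3) by (auto simp: paths_to_def successively_append_iff)
  then show "q \<in> shortest_paths_to Q V x" using p(2) x by (simp add: shortest_paths_eq y(3))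
qed

lemma finite_ascendants: "finite (ascendants Q V (Suc n) x)"
  unfolding ascendants_eq by (rule finite_subset[OF _ finite_nbrs[of x]]) blast

lemma finite_shortest_paths: "x \<in> pyramid_vertices Q V \<Longrightarrow> finite (shortest_paths_to Q V x)"
proof (induction "lev x" arbitrary: x)
  case 0
  then have "x = V" using lev_0 by simp
  then show ?case using 0 shortest_paths_base by simp
next
  case (Suc n)
  have "finite (shortest_paths_to Q V y)" if "y \<in> ascendants Q V (Suc n) x" for y
    using that Suc.hyps(1)[of y] edge[of y x] by (simp add: ascendants_eq)
  then show ?case
    using shortest_paths_Suc[OF Suc.prems Suc.hyps(2)[symmetric]] finite_ascendants by simp
qed

lemma label_Suc:
  assumes x: "x \<in> pyramid_vertices Q V" "lev x = Suc n"
  shows "label Q V x = (\<Sum>y\<in>ascendants Q V (Suc n) x. label Q V y)"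
proof -
  have fin: "finite (shortest_paths_to Q V y)" if "y \<in> ascendants Q V (Suc n) x" for y
    using that edge[of y x] finite_shortest_paths[of y] by (simp add: ascendants_eq)
  have last: "last p = y" if "p \<in> shortest_paths_to Q V y" for p y
    using that by (auto simp: shortest_paths_to_def paths_to_def)
  have "label Q V x = (\<Sum>y\<in>ascendants Q V (Suc n) x. card ((\<lambda>p. p @ [x]) ` shortest_paths_to Q V y))"
    unfolding label_def shortest_paths_Suc[OF x]
  proof (rule card_UN_disjoint)
    show "finite (ascendants Q V (Suc n) x)" by (rule finite_ascendants)
    show "\<forall>y\<in>ascendants Q V (Suc n) x. finite ((\<lambda>p. p @ [x]) ` shortest_paths_to Q V y)"
      using fin by blast
    show "\<forall>y\<in>ascendants Q V (Suc n) x. \<forall>z\<in>ascendants Q V (Suc n) x. y \<noteq> z \<longrightarrow>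
        (\<lambda>p. p @ [x]) ` shortest_paths_to Q V y \<inter> (\<lambda>p. p @ [x]) ` shortest_paths_to Q V z = {}"
    proof (intro ballI impI)
      fix y z :: mink assume "y \<noteq> z"
      then have "shortest_paths_to Q V y \<inter> shortest_paths_to Q V z = {}" using last by blast
      then show "(\<lambda>p. p @ [x]) ` shortest_paths_to Q V y \<inter> (\<lambda>p. p @ [x]) ` shortest_paths_to Q V z = {}"
        by blast
    qed
  qed
  also have "\<dots> = (\<Sum>y\<in>ascendants Q V (Suc n) x. label Q V y)"
    unfolding label_def by (intro sum.cong card_image) (auto simp: inj_on_def)
  finally show ?thesis .
qed

lemma label_base: "V \<in> pyramid_vertices Q V \<Longrightarrow> label Q V V = 1"
  by (simp add: label_def shortest_paths_base)

end

subsection \<open>Counting children by type\<close>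

text \<open>\<open>I\<close> and \<open>D\<close> are the planes and descents of a parent and
  \<open>m\<close> is the wall crossed; by \<open>planes_flip\<close> and \<open>desc_flip\<close>
  the two sets in the condition are the planes and descents of the child.\<close>

definition child_count :: "wall set \<Rightarrow> wall set \<Rightarrow> nat \<Rightarrow> nat \<Rightarrow> nat" where
  "child_count I D k e =
    card {m \<in> star I - D. card (I - {m}) = k \<and> card (insert m {n \<in> D. adj n m}) = e}"

text \<open>Pairs of the number of planes and the number of ascendants: the types E, D, C, B, A and 1.\<close>

definition type_list :: "(nat \<times> nat) list" where
  "type_list = [(0, 1), (0, 2), (0, 3), (1, 1), (1, 2), (2, 1)]"

text \<open>Row \<open>(k, e)\<close>: the numbers of children of the six types in \<^const>\<open>type_list\<close> of a vertex on \<open>k\<close>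
  planes with \<open>e\<close> ascendants.\<close>

definition child_row :: "nat \<times> nat \<Rightarrow> nat list" where
  "child_row t = (if t = (0, 1) then [6, 5, 0, 0, 0, 0]
    else if t = (0, 2) then [4, 4, 2, 0, 0, 0]
    else if t = (0, 3) then [3, 3, 3, 0, 0, 0]
    else if t = (1, 1) then [0, 1, 0, 2, 2, 0]
    else if t = (1, 2) then [0, 0, 1, 1, 2, 0]
    else [0, 0, 0, 0, 2, 1])"

definition child_types :: "wall list \<Rightarrow> wall list \<Rightarrow> (nat \<times> nat) list" where
  "child_types xs ds = map (\<lambda>m. (length (filter (\<lambda>i. i \<noteq> m) xs), Suc (length (filter (\<lambda>n. adj n m) ds))))
    (filter (\<lambda>m. list_all (\<lambda>i. m = i \<or> adj i m) xs \<and> m \<notin> set ds) walls)"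

definition tally :: "(nat \<times> nat) list \<Rightarrow> nat list" where
  "tally ts = map (\<lambda>t. length (filter (\<lambda>s. s = t) ts)) type_list"

lemma child_count_types:
  assumes "distinct xs" "distinct ds"
  shows "child_count (set xs) (set ds) k e = length (filter (\<lambda>s. s = (k, e)) (child_types xs ds))"
proof -
  let ?P = "\<lambda>m. list_all (\<lambda>i. m = i \<or> adj i m) xs \<and> m \<notin> set ds"
  let ?f = "\<lambda>m. (length (filter (\<lambda>i. i \<noteq> m) xs), Suc (length (filter (\<lambda>n. adj n m) ds)))"
  have 1: "card (set xs - {m}) = length (filter (\<lambda>i. i \<noteq> m) xs)" for m
  proof -
    have "set xs - {m} = set (filter (\<lambda>i. i \<noteq> m) xs)" by auto
    then show ?thesis using assms(1) by (simp only: distinct_card distinct_filter)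
  qed
  have 2: "card (insert m {n \<in> set ds. adj n m}) = Suc (length (filter (\<lambda>n. adj n m) ds))" for m
  proof -
    have "{n \<in> set ds. adj n m} = set (filter (\<lambda>n. adj n m) ds)" by auto
    moreover have "m \<notin> {n \<in> set ds. adj n m}" by simp
    ultimately show ?thesis using assms(2)
      by (metis card_insert_disjoint distinct_card distinct_filter List.finite_set)
  qed
  have "{m \<in> star (set xs) - set ds. card (set xs - {m}) = k \<and> card (insert m {n \<in> set ds. adj n m}) = e}
      = set (filter (\<lambda>m. ?P m \<and> ?f m = (k, e)) walls)"
    unfolding 1 2 by (auto simp: star_def set_walls list_all_iff)
  then have "child_count (set xs) (set ds) k e = length (filter (\<lambda>m. ?P m \<and> ?f m = (k, e)) walls)"
    unfolding child_count_def by (simp only: distinct_card distinct_filter distinct_walls)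
  also have "\<dots> = length (filter (\<lambda>s. s = (k, e)) (child_types xs ds))"
    unfolding child_types_def filter_map length_map filter_filter by (simp add: comp_def conj_commute)
  finally show ?thesis .
qed

text \<open>Evaluated for all admissible pairs. That the answer depends on the two cardinalities
  alone closes the recurrences. One plane admits at most two descents, as they form a clique in a
  pentagon; two planes admit only one, as the two common neighbours of two axes are not
  adjacent.\<close>

lemma child_count_table:
  assumes I: "I \<subset> axes" and D: "clique D" "D \<noteq> {}" and ID: "\<forall>i\<in>I. \<forall>m\<in>D. adj i m"
  shows "(card I, card D) \<in> set type_list"
    and "map (\<lambda>(k, e). child_count I D k e) type_list = child_row (card I, card D)"
proof -
  obtain xs where xs: "xs \<in> set axis_lists" "distinct xs" "I = set xs" using axis_list[OF I] .
  obtain ds where ds: "ds \<in> set cliques" "distinct ds" "D = set ds" using clique_list[OF D] .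
  have "list_all (\<lambda>xs. list_all (\<lambda>ds. list_all (\<lambda>i. list_all (adj i) ds) xs \<longrightarrow>
      (length xs, length ds) \<in> set type_list \<and>
      tally (child_types xs ds) = child_row (length xs, length ds)) cliques) axis_lists"
    by code_simp
  moreover have "list_all (\<lambda>i. list_all (adj i) ds) xs"
    using ID unfolding xs(3) ds(3) list_all_iff by blast
  ultimately have *: "(length xs, length ds) \<in> set type_list"
      "tally (child_types xs ds) = child_row (length xs, length ds)"
    using xs(1) ds(1) unfolding list_all_iff by blast+
  have c: "card I = length xs" "card D = length ds"
    using xs ds by (simp_all add: distinct_card)
  show "(card I, card D) \<in> set type_list" using *(1) c by simp
  have "map (\<lambda>(k, e). child_count I D k e) type_list = tally (child_types xs ds)"
    unfolding tally_def xs(3) ds(3)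
    by (rule map_cong) (auto simp: child_count_types[OF xs(2) ds(2)])
  then show "map (\<lambda>(k, e). child_count I D k e) type_list = child_row (card I, card D)"
    using *(2) c by simp
qed

lemma child_count_root:
  "child_count axes {} k e = (if (k, e) = (2, 1) then 3 else 0)"
proof -
  have "axes = set [X0, X1, X2]" by (simp add: axes_def)
  then have "child_count axes {} k e = length (filter (\<lambda>s. s = (k, e)) (child_types [X0, X1, X2] []))"
    using child_count_types[of "[X0, X1, X2]" "[]" k e] by simp
  moreover have "child_types [X0, X1, X2] [] = [(2, 1), (2, 1), (2, 1)]"
    by code_simp
  ultimately show ?thesis by auto
qed

lemma finite_len: "finite (len n)"
proof (induction n)
  case (Suc n)
  have "len (Suc n) \<subseteq> (\<lambda>(w, m). w \<circ> flip m) ` (len n \<times> UNIV)" unfolding len.simps by auto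
  then show ?case by (rule finite_subset) (simp add: Suc.IH)
qed simp

lemma flip_cancel: "w \<in> W \<Longrightarrow> w \<circ> flip a = w \<circ> flip b \<longleftrightarrow> a = b"
proof
  assume w: "w \<in> W" and eq: "w \<circ> flip a = w \<circ> flip b"
  have "w (flip a corner) = w (flip b corner)" using fun_cong[OF eq, of corner] by simp
  then have "flip a corner = flip b corner" using W_inj[OF w] by blast
  then have "nrm a = nrm b" using cube_s_pos by (simp add: flip_corner)
  then show "a = b" by (simp add: nrm_inject)
qed simp

definition typed :: "nat \<Rightarrow> nat \<Rightarrow> nat \<Rightarrow> (mink \<Rightarrow> mink) set" where
  "typed n k e = {w \<in> pyr \<inter> len n. card (planes w) = k \<and> card (desc w) = e}"

lemma finite_typed: "finite (typed n k e)"
  unfolding typed_def by (rule finite_subset[OF _ finite_len[of n]]) blast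

text \<open>A double count: a descent of the child and an ascent of the parent are the same wall.
  Crossing it twice returns to the start, so the map has the same form as its inverse.\<close>

lemma typed_children:
  "bij_betw (\<lambda>(v, m). (v \<circ> flip m, m))
    {(v, m). v \<in> pyr \<inter> len n \<and> m \<in> star (planes v) - desc v \<and>
      card (planes v - {m}) = k \<and> card (insert m {a \<in> desc v. adj a m}) = e}
    (SIGMA w:typed (Suc n) k e. desc w)"
  (is "bij_betw ?f ?A ?B")
proof (rule bij_betwI[where g = ?f])
  show "?f \<in> ?A \<rightarrow> ?B"
  proof
    fix x assume "x \<in> ?A"
    then obtain v m where x: "x = (v, m)" and v: "v \<in> pyr" "v \<in> len n" and m: "m \<in> star (planes v)" "m \<notin> desc v"
      and c: "card (planes v - {m}) = k" "card (insert m {a \<in> desc v. adj a m}) = e" by blast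
    have d: "desc (v \<circ> flip m) = insert m {a \<in> desc v. adj a m}" by (rule desc_flip[OF v(2) m(2)])
    have "v \<circ> flip m \<in> typed (Suc n) k e"
      unfolding typed_def d planes_flip[OF v(1) m]
      using c len_up[OF v(2) m(2)] pyr_flip[OF v(1)] m(1) d planes_flip[OF v(1) m] by simp
    moreover have "m \<in> desc (v \<circ> flip m)" unfolding d by blast
    ultimately show "?f x \<in> ?B" unfolding x by simp
  qed
  show "?f \<in> ?B \<rightarrow> ?A"
  proof
    fix x assume "x \<in> ?B"
    then obtain w m where x: "x = (w, m)" and w: "w \<in> typed (Suc n) k e" and m: "m \<in> desc w" by blast
    have wp: "w \<in> pyr" "w \<in> len (Suc n)" "card (planes w) = k" "card (desc w) = e"
      using w by (auto simp: typed_def)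
    let ?v = "w \<circ> flip m"
    have v: "?v \<in> len n" by (rule len_down[OF wp(2) m])
    have vp: "?v \<in> pyr" using pyr_flip[OF wp(1)] desc_star[OF wp(1,2) m] by blast
    have "?v \<circ> flip m \<in> pyr" using wp(1) by simp
    then have ms: "m \<in> star (planes ?v)" using pyr_flip[OF vp] by blast
    have md: "m \<notin> desc ?v"
      using m height_flip_same[OF len_W[OF wp(2)], of m] by (simp add: desc_def)
    have "planes w = planes ?v - {m}" using planes_flip[OF vp ms md] by simp
    moreover have "desc w = insert m {a \<in> desc ?v. adj a m}" using desc_flip[OF v md] by simp
    ultimately have "(?v, m) \<in> ?A" using v vp ms md wp(3,4) by auto
    then show "?f x \<in> ?A" unfolding x by simp
  qed
qed auto

locale placed_pyramid =
  fixes g :: "mink \<Rightarrow> mink"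
  assumes g: "g \<in> G"
begin

abbreviation "Q \<equiv> g ` base_cube"
abbreviation "V \<equiv> g corner"

definition pos :: "(mink \<Rightarrow> mink) \<Rightarrow> mink" where
  "pos w = g (w corner)"

text \<open>The value is determined on vertices by \<open>pos_inj\<close> and
  \<open>len_unique\<close>; at other points nothing is claimed about it.\<close>

definition lev :: "mink \<Rightarrow> nat" where
  "lev x = (THE k. \<exists>w\<in>len k. x = pos w)"

lemma pos_inj: "w \<in> W \<Longrightarrow> v \<in> W \<Longrightarrow> pos w = pos v \<longleftrightarrow> w = v"
  unfolding pos_def using W_free[of w v] injD[OF G_inj[OF g]] by blast

lemma lev_pos:
  assumes "w \<in> len k"
  shows "lev (pos w) = k"
  unfolding lev_def
proof (rule the_equality)
  show "\<exists>v\<in>len k. pos w = pos v" using assms by blast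
  fix j assume "\<exists>v\<in>len j. pos w = pos v"
  then obtain v where v: "v \<in> len j" "pos w = pos v" by blast
  then have "w = v" using pos_inj[OF len_W[OF assms] len_W[OF v(1)]] by blast
  then show "j = k" using len_unique assms v(1) by blast
qed

lemma vertices: "pyramid_vertices Q V = pos ` pyr"
  unfolding pyramid_vertices_image[OF g] pyramid_vertices_base pos_def image_image ..

lemma edges: "e \<in> pyramid_edges Q V \<longleftrightarrow> (\<exists>w m. w \<in> pyr \<and> w \<circ> flip m \<in> pyr \<and> e = {pos w, pos (w \<circ> flip m)})"
proof
  assume "e \<in> pyramid_edges Q V"
  then obtain w m where w: "w \<in> pyr" "w \<circ> flip m \<in> pyr" "e = g ` {w corner, (w \<circ> flip m) corner}"
    unfolding pyramid_edges_image[OF g] pyramid_edges_base by blast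
  then have "e = {pos w, pos (w \<circ> flip m)}" by (simp add: pos_def)
  then show "\<exists>w m. w \<in> pyr \<and> w \<circ> flip m \<in> pyr \<and> e = {pos w, pos (w \<circ> flip m)}" using w by blast
next
  assume "\<exists>w m. w \<in> pyr \<and> w \<circ> flip m \<in> pyr \<and> e = {pos w, pos (w \<circ> flip m)}"
  then obtain w m where w: "w \<in> pyr" "w \<circ> flip m \<in> pyr" "e = {pos w, pos (w \<circ> flip m)}" by blast
  then have "e = g ` {w corner, (w \<circ> flip m) corner}" by (simp add: pos_def)
  then show "e \<in> pyramid_edges Q V"
    unfolding pyramid_edges_image[OF g] pyramid_edges_base using w(1,2) by blast
qed

lemma edge_pos:
  assumes "w \<in> pyr" "w \<circ> flip m \<in> pyr"
  shows "{pos (w \<circ> flip m), pos w} \<in> pyramid_edges Q V"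
proof -
  have "{pos w, pos (w \<circ> flip m)} \<in> pyramid_edges Q V" using assms edges by blast
  then show ?thesis by (simp only: insert_commute)
qed

lemma edge_at:
  assumes "{y, pos w} \<in> pyramid_edges Q V" "w \<in> W"
  obtains m where "w \<in> pyr" "w \<circ> flip m \<in> pyr" "y = pos (w \<circ> flip m)"
proof -
  obtain v m where v: "v \<in> pyr" "v \<circ> flip m \<in> pyr" "{y, pos w} = {pos v, pos (v \<circ> flip m)}"
    using assms(1) edges by blast
  then consider "pos w = pos v" "y = pos (v \<circ> flip m)" | "pos w = pos (v \<circ> flip m)" "y = pos v"
    by (auto simp: doubleton_eq_iff)
  then show ?thesis
  proof cases
    case 1
    then have "w = v" using pos_inj[OF assms(2) pyr_W[OF v(1)]] by blast
    then show ?thesis using that[of m] v 1 by blast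
  next
    case 2
    then have w: "w = v \<circ> flip m" using pos_inj[OF assms(2) pyr_W[OF v(2)]] by blast
    then have "w \<circ> flip m = v" by simp
    then show ?thesis using that[of m] v 2 w by simp
  qed
qed

lemma len_flip:
  assumes "w \<in> len k" "w \<circ> flip m \<in> len j"
  shows "(j = Suc k \<and> m \<notin> desc w) \<or> (k = Suc j \<and> m \<in> desc w)"
proof (cases "m \<in> desc w")
  case True
  then obtain i where i: "k = Suc i" using assms(1) len_0_desc by (cases k) blast+
  then have "w \<circ> flip m \<in> len i" using len_down assms(1) True by blast
  then show ?thesis using len_unique assms(2) True i by blast
next
  case False
  then show ?thesis using len_unique len_up assms by blast
qed

sublocale graded_pyramid Q V lev
proof
  fix x y assume "{x, y} \<in> pyramid_edges Q V"
  then obtain w m where w: "w \<in> pyr" "w \<circ> flip m \<in> pyr" "{x, y} = {pos w, pos (w \<circ> flip m)}"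
    using edges by blast
  obtain k where k: "w \<in> len k" using W_len[OF pyr_W[OF w(1)]] by blast
  obtain j where j: "w \<circ> flip m \<in> len j" using W_len[OF pyr_W[OF w(2)]] by blast
  have "lev (pos w) = k" "lev (pos (w \<circ> flip m)) = j" by (rule lev_pos[OF k] lev_pos[OF j])+
  moreover have "j = Suc k \<or> k = Suc j" using len_flip[OF k j] by blast
  moreover have "x = pos w \<and> y = pos (w \<circ> flip m) \<or> y = pos w \<and> x = pos (w \<circ> flip m)"
    using w(3) by (auto simp: doubleton_eq_iff)
  ultimately show "x \<in> pyramid_vertices Q V \<and> y \<in> pyramid_vertices Q V \<and>
      (lev y = Suc (lev x) \<or> lev x = Suc (lev y))"
    unfolding vertices using w(1,2) by auto
next
  have "id \<in> len 0" by simp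
  from lev_pos[OF this] show "lev V = 0" by (simp add: pos_def)
next
  fix x assume x: "x \<in> pyramid_vertices Q V" "lev x = 0"
  then obtain w where w: "w \<in> pyr" "x = pos w" unfolding vertices by blast
  obtain k where k: "w \<in> len k" using W_len[OF pyr_W[OF w(1)]] by blast
  then have "k = 0" using lev_pos[OF k] w(2) x(2) by simp
  then have "w = id" using k by simp
  then show "x = V" using w(2) by (simp add: pos_def)
next
  fix x n assume x: "x \<in> pyramid_vertices Q V" "lev x = Suc n"
  then obtain w where w: "w \<in> pyr" "x = pos w" unfolding vertices by blast
  obtain k where "w \<in> len k" using W_len[OF pyr_W[OF w(1)]] by blast
  then have k: "w \<in> len (Suc n)" using lev_pos w(2) x(2) by metis
  obtain d where d: "d \<in> desc w" using desc_nonempty[OF k] by blast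
  have "w \<circ> flip d \<in> pyr" using pyr_flip[OF w(1)] desc_star[OF w(1) k d] by blast
  then have "{pos (w \<circ> flip d), x} \<in> pyramid_edges Q V"
    unfolding w(2) by (rule edge_pos[OF w(1)])
  then show "\<exists>y. {y, x} \<in> pyramid_edges Q V \<and> lev y = n"
    using lev_pos[OF len_down[OF k d]] by blast
next
  fix x
  show "finite {y. {y, x} \<in> pyramid_edges Q V}"
  proof (cases "x \<in> pos ` pyr")
    case True
    then obtain w where w: "w \<in> pyr" "x = pos w" by blast
    have "{y. {y, x} \<in> pyramid_edges Q V} \<subseteq> range (\<lambda>m. pos (w \<circ> flip m))"
      using edge_at[OF _ pyr_W[OF w(1)]] w(2) by blast
    then show ?thesis by (rule finite_subset) simp
  next
    case False
    have "{y, x} \<notin> pyramid_edges Q V" for y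
    proof
      assume "{y, x} \<in> pyramid_edges Q V"
      then obtain w m where "w \<in> pyr" "w \<circ> flip m \<in> pyr" "{y, x} = {pos w, pos (w \<circ> flip m)}"
        using edges by blast
      then have "x \<in> pos ` pyr" by (metis image_eqI insertE insert_iff singletonD)
      with False show False ..
    qed
    then show ?thesis by simp
  qed
qed

lemma level_pos: "level Q V n = pos ` (pyr \<inter> len n)"
proof -
  have "lev (pos w) = n \<longleftrightarrow> w \<in> len n" if "w \<in> pyr" for w
    using lev_pos W_len[OF pyr_W[OF that]] by blast
  then show ?thesis unfolding level_eq vertices by blast
qed

lemma ascendants_pos:
  assumes w: "w \<in> pyr" "w \<in> len (Suc n)"
  shows "ascendants Q V (Suc n) (pos w) = (\<lambda>m. pos (w \<circ> flip m)) ` desc w"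
proof (intro equalityI subsetI)
  fix y assume "y \<in> ascendants Q V (Suc n) (pos w)"
  then have y: "{y, pos w} \<in> pyramid_edges Q V" "lev y = n" by (simp_all add: ascendants_eq)
  obtain m where m: "w \<circ> flip m \<in> pyr" "y = pos (w \<circ> flip m)" using edge_at[OF y(1) pyr_W[OF w(1)]] .
  obtain j where j: "w \<circ> flip m \<in> len j" using W_len[OF pyr_W[OF m(1)]] by blast
  have "j = n" using lev_pos[OF j] y(2) m(2) by simp
  then have "m \<in> desc w" using len_flip[OF w(2) j] by simp
  then show "y \<in> (\<lambda>m. pos (w \<circ> flip m)) ` desc w" using m(2) by blast
next
  fix y assume "y \<in> (\<lambda>m. pos (w \<circ> flip m)) ` desc w"
  then obtain m where m: "m \<in> desc w" "y = pos (w \<circ> flip m)" by blast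
  have "w \<circ> flip m \<in> pyr" using pyr_flip[OF w(1)] desc_star[OF w m(1)] by blast
  then have "{y, pos w} \<in> pyramid_edges Q V"
    unfolding m(2) by (rule edge_pos[OF w(1)])
  moreover have "lev y = n" using lev_pos[OF len_down[OF w(2) m(1)]] m(2) by simp
  ultimately show "y \<in> ascendants Q V (Suc n) (pos w)" by (simp add: ascendants_eq)
qed

lemma pos_flip_inj: "w \<in> W \<Longrightarrow> inj_on (\<lambda>m. pos (w \<circ> flip m)) S"
  by (intro inj_onI) (metis pos_inj W_right flip_cancel)

lemma label_pos:
  assumes w: "w \<in> pyr" "w \<in> len (Suc n)"
  shows "label Q V (pos w) = (\<Sum>m\<in>desc w. label Q V (pos (w \<circ> flip m)))"
proof -
  have "label Q V (pos w) = (\<Sum>y\<in>ascendants Q V (Suc n) (pos w). label Q V y)"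
    by (rule label_Suc) (use w vertices lev_pos in auto)
  then show ?thesis
    unfolding ascendants_pos[OF w] sum.reindex[OF pos_flip_inj[OF pyr_W[OF w(1)]]] by simp
qed

lemma card_planes_pos: "w \<in> W \<Longrightarrow> card (planes_at Q V (pos w)) = card (planes w)"
proof -
  assume w: "w \<in> W"
  have "inj_on ((`) g) A" for A
    using G_inj[OF g] by (meson inj_image_eq_iff inj_onI)
  then show ?thesis
    unfolding pos_def planes_at_image[OF g] using card_planes_at_base[OF w] by (metis card_image)
qed

lemma vertices_of_type_pos: "vertices_of_type Q V k e (Suc n) = pos ` typed (Suc n) k e"
proof -
  have "card (planes_at Q V (pos w)) = k \<and> card (ascendants Q V (Suc n) (pos w)) = e \<longleftrightarrow>
      card (planes w) = k \<and> card (desc w) = e" if w: "w \<in> pyr" "w \<in> len (Suc n)" for w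
    using card_planes_pos[OF pyr_W[OF w(1)]] card_image[OF pos_flip_inj[OF pyr_W[OF w(1)]]]
    unfolding ascendants_pos[OF w] by simp
  then show ?thesis
    unfolding vertices_of_type_def level_pos typed_def by blast
qed

definition hat :: "nat \<Rightarrow> nat \<Rightarrow> nat \<Rightarrow> nat" where
  "hat n k e = (\<Sum>w\<in>typed n k e. label Q V (pos w))"

lemma hat_vertices: "(\<Sum>x\<in>vertices_of_type Q V k e (Suc n). label Q V x) = hat (Suc n) k e"
proof -
  have "inj_on pos (typed (Suc n) k e)"
    by (rule inj_onI) (auto simp: typed_def pos_inj pyr_W)
  then show ?thesis
    unfolding vertices_of_type_pos hat_def by (simp add: sum.reindex)
qed

text \<open>Pascal's rule expands each label over the descents, and \<open>typed_children\<close>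
  regroups the pairs by parent.\<close>

lemma hat_children:
  "hat (Suc n) k e = (\<Sum>v\<in>pyr \<inter> len n. child_count (planes v) (desc v) k e * label Q V (pos v))"
proof -
  let ?C = "\<lambda>v. {m \<in> star (planes v) - desc v. card (planes v - {m}) = k \<and>
      card (insert m {a \<in> desc v. adj a m}) = e}"
  have fin: "finite (pyr \<inter> len n)" using finite_len by blast
  have "hat (Suc n) k e = (\<Sum>w\<in>typed (Suc n) k e. \<Sum>m\<in>desc w. label Q V (pos (w \<circ> flip m)))"
    unfolding hat_def by (rule sum.cong[OF refl], rule label_pos) (auto simp: typed_def simp del: len.simps)
  also have "\<dots> = (\<Sum>(w, m)\<in>(SIGMA w:typed (Suc n) k e. desc w). label Q V (pos (w \<circ> flip m)))"
    by (rule sum.Sigma) (simp_all add: finite_typed)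
  also have "\<dots> = (\<Sum>(v, m)\<in>(SIGMA v:pyr \<inter> len n. ?C v). label Q V (pos v))"
  proof -
    have "{(v, m). v \<in> pyr \<inter> len n \<and> m \<in> star (planes v) - desc v \<and>
        card (planes v - {m}) = k \<and> card (insert m {a \<in> desc v. adj a m}) = e}
        = (SIGMA v:pyr \<inter> len n. ?C v)" by blast
    from sum.reindex_bij_betw[OF typed_children[of n k e, unfolded this],
        of "\<lambda>(w, m). label Q V (pos (w \<circ> flip m))"]
    show ?thesis by (simp add: case_prod_unfold)
  qed
  also have "\<dots> = (\<Sum>v\<in>pyr \<inter> len n. \<Sum>m\<in>?C v. label Q V (pos v))"
    by (rule sum.Sigma[symmetric]) (simp_all add: fin)
  also have "\<dots> = (\<Sum>v\<in>pyr \<inter> len n. child_count (planes v) (desc v) k e * label Q V (pos v))"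
    by (simp add: child_count_def)
  finally show ?thesis .
qed

lemma hat_1: "hat 1 k e = (if (k, e) = (2, 1) then 3 else 0)"
proof -
  have "id \<in> pyr" "V \<in> pyramid_vertices Q V"
    unfolding vertices pos_def using pyr_id by (auto intro: image_eqI[of _ _ id])
  moreover have "pyr \<inter> len 0 = {id}" using pyr_id by auto
  ultimately have "hat 1 k e = child_count axes {} k e * label Q V (pos id)"
    using hat_children[of 0 k e] planes_id desc_id by simp
  then show ?thesis
    using label_base \<open>V \<in> pyramid_vertices Q V\<close> by (simp add: child_count_root pos_def)
qed

text \<open>Column \<open>i\<close> of \<open>child_row\<close> holds the coefficients for children
  of type \<open>type_list ! i\<close>. Parents start on level one, since the apex lies on three
  planes and has none of the types in the table.\<close>

lemma hat_step:
  assumes "i < 6"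
  shows "hat (Suc (Suc n)) (fst (type_list ! i)) (snd (type_list ! i)) =
    (\<Sum>t\<in>set type_list. child_row t ! i * hat (Suc n) (fst t) (snd t))"
proof -
  let ?k = "fst (type_list ! i)" and ?e = "snd (type_list ! i)"
  let ?P = "pyr \<inter> len (Suc n)"
  let ?ty = "\<lambda>v. (card (planes v), card (desc v))"
  have *: "?ty v \<in> set type_list \<and> child_count (planes v) (desc v) ?k ?e = child_row (?ty v) ! i"
    if v: "v \<in> ?P" for v
  proof -
    have vp: "v \<in> pyr" "v \<in> len (Suc n)" using v by blast+
    have D: "desc v \<noteq> {}" by (rule desc_nonempty[OF vp(2)])
    have ID: "\<forall>i\<in>planes v. \<forall>m\<in>desc v. adj i m" using desc_planes[OF vp] by blast
    have I: "planes v \<subset> axes" using planes_axes D ID no_common_neighbour by blast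
    note t = child_count_table[OF I desc_clique[OF vp(2)] D ID]
    have "child_row (?ty v) ! i = (\<lambda>(k, e). child_count (planes v) (desc v) k e) (type_list ! i)"
      unfolding t(2)[symmetric] by (rule nth_map) (use assms in \<open>simp add: type_list_def\<close>)
    then show ?thesis using t(1) by (simp add: case_prod_unfold)
  qed
  have "hat (Suc (Suc n)) ?k ?e = (\<Sum>v\<in>?P. child_row (?ty v) ! i * label Q V (pos v))"
    unfolding hat_children by (rule sum.cong) (use * in auto)
  also have "\<dots> = (\<Sum>t\<in>set type_list. \<Sum>v\<in>{v \<in> ?P. ?ty v = t}. child_row (?ty v) ! i * label Q V (pos v))"
  proof (rule sum.group[symmetric])
    show "finite ?P" using finite_len by (simp del: len.simps)
    show "finite (set type_list)" by simp
    show "?ty ` ?P \<subseteq> set type_list" using * by blast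
  qed
  also have "\<dots> = (\<Sum>t\<in>set type_list. child_row t ! i * hat (Suc n) (fst t) (snd t))"
  proof (rule sum.cong[OF refl])
    fix t :: "nat \<times> nat"
    have "{v \<in> ?P. ?ty v = t} = typed (Suc n) (fst t) (snd t)" by (auto simp: typed_def)
    then show "(\<Sum>v\<in>{v \<in> ?P. ?ty v = t}. child_row (?ty v) ! i * label Q V (pos v))
        = child_row t ! i * hat (Suc n) (fst t) (snd t)"
      by (auto simp: hat_def sum_distrib_left typed_def intro!: sum.cong)
  qed
  finally show ?thesis .
qed

lemma hat_recurrences:
  shows "hat (Suc (Suc n)) 1 2 = 2 * hat (Suc n) 1 2 + 2 * hat (Suc n) 1 1 + 2 * hat (Suc n) 2 1"
    and "hat (Suc (Suc n)) 1 1 = hat (Suc n) 1 2 + 2 * hat (Suc n) 1 1"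
    and "hat (Suc (Suc n)) 0 3 = hat (Suc n) 1 2 + 3 * hat (Suc n) 0 3 + 2 * hat (Suc n) 0 2"
    and "hat (Suc (Suc n)) 0 2 =
      hat (Suc n) 1 1 + 3 * hat (Suc n) 0 3 + 4 * hat (Suc n) 0 2 + 5 * hat (Suc n) 0 1"
    and "hat (Suc (Suc n)) 0 1 = 3 * hat (Suc n) 0 3 + 4 * hat (Suc n) 0 2 + 6 * hat (Suc n) 0 1"
    and "hat (Suc (Suc n)) 2 1 = hat (Suc n) 2 1"
  using hat_step[of 4 n] hat_step[of 3 n] hat_step[of 2 n] hat_step[of 1 n] hat_step[of 0 n]
    hat_step[of 5 n]
  by (simp_all add: type_list_def child_row_def)

text \<open>This sum starts with 3 and reproduces itself; multiplied by the coefficient 2 in the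
  recurrence for \<open>hat\<close> at \<open>(1, 2)\<close> it is the constant 6 of the
  theorem.\<close>

lemma hat_line: "hat (Suc n) 2 1 = 3"
proof (induction n)
  case 0
  show ?case using hat_1[of 2 1] by simp
next
  case (Suc n)
  then show ?case unfolding hat_recurrences(6) .
qed

end

theorem theorem4:
  fixes Q0 :: "mink set" and V0 :: mink
  assumes "Q0 \<in> cubes" and "V0 \<in> Q0"
  shows "(a_hat Q0 V0 1 = 0 \<and> b_hat Q0 V0 1 = 0 \<and> c_hat Q0 V0 1 = 0 \<and>
          d_hat Q0 V0 1 = 0 \<and> e_hat Q0 V0 1 = 0) \<and>
    (\<forall>n\<ge>1.
      a_hat Q0 V0 (n + 1) = 2 * a_hat Q0 V0 n + 2 * b_hat Q0 V0 n + 6 \<and>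
      b_hat Q0 V0 (n + 1) = a_hat Q0 V0 n + 2 * b_hat Q0 V0 n \<and>
      c_hat Q0 V0 (n + 1) = a_hat Q0 V0 n + 3 * c_hat Q0 V0 n + 2 * d_hat Q0 V0 n \<and>
      d_hat Q0 V0 (n + 1) =
        b_hat Q0 V0 n + 3 * c_hat Q0 V0 n + 4 * d_hat Q0 V0 n + 5 * e_hat Q0 V0 n \<and>
      e_hat Q0 V0 (n + 1) = 3 * c_hat Q0 V0 n + 4 * d_hat Q0 V0 n + 6 * e_hat Q0 V0 n)"
proof -
  obtain g where g: "g \<in> G" and Q0: "Q0 = g ` base_cube" and V0: "V0 = g corner"
    using cube_vertex_base[OF assms] .
  interpret placed_pyramid g by (rule placed_pyramid.intro[OF g])
  have hats: "a_hat Q0 V0 (Suc n) = hat (Suc n) 1 2" "b_hat Q0 V0 (Suc n) = hat (Suc n) 1 1"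
    "c_hat Q0 V0 (Suc n) = hat (Suc n) 0 3" "d_hat Q0 V0 (Suc n) = hat (Suc n) 0 2"
    "e_hat Q0 V0 (Suc n) = hat (Suc n) 0 1" for n
    unfolding a_hat_def b_hat_def c_hat_def d_hat_def e_hat_def Q0 V0 by (rule hat_vertices)+
  have "a_hat Q0 V0 1 = 0 \<and> b_hat Q0 V0 1 = 0 \<and> c_hat Q0 V0 1 = 0 \<and>
      d_hat Q0 V0 1 = 0 \<and> e_hat Q0 V0 1 = 0"
    using hats[of 0] hat_1 by simp
  moreover have "a_hat Q0 V0 (n + 1) = 2 * a_hat Q0 V0 n + 2 * b_hat Q0 V0 n + 6 \<and>
      b_hat Q0 V0 (n + 1) = a_hat Q0 V0 n + 2 * b_hat Q0 V0 n \<and>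
      c_hat Q0 V0 (n + 1) = a_hat Q0 V0 n + 3 * c_hat Q0 V0 n + 2 * d_hat Q0 V0 n \<and>
      d_hat Q0 V0 (n + 1) =
        b_hat Q0 V0 n + 3 * c_hat Q0 V0 n + 4 * d_hat Q0 V0 n + 5 * e_hat Q0 V0 n \<and>
      e_hat Q0 V0 (n + 1) = 3 * c_hat Q0 V0 n + 4 * d_hat Q0 V0 n + 6 * e_hat Q0 V0 n"
    if n: "n \<ge> 1" for n
  proof -
    obtain k where k: "n = Suc k" using n by (cases n) auto
    show ?thesis
      unfolding k Suc_eq_plus1[symmetric] hats hat_recurrences(1-5)[of k] hat_line by simp
  qed
  ultimately show ?thesis by blast
qed

end
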